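(* Let $n\ge 1$ be an integer, let $q\in\mathbb{C}^*$ with $|q|<1$, let $v\in\mathbb{C}^*$, and suppose that $|a_i|<1$ $(i=1,\ldots,6)$ and $|t|<1$. Let $$ \begin{aligned} J&=\frac{1}{n!}\int_{\mathbb{T}^{n}} \prod_{i=1}^{n} \bigg[ \frac{(z_{i}^{2};q)_{\infty}}{(qz_{i}^{2};q)_{\infty}} \frac{\theta(t^{n-1}a_{1}a_{2}vz_{i}^{-1}, vz_{i};q)}{\prod_{j=1}^{2}(a_jz_{i},a_jz_{i}^{-1};q)_{\infty}} \prod_{k=3}^{6}\frac{(qa_{k}^{-1}z_{i};q)_{\infty}}{(a_{k}z_{i};q)_{\infty}} \bigg]\\ &\qquad\times\prod_{1\le j< k\le n} \frac{(z_{j}z_{k};q)_{\infty}}{(qz_{j}z_{k};q)_{\infty}} \frac{(z_{j}/z_{k},z_{k}/z_{j};q)_{\infty}}{(tz_{j}/z_{k},tz_{k}/z_{j};q)_{\infty}} \frac{(qt^{-1}z_{j}z_{k};q)_{\infty}}{(tz_{j}z_{k};q)_{\infty}} \,\varpi(z) \end{aligned} $$ and $$ \begin{aligned} I&=\frac{1}{2^nn!}\int_{\mathbb{T}^n} \prod_{i=1}^n\frac{(z_i^2,z_i^{-2},qa_6^{-1}z_i,qa_6^{-1}z_i^{-1};q)_\infty} {\prod_{m=1}^5(a_mz_i,a_mz_i^{-1};q)_\infty}\\ &\qquad\times \prod_{1\le j<k\le n}\frac{(z_jz_k^{-1},z_j^{-1}z_k,z_jz_k,z_j^{-1}z_k^{-1};q)_\infty}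 {(tz_jz_k^{-1},tz_j^{-1}z_k,tz_jz_k,tz_j^{-1}z_k^{-1};q)_\infty} \,\varpi(z). \end{aligned} $$ Under the balancing condition $q=a_1a_2a_3a_4a_5a_6t^{2n-2}$ (and provided $I\ne 0$, so that the quotient is defined), $$ \frac{J}{I} =\prod_{i=1}^{n}\frac{\prod_{l=1}^{2}\theta(t^{i-1}a_{l}v;q)\prod_{3\le j<k\le 5}\theta(t^{i-1}a_{j}a_{k};q)} {\prod_{l=1}^{2}\theta(t^{i-1}a_{l}a_{6};q)}. $$
   Context: Notation: $(u;q)_\infty=\prod_{i=0}^\infty(1-q^iu)$, $(u_1,\ldots,u_m;q)_\infty=(u_1;q)_\infty\cdots(u_m;q)_\infty$, $\theta(u;q)=(u,q/u;q)_\infty$ for $u\in\mathbb{C}^*$, $\theta(u_1,\ldots,u_m;q)=\theta(u_1;q)\cdots\theta(u_m;q)$. Quotients of the form $(u;q)_\infty/(qu;q)_\infty$ are understood as $1-u$. The measure is $\varpi(z)=\frac{1}{(2\pi\sqrt{-1})^n}\frac{dz_1}{z_1}\cdots\frac{dz_n}{z_n}$, and $\mathbb{T}^n=\{(z_1,\ldots,z_n)\in\mathbb{C}^n : |z_i|=1\ (i=1,\ldots,n)\}$ is the $n$-fold product of the unit circle, each traversed in the positive direction. *)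

theory Defs
  imports "HOL-Complex_Analysis.Complex_Analysis"
begin

definition qpoch :: "complex \<Rightarrow> complex \<Rightarrow> complex" where
  "qpoch u q = (\<Prod>i. 1 - q ^ i * u)"

definition theta :: "complex \<Rightarrow> complex \<Rightarrow> complex" where
  "theta u q = qpoch u q * qpoch (q / u) q"

text \<open>
  The quotient of \<open>qpoch u q\<close> by \<open>qpoch (q * u) q\<close> is by convention \<open>1 - u\<close>; the lemma
  \<open>qpoch_quot_eq\<close> below shows that this is the actual quotient whenever the denominator
  is nonzero.
\<close>

definition qpoch_quot :: "complex \<Rightarrow> complex \<Rightarrow> complex" where
  "qpoch_quot u q = 1 - u"

lemma qpoch_convergent:
  fixes q u :: complex
  assumes "norm q < 1"
  shows "convergent_prod (\<lambda>i. 1 - q ^ i * u)"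
proof -
  have "summable (\<lambda>i. norm ((1 - q ^ i * u) - 1))"
    using assms summable_mult2[OF summable_geometric[of "norm q"], of "norm u"]
    by (simp add: norm_mult norm_power)
  then show ?thesis
    by (intro abs_convergent_prod_imp_convergent_prod summable_imp_abs_convergent_prod)
qed

lemma qpoch_quot_eq:
  assumes q: "norm q < 1" and nz: "qpoch (q * u) q \<noteq> 0"
  shows "qpoch u q / qpoch (q * u) q = qpoch_quot u q"
proof -
  have "(\<lambda>i. 1 - q ^ i * (q * u)) has_prod qpoch (q * u) q"
    unfolding qpoch_def using qpoch_convergent[OF q] by (rule convergent_prod_has_prod)
  then have *: "(\<lambda>i. 1 - q ^ Suc i * u) has_prod qpoch (q * u) q"
    by (simp add: mult_ac)
  have "qpoch u q = (1 - u) * qpoch (q * u) q"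
  proof (cases "u = 1")
    case True
    have "(\<lambda>i. 1 - q ^ i * u) has_prod qpoch u q"
      unfolding qpoch_def using qpoch_convergent[OF q] by (rule convergent_prod_has_prod)
    then have "qpoch u q = 0"
      using has_prod_0_iff True
      by (metis (mono_tags, lifting) cancel_comm_monoid_add_class.diff_cancel has_prod_eq_0_iff
          mult_1 power_0 rangeI)
    with True show ?thesis by simp
  next
    case False
    then have "(\<lambda>i. 1 - q ^ i * u) has_prod (qpoch (q * u) q * (1 - q ^ 0 * u))"
      using * by (subst has_prod_Suc_iff[symmetric]) auto
    then show ?thesis
      unfolding qpoch_def by (simp add: has_prod_unique[symmetric] mult.commute)
  qed
  with nz show ?thesis by (simp add: qpoch_quot_def)
qed

text \<open>
  The integral of \<open>f z\<close> over the \<open>n\<close>-fold product of the positively oriented unit circle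
  against the form \<open>dz_1 / z_1 ... dz_n / z_n\<close>, normalised by the \<open>n\<close>-th power of \<open>2 * pi * i\<close>.
  As for \<open>contour_integral\<close>, it is computed by pulling back along the parametrisation
  \<open>circlepath 0 1\<close> of each circle. Points of the torus are functions on \<open>{1..n}\<close>.
\<close>

definition torus_integral :: "nat \<Rightarrow> ((nat \<Rightarrow> complex) \<Rightarrow> complex) \<Rightarrow> complex" where
  "torus_integral n f =
     1 / (2 * of_real pi * \<i>) ^ n *
     (\<integral>x. f (\<lambda>i\<in>{1..n}. circlepath 0 1 (x i)) *
          (\<Prod>i=1..n. vector_derivative (circlepath 0 1) (at (x i)) / circlepath 0 1 (x i))
      \<partial>(Pi\<^sub>M {1..n} (\<lambda>_. restrict_space lborel {0..1})))"

lemma torus_integral_cis: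
  "torus_integral n f =
     (\<integral>x. f (\<lambda>i\<in>{1..n}. cis (2 * pi * x i))
      \<partial>(Pi\<^sub>M {1..n} (\<lambda>_. restrict_space lborel {0..1})))"
proof -
  have "vector_derivative (circlepath 0 1) (at t) / circlepath 0 1 t = 2 * of_real pi * \<i>" for t
    unfolding vector_derivative_circlepath by (simp add: circlepath)
  moreover have "circlepath 0 1 = (\<lambda>t. cis (2 * pi * t))"
    by (auto simp: circlepath cis_conv_exp fun_eq_iff mult_ac)
  ultimately show ?thesis
    by (simp add: torus_integral_def)
qed

text \<open>The parameters are \<open>a 1, ..., a 6\<close>.\<close>

definition J_integrand ::
  "nat \<Rightarrow> complex \<Rightarrow> complex \<Rightarrow> complex \<Rightarrow> (nat \<Rightarrow> complex) \<Rightarrow> (nat \<Rightarrow> complex) \<Rightarrow> complex" where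
  "J_integrand n q t v a z =
     (\<Prod>i=1..n.
        qpoch_quot ((z i)\<^sup>2) q *
        (theta (t ^ (n - 1) * a 1 * a 2 * v / z i) q * theta (v * z i) q /
           (\<Prod>j=1..2. qpoch (a j * z i) q * qpoch (a j / z i) q)) *
        (\<Prod>k=3..6. qpoch (q / a k * z i) q / qpoch (a k * z i) q)) *
     (\<Prod>j=1..n. \<Prod>k\<in>{j<..n}.
        qpoch_quot (z j * z k) q *
        (qpoch (z j / z k) q * qpoch (z k / z j) q /
           (qpoch (t * z j / z k) q * qpoch (t * z k / z j) q)) *
        (qpoch (q / t * z j * z k) q / qpoch (t * z j * z k) q))"

definition J_int ::
  "nat \<Rightarrow> complex \<Rightarrow> complex \<Rightarrow> complex \<Rightarrow> (nat \<Rightarrow> complex) \<Rightarrow> complex" where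
  "J_int n q t v a = 1 / fact n * torus_integral n (J_integrand n q t v a)"

definition I_integrand ::
  "nat \<Rightarrow> complex \<Rightarrow> complex \<Rightarrow> (nat \<Rightarrow> complex) \<Rightarrow> (nat \<Rightarrow> complex) \<Rightarrow> complex" where
  "I_integrand n q t a z =
     (\<Prod>i=1..n.
        qpoch ((z i)\<^sup>2) q * qpoch (1 / (z i)\<^sup>2) q *
        qpoch (q / a 6 * z i) q * qpoch (q / a 6 / z i) q /
        (\<Prod>m=1..5. qpoch (a m * z i) q * qpoch (a m / z i) q)) *
     (\<Prod>j=1..n. \<Prod>k\<in>{j<..n}.
        (qpoch (z j / z k) q * qpoch (z k / z j) q *
         qpoch (z j * z k) q * qpoch (1 / (z j * z k)) q) /
        (qpoch (t * z j / z k) q * qpoch (t * z k / z j) q *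
         qpoch (t * z j * z k) q * qpoch (t / (z j * z k)) q))"

definition I_int :: "nat \<Rightarrow> complex \<Rightarrow> complex \<Rightarrow> (nat \<Rightarrow> complex) \<Rightarrow> complex" where
  "I_int n q t a = 1 / (2 ^ n * fact n) * torus_integral n (I_integrand n q t a)"

end

theory Submission
  imports Defs "HOL-Probability.Infinite_Product_Measure" "HOL-Combinatorics.Permutations"
begin

text \<open>
  As a function of \<open>v\<close>, both \<open>J\<close> and the product of the \<open>theta (t\<^sup>i\<^sup>-\<^sup>1 a\<^sub>l v)\<close>, \<open>l = 1, 2\<close>, are
  holomorphic on the punctured plane and quasi-periodic with the same multiplier. Hence they are proportional
  as soon as \<open>J\<close> vanishes at the points \<open>v = 1 / (a\<^sub>l t\<^sup>m)\<close> with \<open>0 \<le> m < n\<close>, provided these are distinct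
  modulo powers of \<open>q\<close>; genericity is removed by continuity in the parameters.

  At such a point the integrand becomes \<open>\<Delta>(z) \<Prod>\<^sub>i \<pi>(1 / z\<^sub>i) z\<^sub>i \<phi>(z)\<close>, where \<open>\<Delta>\<close> is the Macdonald
  weight of type A, \<open>\<phi>\<close> is symmetric and holomorphic on the closed polydisc, and \<open>\<Prod>\<^sub>i \<pi>(1 / z\<^sub>i)\<close> is
  Cauchy's kernel in \<open>n\<close> against \<open>n - 1\<close> variables. The alternating sum of the Macdonald operators
  annihilates this kernel, is self-adjoint for \<open>\<Delta>\<close>, and acts triangularly with nonzero diagonal entries
  on the symmetric functions divisible by \<open>z\<^sub>1 \<dots> z\<^sub>n\<close>. So the integral is zero.

  The factor of proportionality is read off at \<open>v = a\<^sub>6\<close>, where averaging the integrand over the inversions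
  \<open>z\<^sub>i \<mapsto> 1 / z\<^sub>i\<close> gives a constant multiple of the integrand of \<open>I\<close>, by a theta function identity
  which is proved by induction on \<open>n\<close> with Liouville's theorem.
\<close>

subsection \<open>The functions qpoch and theta\<close>

text \<open>At v = 1 / (a_1 t^m) the kernel is \<pi>(x) = (a_1 t^m x, a_2 t^(n-1-m) x; q) / (a_1 x,
  a_2 x; q). It splits into n - 1 factors (t y x; q) / (y x; q), where y runs through a_1 t^i with i
  < m and a_2 t^i with i < n - 1 - m. In Macdonald polynomials Cauchy's kernel then involves only
  partitions with at most n - 1 parts; the eigenvalue, the product of the 1 - t^(n-i)
  q^(\<lambda>_i), has the factor 1 - 1 on each of them, and no zero factor once all \<lambda>_i
  \<ge> 1. Macdonald polynomials are never constructed: annihilation becomes a linear dependence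
  between columns of a determinant, and self-adjointness a shift of contours by the factor 1/q.

  The balancing condition enters at v = a_6: it makes the symmetrised theta quotient elliptic in
  each variable. It also puts t^(i-1) a_l a_6 strictly between |q| and 1 in absolute value, so that
  the final denominators do not vanish.

  Genericity is controlled through absolute values alone: parameters or variables are scaled by
  powers of 1 + s, and for small s > 0 the relevant norms avoid all powers of |q|.\<close>

lemma qpoch_LIMSEQ:
  assumes "norm q < 1"
  shows "(\<lambda>N. \<Prod>i<N. 1 - q ^ i * u) \<longlonglongrightarrow> qpoch u q"
proof -
  have "(\<lambda>n. \<Prod>i\<le>n. 1 - q ^ i * u) \<longlonglongrightarrow> qpoch u q"
    unfolding qpoch_def by (rule convergent_prod_LIMSEQ[OF qpoch_convergent[OF assms]])
  then show ?thesis
    by (subst filterlim_sequentially_Suc[symmetric]) (simp only: lessThan_Suc_atMost)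
qed

lemma qpoch_rec:
  assumes "norm q < 1"
  shows "qpoch u q = (1 - u) * qpoch (q * u) q"
proof (rule LIMSEQ_unique)
  show "(\<lambda>N. \<Prod>i<Suc N. 1 - q ^ i * u) \<longlonglongrightarrow> qpoch u q"
    using qpoch_LIMSEQ[OF assms, of u] by (rule LIMSEQ_Suc)
  have "(\<lambda>N. (1 - u) * (\<Prod>i<N. 1 - q ^ i * (q * u))) \<longlonglongrightarrow> (1 - u) * qpoch (q * u) q"
    by (intro tendsto_intros qpoch_LIMSEQ assms)
  then show "(\<lambda>N. \<Prod>i<Suc N. 1 - q ^ i * u) \<longlonglongrightarrow> (1 - u) * qpoch (q * u) q"
    unfolding prod.lessThan_Suc_shift by (simp add: mult_ac)
qed

lemma qpoch_eq_0_iff: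
  assumes "norm q < 1"
  shows "qpoch u q = 0 \<longleftrightarrow> (\<exists>i. q ^ i * u = 1)"
proof -
  have "(\<lambda>i. 1 - q ^ i * u) has_prod qpoch u q"
    unfolding qpoch_def using qpoch_convergent[OF assms] by (rule convergent_prod_has_prod)
  then have "qpoch u q = 0 \<longleftrightarrow> 0 \<in> range (\<lambda>i. 1 - q ^ i * u)"
    by (rule has_prod_eq_0_iff)
  also have "\<dots> \<longleftrightarrow> (\<exists>i. q ^ i * u = 1)"
    by (force simp: image_iff)
  finally show ?thesis .
qed

lemma qpoch_nonzero:
  assumes "norm q < 1" "norm u < 1"
  shows "qpoch u q \<noteq> 0"
proof -
  have "norm (q ^ i * u) < 1" for i
    using mult_mono[of "norm q ^ i" 1 "norm u" "norm u"] assms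
    by (auto simp: norm_mult norm_power power_le_one)
  then show ?thesis
    unfolding qpoch_eq_0_iff[OF assms(1)] by (metis less_irrefl norm_one)
qed

text \<open>On a disc of radius 1 the terms \<open>q ^ i * u\<close> are dominated by a geometric
  series, so the partial products converge uniformly there.\<close>

lemma qpoch_holomorphic:
  assumes q: "norm q < 1"
  shows "(\<lambda>u. qpoch u q) holomorphic_on UNIV"
proof (rule holomorphic_uniform_sequence)
  fix x :: complex
  show "\<exists>d>0. cball x d \<subseteq> UNIV \<and>
      uniform_limit (cball x d) (\<lambda>N u. \<Prod>i<N. 1 - q ^ i * u) (\<lambda>u. qpoch u q) sequentially"
  proof (intro exI[of _ 1] conjI)
    have bd: "norm (norm (- (q ^ i * u))) \<le> norm q ^ i * (norm x + 1)" if "u \<in> cball x 1" for i u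
    proof -
      have "norm u \<le> norm x + 1"
        using that norm_triangle_ineq2[of u x] by (auto simp: dist_norm norm_minus_commute)
      then show ?thesis
        by (auto simp: norm_mult norm_power intro!: mult_left_mono)
    qed
    have "summable (\<lambda>i. norm q ^ i * (norm x + 1))"
      using q by (intro summable_mult2 summable_geometric) simp
    then have "uniformly_convergent_on (cball x 1) (\<lambda>N u. \<Sum>i<N. norm (- (q ^ i * u)))"
      by (intro Weierstrass_m_test'[of _ _ "\<lambda>i. norm q ^ i * (norm x + 1)"] bd)
    then have "uniformly_convergent_on (cball x 1) (\<lambda>N u. \<Prod>i<N. 1 + - (q ^ i * u))"
      by (intro uniformly_convergent_on_prod) (auto intro!: continuous_intros)
    then obtain l where l: "uniform_limit (cball x 1) (\<lambda>N u. \<Prod>i<N. 1 - q ^ i * u) l sequentially"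
      by (auto simp: uniformly_convergent_on_def)
    have "l u = qpoch u q" if "u \<in> cball x 1" for u
      using tendsto_uniform_limitI[OF l that] qpoch_LIMSEQ[OF q, of u] by (rule LIMSEQ_unique)
    with l show "uniform_limit (cball x 1) (\<lambda>N u. \<Prod>i<N. 1 - q ^ i * u) (\<lambda>u. qpoch u q) sequentially"
      by (metis (no_types, lifting) uniform_limit_cong')
  qed auto
qed (auto intro!: holomorphic_intros)

lemma theta_quasi_inverse: "u \<noteq> 0 \<Longrightarrow> q \<noteq> 0 \<Longrightarrow> theta (q / u) q = theta u q"
  by (simp add: theta_def mult.commute)

locale nome =
  fixes q :: complex
  assumes q_nz [simp]: "q \<noteq> 0" and q_less: "norm q < 1"
begin

abbreviation "qp u \<equiv> qpoch u q"
abbreviation "th u \<equiv> theta u q"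

lemmas qp_rec = qpoch_rec[OF q_less]
lemmas qp_eq_0_iff = qpoch_eq_0_iff[OF q_less]
lemmas qp_nonzero = qpoch_nonzero[OF q_less]

lemma qp_holomorphic [holomorphic_intros]:
  assumes "f holomorphic_on A"
  shows "(\<lambda>z. qp (f z)) holomorphic_on A"
  using holomorphic_on_compose[OF assms holomorphic_on_subset[OF qpoch_holomorphic[OF q_less]]]
  by (auto simp: o_def)

lemma qp_continuous [continuous_intros]:
  assumes "continuous_on A f"
  shows "continuous_on A (\<lambda>z. qp (f z))"
  using continuous_on_compose[OF assms continuous_on_subset[OF
      holomorphic_on_imp_continuous_on[OF qpoch_holomorphic[OF q_less]]]]
  by (auto simp: o_def)

lemma th_holomorphic [holomorphic_intros]:
  assumes "f holomorphic_on A" "\<And>z. z \<in> A \<Longrightarrow> f z \<noteq> 0"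
  shows "(\<lambda>z. th (f z)) holomorphic_on A"
  unfolding theta_def by (intro holomorphic_intros assms)

lemma th_continuous [continuous_intros]:
  assumes "continuous_on A f" "\<And>z. z \<in> A \<Longrightarrow> f z \<noteq> 0"
  shows "continuous_on A (\<lambda>z. th (f z))"
  unfolding theta_def by (intro continuous_intros assms ballI)

text \<open>Multiplied by \<open>1 - u\<close>, both sides become \<open>qp u * qp (1 / u)\<close>.
  This settles all \<open>u\<close> except \<open>u = 1\<close>, where both sides are zero.\<close>

lemma th_q:
  assumes "u \<noteq> 0"
  shows "th (q * u) = - th u / u"
proof -
  have "th (q * u) * (1 - u) = qp u * qp (1 / u)"
    by (simp add: theta_def qp_rec[of u])
  also have "\<dots> = qp u * ((1 - 1 / u) * qp (q / u))"
    by (subst qp_rec[of "1 / u"]) simp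
  also have "\<dots> = (- th u / u) * (1 - u)"
    using assms by (simp add: theta_def divide_simps) (simp add: algebra_simps)
  finally show ?thesis
  proof (cases "u = 1")
    case True
    have "qp 1 = 0" by (subst qp_rec) simp
    then show ?thesis using True by (simp add: theta_def)
  next
    case False
    assume "th (q * u) * (1 - u) = (- th u / u) * (1 - u)"
    then show ?thesis using False by (metis mult_right_cancel right_minus_eq)
  qed
qed

lemma th_inverse:
  assumes "u \<noteq> 0"
  shows "th (1 / u) = - th u / u"
  using th_q[OF assms] theta_quasi_inverse[of "q * u" q] assms by (simp add: divide_simps)

lemma th_div_q:
  assumes "u \<noteq> 0"
  shows "th (u / q) = - (u / q) * th u"
  using th_q[of "u / q"] assms by (simp add: field_simps)

lemma th_one [simp]: "th 1 = 0"
proof -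
  have "qp 1 = 0" by (subst qp_rec) simp
  then show ?thesis by (simp add: theta_def)
qed

text \<open>The factor \<open>qp u\<close> supplies the powers of \<open>q\<close> with exponent at
  most 0, and \<open>qp (q / u)\<close> those with exponent at least 1; each integer exponent arises
  from exactly one of them.\<close>

lemma th_eq_0_iff:
  assumes "u \<noteq> 0"
  shows "th u = 0 \<longleftrightarrow> (\<exists>j. u = q powi j)"
proof
  assume "th u = 0"
  then consider i where "q ^ i * u = 1" | i where "q ^ i * (q / u) = 1"
    by (auto simp: theta_def qp_eq_0_iff)
  then show "\<exists>j. u = q powi j"
  proof cases
    case 1
    then show ?thesis
      by (intro exI[of _ "- int i"]) (auto simp: power_int_minus field_simps)
  next
    case 2
    then show ?thesis using assms
      by (intro exI[of _ "int (Suc i)"]) (auto simp: power_int_def nat_add_distrib field_simps)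
  qed
next
  assume "\<exists>j. u = q powi j"
  then obtain j where j: "u = q powi j" by blast
  show "th u = 0"
  proof (cases "j \<le> 0")
    case True
    then have "q ^ nat (- j) * u = 1"
      unfolding j by (auto simp: power_int_def simp flip: power_mult_distrib)
    then show ?thesis by (auto simp: theta_def qp_eq_0_iff)
  next
    case False
    then obtain i where "j = int (Suc i)" by (metis not_le zero_less_imp_eq_int gr0_implies_Suc of_nat_0_less_iff)
    then have "q ^ i * (q / u) = 1"
      unfolding j by (auto simp: power_int_def nat_add_distrib)
    then show ?thesis by (auto simp: theta_def qp_eq_0_iff)
  qed
qed

text \<open>A test on absolute values only, so that every genericity condition can be met by a real
  rescaling.\<close>

lemma th_nonzero_norm:
  assumes "u \<noteq> 0" "norm u \<notin> range (\<lambda>j. norm q powi j)"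
  shows "th u \<noteq> 0"
  using assms by (auto simp: th_eq_0_iff norm_power_int)

subsection \<open>Quasi-periodic functions with given zeros\<close>

definition simple_zeros :: "(complex \<Rightarrow> complex) \<Rightarrow> bool" where
  "simple_zeros f \<longleftrightarrow> (\<forall>z. z \<noteq> 0 \<longrightarrow> f z = 0 \<longrightarrow> deriv f z \<noteq> 0)"

text \<open>Only vanishing is transported along the orbit under powers of \<open>q\<close>, so the
  nonzero multiplier may vary with the point. This moves a zero to a convenient representative of
  its orbit.\<close>

lemma quasi_periodic_zero:
  assumes "\<And>z. z \<noteq> 0 \<Longrightarrow> \<exists>m. m \<noteq> 0 \<and> P (q * z) = m * (P z :: complex)" and "z \<noteq> 0"
  shows "P (q powi j * z) = 0 \<longleftrightarrow> P z = 0"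
proof (induction j rule: int_induct[where k = 0])
  case (step1 i)
  have eq: "q powi (i + 1) * z = q * (q powi i * z)"
    by (simp add: power_int_add)
  show ?case
    unfolding eq using assms(1)[of "q powi i * z"] step1 \<open>z \<noteq> 0\<close> by auto
next
  case (step2 i)
  have eq: "q powi i * z = q * (q powi (i - 1) * z)"
    by (simp add: power_int_diff)
  show ?case
    using assms(1)[of "q powi (i - 1) * z"] step2 \<open>z \<noteq> 0\<close> unfolding eq by auto
qed simp

lemma has_deriv_open:
  assumes "f holomorphic_on - {0}" "z \<noteq> (0::complex)"
  shows "(f has_field_derivative deriv f z) (at z)"
  using assms by (intro holomorphic_derivI[of _ "- {0}"]) auto

lemma simple_zeros_mult:
  assumes f: "f holomorphic_on - {0}" and g: "g holomorphic_on - {0}"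
    and "simple_zeros f" "simple_zeros g"
    and "\<And>z. z \<noteq> 0 \<Longrightarrow> f z = 0 \<Longrightarrow> g z \<noteq> 0"
  shows "simple_zeros (\<lambda>z. f z * g z)"
  unfolding simple_zeros_def
proof (intro allI impI)
  fix z assume z: "z \<noteq> 0" "f z * g z = 0"
  have "deriv (\<lambda>z. f z * g z) z = f z * deriv g z + deriv f z * g z"
    using has_deriv_open[OF f z(1)] has_deriv_open[OF g z(1)]
    by (intro DERIV_imp_deriv DERIV_mult')
  moreover have "f z = 0 \<Longrightarrow> deriv f z \<noteq> 0" "g z = 0 \<Longrightarrow> deriv g z \<noteq> 0" "f z = 0 \<Longrightarrow> g z \<noteq> 0"
    using assms(3-5) z(1) unfolding simple_zeros_def by blast+
  ultimately show "deriv (\<lambda>z. f z * g z) z \<noteq> 0"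
    using z(2) by (cases "f z = 0") simp_all
qed

lemma simple_zeros_prod:
  assumes "finite A" and "\<And>i. i \<in> A \<Longrightarrow> f i holomorphic_on - {0}"
    and "\<And>i. i \<in> A \<Longrightarrow> simple_zeros (f i)"
    and "\<And>i j z. i \<in> A \<Longrightarrow> j \<in> A \<Longrightarrow> i \<noteq> j \<Longrightarrow> z \<noteq> 0 \<Longrightarrow> f i z = 0 \<Longrightarrow> f j z \<noteq> 0"
  shows "simple_zeros (\<lambda>z. \<Prod>i\<in>A. f i z)"
  using assms
proof (induction A rule: finite_induct)
  case (insert a A)
  have "simple_zeros (\<lambda>z. f a z * (\<Prod>i\<in>A. f i z))"
  proof (rule simple_zeros_mult[of "f a" "\<lambda>z. \<Prod>i\<in>A. f i z"])
    show "simple_zeros (\<lambda>z. \<Prod>i\<in>A. f i z)"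
      by (rule insert.IH) (blast intro: insert.prems(1,2), blast intro: insert.prems(1,2), metis insert.prems(3) insertI2)
  next
    fix z :: complex assume "z \<noteq> 0" "f a z = 0"
    then show "(\<Prod>i\<in>A. f i z) \<noteq> 0"
      using insert.hyps insert.prems(3)[of a _ z] by (auto simp: prod_zero_iff)
  qed (use insert.prems in \<open>auto intro!: holomorphic_intros\<close>)
  then show ?case using insert by simp
qed (simp add: simple_zeros_def)

text \<open>At a zero, differentiating \<open>th (q * z) = - th z / z\<close> leaves only the term
  with the derivative of \<open>th\<close>, so simplicity passes from \<open>z\<close> to
  \<open>q * z\<close> and back. At 1 the factor \<open>1 - u\<close> of \<open>th\<close> gives the
  derivative \<open>- (qp q * qp q)\<close>, which is nonzero.\<close>

lemma simple_zeros_th: "simple_zeros th"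
  unfolding simple_zeros_def
proof (intro allI impI)
  have th_holo: "th holomorphic_on - {0}"
    by (intro th_holomorphic holomorphic_intros) auto
  have shift: "deriv th (q * z) = 0 \<longleftrightarrow> deriv th z = 0" if "z \<noteq> 0" "th z = 0" for z
  proof -
    have "((\<lambda>z. th (q * z)) has_field_derivative deriv th (q * z) * q) (at z)"
      using has_deriv_open[OF th_holo, of "q * z"] that
      by (intro DERIV_chain2[of th]) (auto intro!: derivative_eq_intros)
    moreover have "((\<lambda>z. - th z / z) has_field_derivative - deriv th z / z) (at z)"
      using has_deriv_open[OF th_holo that(1)] that
      by (auto intro!: derivative_eq_intros simp: field_simps)
    moreover have "\<forall>\<^sub>F z in nhds z. th (q * z) = - th z / z"
      using eventually_nhds_in_open[of "- {0}" z] that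
      by (auto elim!: eventually_mono simp: th_q open_Compl)
    ultimately have "deriv th (q * z) * q = - deriv th z / z"
      using DERIV_cong_ev[OF refl _ refl, of "\<lambda>z. th (q * z)" "\<lambda>z. - th z / z" z] DERIV_unique by blast
    then show ?thesis using that by (auto simp: field_simps)
  qed
  have "deriv th 1 \<noteq> 0"
  proof -
    have "((\<lambda>u. (1 - u) * (qp (q * u) * qp (q / u))) has_field_derivative - (qp q * qp q)) (at 1)"
    proof -
      have "(\<lambda>u. qp (q * u) * qp (q / u)) holomorphic_on - {0}"
        by (intro holomorphic_intros) auto
      moreover have "((\<lambda>u. 1 - u) has_field_derivative - 1) (at (1::complex))"
        by (auto intro!: derivative_eq_intros)
      ultimately show ?thesis
        using DERIV_mult[OF _ has_deriv_open, of "\<lambda>u. 1 - u" "- 1" 1] by fastforce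
    qed
    then have "deriv th 1 = - (qp q * qp q)"
      by (intro DERIV_imp_deriv) (simp add: theta_def qp_rec[symmetric] mult.assoc[symmetric])
    then show ?thesis using qp_nonzero[OF q_less] by simp
  qed
  moreover have "deriv th (q powi j) = 0 \<longleftrightarrow> deriv th 1 = 0" for j
  proof (induction j rule: int_induct[where k = 0])
    case (step1 i)
    then show ?case
      using shift[of "q powi i"] by (auto simp: power_int_add mult.commute th_eq_0_iff)
  next
    case (step2 i)
    have "q powi i = q * q powi (i - 1)" by (simp add: power_int_diff)
    then show ?case
      using shift[of "q powi (i - 1)"] step2 by (auto simp: th_eq_0_iff)
  qed simp
  moreover fix z assume "z \<noteq> 0" "th z = 0"
  ultimately show "deriv th z \<noteq> 0"
    by (auto simp: th_eq_0_iff)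
qed

lemma simple_zeros_th_scale:
  assumes "c \<noteq> 0"
  shows "simple_zeros (\<lambda>z. th (c * z))"
  unfolding simple_zeros_def
proof (intro allI impI)
  fix z assume z: "z \<noteq> 0" "th (c * z) = 0"
  have th_holo: "th holomorphic_on - {0}"
    by (intro th_holomorphic holomorphic_intros) auto
  have "((\<lambda>z. th (c * z)) has_field_derivative deriv th (c * z) * c) (at z)"
    using has_deriv_open[OF th_holo, of "c * z"] z assms
    by (intro DERIV_chain2[of th]) (auto intro!: derivative_eq_intros)
  then show "deriv (\<lambda>z. th (c * z)) z \<noteq> 0"
    using simple_zeros_th z assms by (auto simp: simple_zeros_def dest!: DERIV_imp_deriv)
qed

lemma simple_zeros_th_square: "simple_zeros (\<lambda>z. th (z\<^sup>2))"
  unfolding simple_zeros_def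
proof (intro allI impI)
  fix z assume z: "z \<noteq> 0" "th (z\<^sup>2) = 0"
  have th_holo: "th holomorphic_on - {0}"
    by (intro th_holomorphic holomorphic_intros) auto
  have "((\<lambda>z. th (z\<^sup>2)) has_field_derivative deriv th (z\<^sup>2) * (2 * z)) (at z)"
    using has_deriv_open[OF th_holo, of "z\<^sup>2"] z
    by (intro DERIV_chain2[of th]) (auto intro!: derivative_eq_intros)
  then show "deriv (\<lambda>z. th (z\<^sup>2)) z \<noteq> 0"
    using simple_zeros_th z by (auto simp: simple_zeros_def dest!: DERIV_imp_deriv)
qed

section \<open>The punctured plane modulo powers of q, and Liouville's theorem on it\<close>

lemma q_annulus_representative:
  assumes "z \<noteq> 0"
  shows "\<exists>j. norm q \<le> norm (q powi j * z) \<and> norm (q powi j * z) \<le> 1"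
proof -
  define r where "r = norm q"
  have r: "0 < r" "r < 1" using q_less by (auto simp: r_def)
  \<comment> \<open>With x = ln |z| / ln |q| the logarithm of |q^j z| is (j + x) ln |q|; this choice
    of j makes j + x the fractional part of x.\<close>
  define j where "j = - \<lfloor>ln (norm z) / ln r\<rfloor>"
  have lr: "ln r < 0" using r by simp
  define x where "x = ln (norm z) / ln r"
  have x: "ln (norm z) = x * ln r" using lr by (simp add: x_def)
  have ln_eq: "ln (r powi j * norm z) = (of_int j + x) * ln r"
    using r assms by (simp add: ln_mult ln_powr x algebra_simps flip: powr_real_of_int')
  have "0 \<le> of_int j + x" "of_int j + x \<le> 1"
    unfolding j_def x_def by (auto intro: less_imp_le) linarith+
  then have "ln (r powi j * norm z) \<le> 0" "ln r \<le> ln (r powi j * norm z)"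
    using lr unfolding ln_eq by (auto simp: mult_le_0_iff mult_le_cancel_right1 mult_le_cancel_right2)
  moreover have "r powi j * norm z > 0" using r assms by simp
  ultimately have "r \<le> r powi j * norm z" "r powi j * norm z \<le> 1"
    using r by (simp_all add: ln_le_cancel_iff)
  then show ?thesis
    by (intro exI[of _ j]) (auto simp: norm_mult norm_power_int r_def)
qed

text \<open>Every value is attained on the compact annulus between the radii |q| and 1, so
  \<open>h\<close> composed with \<open>exp\<close> is a bounded entire function.\<close>

lemma q_periodic_imp_constant:
  assumes h: "h holomorphic_on - {0}" and per: "\<And>z. z \<noteq> 0 \<Longrightarrow> h (q * z) = h z"
  shows "\<exists>C. \<forall>z. z \<noteq> 0 \<longrightarrow> h z = (C :: complex)"
proof -
  \<comment> \<open>\<open>quasi_periodic_zero\<close> is applied to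
    \<open>w \<mapsto> h w - h z\<close>, with multiplier 1.\<close>
  have perj: "h (q powi j * z) = h z" if "z \<noteq> 0" for j z
    using quasi_periodic_zero[of "\<lambda>w. h w - h z" z j] per that
    by (metis diff_self eq_iff_diff_eq_0 mult_cancel_right2 zero_neq_one mult_1)
  define A where "A = {z :: complex. norm q \<le> norm z \<and> norm z \<le> 1}"
  have "compact A"
  proof -
    have "A = cball 0 1 - ball 0 (norm q)"
      by (auto simp: A_def)
    then show ?thesis by (auto intro: compact_diff)
  qed
  moreover have "0 \<notin> A" by (simp add: A_def)
  then have "continuous_on A h"
    using holomorphic_on_imp_continuous_on[OF h] by (rule_tac continuous_on_subset) auto
  ultimately have "bounded (h ` A)"
    using compact_continuous_image compact_imp_bounded by blast
  moreover have "range (\<lambda>w. h (exp w)) \<subseteq> h ` A"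
  proof safe
    fix w :: complex
    obtain j where "q powi j * exp w \<in> A"
      using q_annulus_representative[of "exp w"] by (auto simp: A_def)
    moreover have "h (exp w) = h (q powi j * exp w)"
      by (simp add: perj)
    ultimately show "h (exp w) \<in> h ` A" by blast
  qed
  ultimately have "bounded (range (\<lambda>w. h (exp w)))"
    by (rule bounded_subset)
  moreover have "(\<lambda>w. h (exp w)) holomorphic_on UNIV"
    using holomorphic_on_compose[OF holomorphic_on_exp, of h UNIV] holomorphic_on_subset[OF h, of "range exp"]
    by (force simp: o_def)
  ultimately obtain C where C: "\<And>w. h (exp w) = C"
    using Liouville_theorem[of "\<lambda>w. h (exp w)"] by (metis constant_on_def UNIV_I)
  show ?thesis
    using C exp_Ln by metis
qed

text \<open>At a simple zero of \<open>D\<close> the rule of l'Hospital gives the value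
  \<open>deriv P z / deriv D z\<close>, with which the quotient is continuous; the singularity is
  then removable. The last clause, that zeros of \<open>D\<close> are isolated, allows identities to
  be extended to them by taking limits.\<close>

lemma quotient_extends:
  assumes P: "P holomorphic_on - {0}" and D: "D holomorphic_on - {0}"
    and simple: "simple_zeros D" and van: "\<And>z. z \<noteq> 0 \<Longrightarrow> D z = 0 \<Longrightarrow> P z = 0"
  shows "\<exists>h. h holomorphic_on - {0} \<and> (\<forall>z. z \<noteq> 0 \<longrightarrow> P z = h z * D z) \<and> (\<forall>z. z \<noteq> 0 \<longrightarrow> D z \<noteq> 0 \<longrightarrow> h z = P z / D z)
      \<and> (\<forall>z. z \<noteq> 0 \<longrightarrow> D z = 0 \<longrightarrow> (\<forall>\<^sub>F w in at z. D w \<noteq> 0))"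
proof -
  define h where "h z = (if D z = 0 then deriv P z / deriv D z else P z / D z)" for z
  have isolated: "\<forall>\<^sub>F w in at z. D w \<noteq> 0" if z: "z \<noteq> 0" "D z = 0" for z
  proof -
    have "((\<lambda>w. (D w - D z) / (w - z)) \<longlongrightarrow> deriv D z) (at z)"
      using has_deriv_open[OF D z(1)] by (simp add: has_field_derivative_iff)
    moreover have "deriv D z \<noteq> 0" using simple z by (auto simp: simple_zeros_def)
    ultimately have "\<forall>\<^sub>F w in at z. (D w - D z) / (w - z) \<noteq> 0"
      by (rule tendsto_imp_eventually_ne)
    then show ?thesis by eventually_elim (auto simp: z)
  qed
  have "h field_differentiable (at z)" if z: "z \<noteq> 0" for z
  proof (cases "D z = 0")
    case False
    have "continuous_on (- {0}) D" using D by (rule holomorphic_on_imp_continuous_on)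
    then have "isCont D z" using z by (simp add: continuous_on_eq_continuous_at open_Compl)
    then have "\<forall>\<^sub>F w in at z. D w \<noteq> 0"
      using False unfolding isCont_def by (rule tendsto_imp_eventually_ne)
    then have "\<forall>\<^sub>F w in nhds z. D w \<noteq> 0"
      using False by (simp add: eventually_nhds_conv_at)
    then have ev: "\<forall>\<^sub>F w in nhds z. P w / D w = h w"
      by eventually_elim (simp add: h_def)
    note DERIV_divide[OF has_deriv_open[OF P z] has_deriv_open[OF D z] False]
    with ev show ?thesis
      using DERIV_cong_ev[OF refl ev refl] by (auto simp: field_differentiable_def)
  next
    case True
    obtain e where e: "e > 0" "\<And>w. w \<noteq> z \<Longrightarrow> dist w z < e \<Longrightarrow> D w \<noteq> 0"
      using isolated[OF z True] by (auto simp: eventually_at)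
    define d where "d = min e (norm z)"
    have d: "d > 0" using e z by (simp add: d_def)
    have nz: "w \<noteq> 0" if "w \<in> ball z d" for w
      using that by (auto simp: d_def dist_norm)
    have Dw: "D w \<noteq> 0" if "w \<in> ball z d - {z}" for w
      using that e by (auto simp: d_def dist_commute)
    have "h holomorphic_on ball z d"
    proof (rule no_isolated_singularity[of _ _ "{z}"])
      have "(\<lambda>w. P w / D w) holomorphic_on ball z d - {z}"
        using Dw nz[of 0] by (intro holomorphic_intros holomorphic_on_subset[OF P] holomorphic_on_subset[OF D]) blast+
      then show holo: "h holomorphic_on ball z d - {z}"
        by (rule holomorphic_transform) (auto simp: h_def Dw)
      have "((\<lambda>w. P w / D w) \<longlongrightarrow> h z) (at z)"
        using has_deriv_open[OF P z] has_deriv_open[OF D z] van[OF z True] True simple z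
        by (intro lhopital_complex_simple) (auto simp: h_def simple_zeros_def)
      moreover have "\<forall>\<^sub>F w in at z. P w / D w = h w"
        using isolated[OF z True] by eventually_elim (simp add: h_def)
      ultimately have lim: "(h \<longlongrightarrow> h z) (at z)"
        by (rule Lim_transform_eventually)
      have "isCont h w" if "w \<in> ball z d" for w
      proof (cases "w = z")
        case True then show ?thesis using lim by (simp add: isCont_def)
      next
        case False
        then show ?thesis
          using holomorphic_on_imp_continuous_on[OF holo] that
          by (simp add: continuous_on_eq_continuous_at open_delete)
      qed
      then show "continuous_on (ball z d) h"
        by (simp add: continuous_at_imp_continuous_on)
    qed auto
    then show ?thesis
      using d by (intro holomorphic_on_imp_differentiable_at[of h "ball z d"]) auto
  qed
  then have "h holomorphic_on - {0}"
    by (auto simp: holomorphic_on_def field_differentiable_at_within)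
  moreover have "P z = h z * D z" if "z \<noteq> 0" for z
    using van that by (auto simp: h_def)
  ultimately show ?thesis
    using isolated by (intro exI[of _ h]) (auto simp: h_def)
qed

text \<open>The quotient of the two functions is elliptic without poles.\<close>

lemma quasi_periodic_proportional:
  assumes P: "P holomorphic_on - {0}" and D: "D holomorphic_on - {0}"
    and simple: "simple_zeros D" and van: "\<And>z. z \<noteq> 0 \<Longrightarrow> D z = 0 \<Longrightarrow> P z = 0"
    and m: "\<And>z. z \<noteq> 0 \<Longrightarrow> m z \<noteq> 0"
    and Pq: "\<And>z. z \<noteq> 0 \<Longrightarrow> P (q * z) = m z * P z"
    and Dq: "\<And>z. z \<noteq> 0 \<Longrightarrow> D (q * z) = m z * D z"
  obtains C where "\<And>z. z \<noteq> 0 \<Longrightarrow> P z = C * D z"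
proof -
  obtain h where h: "h holomorphic_on - {0}"
    and hP: "\<And>z. z \<noteq> 0 \<Longrightarrow> P z = h z * D z"
    and hq: "\<And>z. z \<noteq> 0 \<Longrightarrow> D z \<noteq> 0 \<Longrightarrow> h z = P z / D z"
    and iso: "\<And>z. z \<noteq> 0 \<Longrightarrow> D z = 0 \<Longrightarrow> \<forall>\<^sub>F w in at z. D w \<noteq> 0"
    using quotient_extends[OF P D simple van] by blast
  have per: "h (q * z) = h z" if z: "z \<noteq> 0" "D z \<noteq> 0" for z
    using z m[of z] Pq[of z] Dq[of z] by (simp add: hq)
  have "h (q * z) = h z" if z: "z \<noteq> 0" for z
  proof (cases "D z = 0")
    \<comment> \<open>Zeros of \<open>D\<close> are isolated, so at such a point both sides are
      limits of values that already agree.\<close>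
    case True
    have cont: "isCont h w" if "w \<noteq> 0" for w
      using holomorphic_on_imp_continuous_on[OF h] that
      by (simp add: continuous_on_eq_continuous_at open_Compl)
    have "((\<lambda>w. h (q * w)) \<longlongrightarrow> h (q * z)) (at z)"
    proof -
      have "isCont (\<lambda>w. h (q * w)) z"
        using cont[of "q * z"] z by (intro isCont_o2[of z "\<lambda>w. q * w" h]) auto
      then show ?thesis by (simp add: isCont_def)
    qed
    moreover have "(h \<longlongrightarrow> h z) (at z)" using cont[OF z] by (simp add: isCont_def)
    moreover have "\<forall>\<^sub>F w in at z. h (q * w) = h w"
      using iso[OF z True] eventually_neq_at_within[of 0 z UNIV]
      by eventually_elim (auto simp: per)
    ultimately have "(h \<longlongrightarrow> h (q * z)) (at z)"
      by (rule_tac Lim_transform_eventually)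
    then show ?thesis
      using \<open>(h \<longlongrightarrow> h z) (at z)\<close> by (rule tendsto_unique[OF trivial_limit_at])
  qed (use per z in auto)
  then obtain C where "\<And>z. z \<noteq> 0 \<Longrightarrow> h z = C"
    using q_periodic_imp_constant[OF h] by metis
  with hP have "\<And>z. z \<noteq> 0 \<Longrightarrow> P z = C * D z" by simp
  then show ?thesis by (rule that)
qed

end

subsection \<open>A theta function identity of type BC\<close>

text \<open>Indexed by an arbitrary set of naturals and not by an interval, so that the theta
  identity can be proved by inserting one index at a time.\<close>

definition pairprod :: "nat set \<Rightarrow> (nat \<Rightarrow> nat \<Rightarrow> complex) \<Rightarrow> complex" where
  "pairprod A F = (\<Prod>j\<in>A. \<Prod>k\<in>{k \<in> A. j < k}. F j k)"

text \<open>By symmetry of \<open>F\<close> the position of \<open>x\<close> in the order is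
  immaterial: the pairs in which \<open>x\<close> is the smaller and the larger index recombine to
  one product over \<open>A\<close>.\<close>

lemma pairprod_insert:
  assumes A: "finite A" "x \<notin> A" and sym: "\<And>j k. F j k = F k j"
  shows "pairprod (insert x A) F = pairprod A F * (\<Prod>k\<in>A. F x k)"
proof -
  have 1: "{k \<in> insert x A. x < k} = {k \<in> A. x < k}"
    by auto
  have 2: "(\<Prod>k\<in>{k \<in> insert x A. j < k}. F j k) =
      (\<Prod>k\<in>{k \<in> A. j < k}. F j k) * (if j < x then F x j else 1)" for j
  proof -
    have "{k \<in> insert x A. j < k} = (if j < x then insert x {k \<in> A. j < k} else {k \<in> A. j < k})"
      by auto
    then show ?thesis using A by (simp add: sym[of j x] mult.commute)
  qed
  have 3: "(\<Prod>j\<in>A. if j < x then F x j else 1) = (\<Prod>j\<in>{j \<in> A. j < x}. F x j)"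
    using A by (simp add: prod.If_cases Int_def)
  have "(\<Prod>k\<in>{k \<in> A. x < k}. F x k) * (\<Prod>j\<in>{j \<in> A. j < x}. F x j) =
      (\<Prod>k\<in>{k \<in> A. x < k} \<union> {j \<in> A. j < x}. F x k)"
    using A by (intro prod.union_disjoint[symmetric]) auto
  also have "{k \<in> A. x < k} \<union> {j \<in> A. j < x} = A"
    using A by (auto intro: linorder_neqE_nat)
  finally have 4: "(\<Prod>k\<in>{k \<in> A. x < k}. F x k) * (\<Prod>j\<in>{j \<in> A. j < x}. F x j) = (\<Prod>k\<in>A. F x k)" .
  show ?thesis
    unfolding pairprod_def prod.insert[OF A] 1 2 prod.distrib 3 4[symmetric] by (simp only: mult_ac less_irrefl if_False mult_1)
qed

lemma pairprod_cong:
  assumes "\<And>j k. j \<in> A \<Longrightarrow> k \<in> A \<Longrightarrow> j < k \<Longrightarrow> F j k = G j k"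
  shows "pairprod A F = pairprod A G"
  unfolding pairprod_def using assms by (intro prod.cong) auto

text \<open>The sign changes in the Weyl group of type BC, acting by inversion of the coordinates in
  \<open>E\<close>. Sums over \<open>Pow A\<close> are the symmetrisations.\<close>

definition flip :: "nat set \<Rightarrow> (nat \<Rightarrow> complex) \<Rightarrow> nat \<Rightarrow> complex" where
  "flip E z i = (if i \<in> E then 1 / z i else z i)"

lemma sum_Pow_insert:
  assumes "finite A" "x \<notin> A"
  shows "(\<Sum>E\<in>Pow (insert x A). f E) = (\<Sum>E\<in>Pow A. f E + f (insert x E))"
proof -
  have "inj_on (insert x) (Pow A)"
    using assms by (auto simp: inj_on_def)
  moreover have "Pow A \<inter> insert x ` Pow A = {}"
    using assms by auto
  ultimately show ?thesis
    using assms by (simp add: Pow_insert sum.union_disjoint sum.reindex sum.distrib)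
qed

context nome
begin

text \<open>The zeros of \<open>th\<close> are the integer powers of \<open>q\<close>, which form a
  multiplicative group.\<close>

lemma th_zero_mult: "a \<noteq> 0 \<Longrightarrow> b \<noteq> 0 \<Longrightarrow> th a = 0 \<Longrightarrow> th b = 0 \<Longrightarrow> th (a * b) = 0"
  by (auto simp: th_eq_0_iff simp flip: power_int_add)

lemma th_zero_div: "a \<noteq> 0 \<Longrightarrow> b \<noteq> 0 \<Longrightarrow> th a = 0 \<Longrightarrow> th b = 0 \<Longrightarrow> th (a / b) = 0"
  by (auto simp: th_eq_0_iff simp flip: power_int_diff)

definition th4 :: "complex \<Rightarrow> complex \<Rightarrow> complex \<Rightarrow> complex \<Rightarrow> complex \<Rightarrow> complex" where
  "th4 b0 b1 b2 b3 u = th (b0 * u) * th (b1 * u) * th (b2 * u) * th (b3 * u)"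

definition bc_term ::
  "complex \<Rightarrow> complex \<Rightarrow> complex \<Rightarrow> complex \<Rightarrow> complex \<Rightarrow> nat set \<Rightarrow> (nat \<Rightarrow> complex) \<Rightarrow> complex" where
  "bc_term b0 b1 b2 b3 t A w = (\<Prod>i\<in>A. th4 b0 b1 b2 b3 (w i) / th ((w i)\<^sup>2)) *
     pairprod A (\<lambda>j k. th (t * w j * w k) / th (w j * w k))"

text \<open>Ratios are included because inverting one coordinate turns a product into a ratio: the
  condition covers the denominators of \<open>bc_term\<close> at all flipped points.\<close>

definition generic :: "nat set \<Rightarrow> (nat \<Rightarrow> complex) \<Rightarrow> bool" where
  "generic A z \<longleftrightarrow> (\<forall>i\<in>A. z i \<noteq> 0 \<and> th ((z i)\<^sup>2) \<noteq> 0) \<and>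
     (\<forall>j\<in>A. \<forall>k\<in>A. j \<noteq> k \<longrightarrow> th (z j * z k) \<noteq> 0 \<and> th (z j / z k) \<noteq> 0)"

lemma bc_term_insert:
  assumes "finite A" "x \<notin> A"
  shows "bc_term b0 b1 b2 b3 t (insert x A) w = bc_term b0 b1 b2 b3 t A w *
     (th4 b0 b1 b2 b3 (w x) / th ((w x)\<^sup>2) * (\<Prod>k\<in>A. th (t * w x * w k) / th (w x * w k)))"
  unfolding bc_term_def using assms
  by (subst pairprod_insert) (auto simp: mult_ac)

lemma bc_term_cong:
  assumes "\<And>i. i \<in> A \<Longrightarrow> w i = w' i"
  shows "bc_term b0 b1 b2 b3 t A w = bc_term b0 b1 b2 b3 t A w'"
  unfolding bc_term_def using assms
  by (intro arg_cong2[of _ _ _ _ "(*)"] prod.cong pairprod_cong) auto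

lemma th4_q:
  assumes "u \<noteq> 0" "b0 \<noteq> 0" "b1 \<noteq> 0" "b2 \<noteq> 0" "b3 \<noteq> 0"
  shows "th4 b0 b1 b2 b3 (q * u) = th4 b0 b1 b2 b3 u / (b0 * b1 * b2 * b3 * u ^ 4)"
proof -
  have "th (b * (q * u)) = - th (b * u) / (b * u)" if "b \<noteq> 0" for b
    using th_q[of "b * u"] that assms by (simp add: mult_ac)
  then show ?thesis using assms
    by (simp add: th4_def power_numeral_reduce mult_ac)
qed

lemma th4_div_q:
  assumes "u \<noteq> 0" "b0 \<noteq> 0" "b1 \<noteq> 0" "b2 \<noteq> 0" "b3 \<noteq> 0"
  shows "th4 b0 b1 b2 b3 (u / q) = th4 b0 b1 b2 b3 u * (b0 * b1 * b2 * b3 * u ^ 4) / q ^ 4"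
  using th4_q[of "u / q" b0 b1 b2 b3] assms by (simp add: power_divide)

lemma th4_holomorphic [holomorphic_intros]:
  assumes "f holomorphic_on A" "\<And>z. z \<in> A \<Longrightarrow> f z \<noteq> 0" "b0 \<noteq> 0" "b1 \<noteq> 0" "b2 \<noteq> 0" "b3 \<noteq> 0"
  shows "(\<lambda>z. th4 b0 b1 b2 b3 (f z)) holomorphic_on A"
  unfolding th4_def using assms by (intro holomorphic_intros) auto

text \<open>
  As a function of the variable \<open>u\<close> with index \<open>x\<close>, the symmetrised sum is \<open>bc_num / bc_den\<close>,
  where both are quasi-periodic with the same multiplier.
\<close>

definition bc_den :: "nat set \<Rightarrow> (nat \<Rightarrow> complex) \<Rightarrow> complex \<Rightarrow> complex" where
  "bc_den A z u = th (u\<^sup>2) * (\<Prod>k\<in>A. th (u * z k) * th (u / z k))"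

definition bc_plus where
  "bc_plus b0 b1 b2 b3 t A w u = th4 b0 b1 b2 b3 u * (\<Prod>k\<in>A. th (t * u * w k) * th (u / w k))"

text \<open>Numerator of the term in which \<open>u\<close> is inverted. The factors
  \<open>u\<^sup>2\<close> and \<open>- (u / w k)\<close> come from \<open>th_inverse\<close>,
  applied to the denominators \<open>th ((1 / u)\<^sup>2)\<close> and \<open>th (w k / u)\<close>;
  the remaining sign is the minus sign in \<open>bc_num\<close>.\<close>

definition bc_minus where
  "bc_minus b0 b1 b2 b3 t A w u =
     u\<^sup>2 * th4 b0 b1 b2 b3 (1 / u) * (\<Prod>k\<in>A. - (u / w k) * th (t * w k / u) * th (u * w k))"

definition bc_num where
  "bc_num b0 b1 b2 b3 t A z u = (\<Sum>E\<in>Pow A. bc_term b0 b1 b2 b3 t A (flip E z) *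
     (bc_plus b0 b1 b2 b3 t A (flip E z) u - bc_minus b0 b1 b2 b3 t A (flip E z) u))"

lemma flip_nonzero: "z i \<noteq> 0 \<Longrightarrow> flip E z i \<noteq> 0"
  by (simp add: flip_def)

lemma flip_pair: "th (u * flip E z k) * th (u / flip E z k) = th (u * z k) * th (u / z k)"
  by (simp add: flip_def mult.commute)

text \<open>The subsets \<open>E\<close> and \<open>insert x E\<close> are treated together: their
  terms share the factor \<open>bc_term\<close> over \<open>A\<close>, and by
  \<open>flip_pair\<close> the common denominator is the same for all \<open>E\<close>.\<close>

lemma bc_sum_eq_quotient:
  assumes A: "finite A" "x \<notin> A" and nz: "u \<noteq> 0" "\<And>k. k \<in> A \<Longrightarrow> z k \<noteq> 0"
    and D: "bc_den A z u \<noteq> 0" and zx: "z x = u"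
  shows "(\<Sum>E\<in>Pow (insert x A). bc_term b0 b1 b2 b3 t (insert x A) (flip E z)) =
           bc_num b0 b1 b2 b3 t A z u / bc_den A z u"
  unfolding sum_Pow_insert[OF A] bc_num_def sum_divide_distrib
proof (intro sum.cong refl)
  fix E assume E: "E \<in> Pow A"
  define w where "w = flip E z"
  have den: "bc_den A z u = th (u\<^sup>2) * (\<Prod>k\<in>A. th (u * w k) * th (u / w k))"
    unfolding bc_den_def w_def flip_pair ..
  have nzf: "th (u\<^sup>2) \<noteq> 0" "\<And>k. k \<in> A \<Longrightarrow> th (u * w k) \<noteq> 0" "\<And>k. k \<in> A \<Longrightarrow> th (u / w k) \<noteq> 0"
    using D A(1) unfolding den by auto
  have wnz: "w k \<noteq> 0" if "k \<in> A" for k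
    using nz(2)[OF that] by (simp add: w_def flip_nonzero)
  have wx: "flip E z x = u" "flip (insert x E) z x = 1 / u"
    using E A(2) zx by (auto simp: flip_def)
  have w': "flip (insert x E) z k = w k" if "k \<in> A" for k
    using that A(2) by (auto simp: flip_def w_def)
  have plus: "th4 b0 b1 b2 b3 u / th (u\<^sup>2) * (\<Prod>k\<in>A. th (t * u * w k) / th (u * w k)) =
      bc_plus b0 b1 b2 b3 t A w u / bc_den A z u"
  proof -
    have "(\<Prod>k\<in>A. th (t * u * w k) / th (u * w k)) =
        (\<Prod>k\<in>A. th (t * u * w k) * th (u / w k)) / (\<Prod>k\<in>A. th (u * w k) * th (u / w k))"
      unfolding prod_dividef[symmetric] using nzf by (intro prod.cong) auto
    then show ?thesis by (simp add: den bc_plus_def)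
  qed
  have minus: "th4 b0 b1 b2 b3 (1 / u) / th ((1 / u)\<^sup>2) *
        (\<Prod>k\<in>A. th (t * (1 / u) * w k) / th (1 / u * w k)) =
      - (bc_minus b0 b1 b2 b3 t A w u / bc_den A z u)"
  proof -
    have "(\<Prod>k\<in>A. th (t * (1 / u) * w k) / th (1 / u * w k)) =
        (\<Prod>k\<in>A. - (u / w k) * th (t * w k / u) * th (u * w k)) / (\<Prod>k\<in>A. th (u * w k) * th (u / w k))"
      unfolding prod_dividef[symmetric]
    proof (intro prod.cong refl)
      fix k assume k: "k \<in> A"
      have "th (1 / u * w k) = - th (u / w k) * w k / u"
        using th_inverse[of "u / w k"] wnz[OF k] nz by simp
      then show "th (t * (1 / u) * w k) / th (1 / u * w k) =
          - (u / w k) * th (t * w k / u) * th (u * w k) / (th (u * w k) * th (u / w k))"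
        using nzf(2,3)[OF k] wnz[OF k] nz(1) by (simp only:) (simp add: mult_ac)
    qed
    moreover have "th ((1 / u)\<^sup>2) = - th (u\<^sup>2) / u\<^sup>2"
      using th_inverse[of "u\<^sup>2"] nz by (simp add: power_divide)
    ultimately show ?thesis using nz by (simp add: den bc_minus_def)
  qed
  have "bc_term b0 b1 b2 b3 t A (flip (insert x E) z) = bc_term b0 b1 b2 b3 t A w"
    by (intro bc_term_cong w')
  then have "bc_term b0 b1 b2 b3 t (insert x A) (flip (insert x E) z) =
      bc_term b0 b1 b2 b3 t A w * - (bc_minus b0 b1 b2 b3 t A w u / bc_den A z u)"
    unfolding bc_term_insert[OF A] wx minus[symmetric] by (simp add: w' cong: prod.cong)
  moreover have "bc_term b0 b1 b2 b3 t (insert x A) (flip E z) =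
      bc_term b0 b1 b2 b3 t A w * (bc_plus b0 b1 b2 b3 t A w u / bc_den A z u)"
    unfolding bc_term_insert[OF A] wx plus[symmetric] by (simp add: w_def)
  ultimately show "bc_term b0 b1 b2 b3 t (insert x A) (flip E z) +
      bc_term b0 b1 b2 b3 t (insert x A) (flip (insert x E) z) =
      bc_term b0 b1 b2 b3 t A (flip E z) *
        (bc_plus b0 b1 b2 b3 t A (flip E z) u - bc_minus b0 b1 b2 b3 t A (flip E z) u) / bc_den A z u"
    unfolding w_def[symmetric] by (simp add: diff_divide_distrib right_diff_distrib)
qed

section \<open>Quasi-periodicity and zeros of numerator and denominator\<close>

lemma bc_den_q:
  assumes "finite A" "u \<noteq> 0" "\<And>k. k \<in> A \<Longrightarrow> z k \<noteq> 0"
  shows "bc_den A z (q * u) = 1 / (q * u ^ (4 + 2 * card A)) * bc_den A z u"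
proof -
  have "(\<Prod>k\<in>A. th (q * u * z k) * th (q * u / z k)) =
      (\<Prod>k\<in>A. th (u * z k) * th (u / z k) / u\<^sup>2)"
  proof (intro prod.cong refl)
    fix k assume "k \<in> A"
    then show "th (q * u * z k) * th (q * u / z k) = th (u * z k) * th (u / z k) / u\<^sup>2"
      using th_q[of "u * z k"] th_q[of "u / z k"] assms
      by (simp add: mult.assoc power2_eq_square)
  qed
  also have "\<dots> = (\<Prod>k\<in>A. th (u * z k) * th (u / z k)) / u ^ (2 * card A)"
    by (simp add: prod_dividef power_mult)
  finally have "(\<Prod>k\<in>A. th (q * u * z k) * th (q * u / z k)) =
      (\<Prod>k\<in>A. th (u * z k) * th (u / z k)) / u ^ (2 * card A)" .
  moreover have "th ((q * u)\<^sup>2) = th (u\<^sup>2) / (q * u ^ 4)"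
  proof -
    have "th ((q * u)\<^sup>2) = th (q * (q * u\<^sup>2))"
      by (simp add: power2_eq_square mult_ac)
    also have "\<dots> = th (u\<^sup>2) / (q * u ^ 4)"
      using assms by (subst th_q, simp, subst th_q) (auto simp: power2_eq_square power4_eq_xxxx)
    finally show ?thesis .
  qed
  ultimately show ?thesis by (simp add: bc_den_def power_add)
qed

text \<open>The four theta factors contribute \<open>1 / (b0 * b1 * b2 * b3 * u ^ 4)\<close> and
  each \<open>k\<close> contributes \<open>1 / (t * u\<^sup>2)\<close>. The balancing condition
  turns the collected constant into \<open>q\<close>, which is the constant in the multiplier of
  \<open>bc_den\<close>.\<close>

lemma bc_plus_q:
  assumes "finite A" "u \<noteq> 0" "\<And>k. k \<in> A \<Longrightarrow> w k \<noteq> 0" "b0 \<noteq> 0" "b1 \<noteq> 0" "b2 \<noteq> 0" "b3 \<noteq> 0" "t \<noteq> 0"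
    and bal: "b0 * b1 * b2 * b3 * t ^ card A = q"
  shows "bc_plus b0 b1 b2 b3 t A w (q * u) = 1 / (q * u ^ (4 + 2 * card A)) * bc_plus b0 b1 b2 b3 t A w u"
proof -
  have "(\<Prod>k\<in>A. th (t * (q * u) * w k) * th (q * u / w k)) =
      (\<Prod>k\<in>A. th (t * u * w k) * th (u / w k) / (t * u\<^sup>2))"
  proof (intro prod.cong refl)
    fix k assume "k \<in> A"
    then show "th (t * (q * u) * w k) * th (q * u / w k) = th (t * u * w k) * th (u / w k) / (t * u\<^sup>2)"
      using th_q[of "t * u * w k"] th_q[of "u / w k"] assms
      by (simp add: mult_ac power2_eq_square)
  qed
  also have "\<dots> = (\<Prod>k\<in>A. th (t * u * w k) * th (u / w k)) / (t ^ card A * u ^ (2 * card A))"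
    by (simp add: prod_dividef power_mult power_mult_distrib)
  finally have 1: "(\<Prod>k\<in>A. th (t * (q * u) * w k) * th (q * u / w k)) =
      (\<Prod>k\<in>A. th (t * u * w k) * th (u / w k)) / (t ^ card A * u ^ (2 * card A))" .
  have "bc_plus b0 b1 b2 b3 t A w (q * u) =
      1 / ((b0 * b1 * b2 * b3 * t ^ card A) * u ^ (4 + 2 * card A)) * bc_plus b0 b1 b2 b3 t A w u"
    unfolding bc_plus_def 1 using assms by (simp add: th4_q power_add mult_ac del: bal)
  then show ?thesis unfolding bal .
qed

lemma bc_minus_q:
  assumes "finite A" "u \<noteq> 0" "\<And>k. k \<in> A \<Longrightarrow> w k \<noteq> 0" "b0 \<noteq> 0" "b1 \<noteq> 0" "b2 \<noteq> 0" "b3 \<noteq> 0" "t \<noteq> 0"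
    and bal: "b0 * b1 * b2 * b3 * t ^ card A = q"
  shows "bc_minus b0 b1 b2 b3 t A w (q * u) = 1 / (q * u ^ (4 + 2 * card A)) * bc_minus b0 b1 b2 b3 t A w u"
proof -
  have "(\<Prod>k\<in>A. - (q * u / w k) * th (t * w k / (q * u)) * th (q * u * w k)) =
      (\<Prod>k\<in>A. - (u / w k) * th (t * w k / u) * th (u * w k) * (t / u\<^sup>2))"
  proof (intro prod.cong refl)
    fix k assume "k \<in> A"
    show "- (q * u / w k) * th (t * w k / (q * u)) * th (q * u * w k) =
        - (u / w k) * th (t * w k / u) * th (u * w k) * (t / u\<^sup>2)"
    proof -
      have k: "w k \<noteq> 0" using assms \<open>k \<in> A\<close> by simp
      have 1: "th (q * u * w k) = - th (u * w k) / (u * w k)"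
        using th_q[of "u * w k"] k assms by (simp add: mult.assoc)
      have "t * w k / (q * u) = (t * w k / u) / q" by (simp add: mult.commute)
      then have 2: "th (t * w k / (q * u)) = - (t * w k / u / q) * th (t * w k / u)"
        using th_div_q[of "t * w k / u"] k assms(2,8) by (simp del: divide_divide_eq_left)
      show ?thesis unfolding 1 2 using k assms(2) by (simp add: power2_eq_square mult_ac)
    qed
  qed
  also have "\<dots> = (\<Prod>k\<in>A. - (u / w k) * th (t * w k / u) * th (u * w k)) * (t ^ card A / u ^ (2 * card A))"
    unfolding prod.distrib[of _ "\<lambda>_. t / u\<^sup>2"] by (simp add: power_divide power_mult)
  finally have 1: "(\<Prod>k\<in>A. - (q * u / w k) * th (t * w k / (q * u)) * th (q * u * w k)) =
     (\<Prod>k\<in>A. - (u / w k) * th (t * w k / u) * th (u * w k)) * (t ^ card A / u ^ (2 * card A))" .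
  have 2: "th4 b0 b1 b2 b3 (1 / (q * u)) = th4 b0 b1 b2 b3 (1 / u) * (b0 * b1 * b2 * b3) / (u ^ 4 * q ^ 4)"
    using th4_div_q[of "1 / u" b0 b1 b2 b3] assms by (simp add: power_divide mult.commute)
  have "bc_minus b0 b1 b2 b3 t A w (q * u) =
      (b0 * b1 * b2 * b3 * t ^ card A) * (q\<^sup>2 / (q ^ 4 * u ^ (4 + 2 * card A))) * bc_minus b0 b1 b2 b3 t A w u"
    unfolding bc_minus_def 1 2 using assms
    by (simp add: power_add power_mult_distrib mult_ac)
  \<comment> \<open>One factor \<open>q\<close> is the balancing condition, \<open>q\<^sup>2\<close>
    comes from the prefactor \<open>u\<^sup>2\<close> of \<open>bc_minus\<close>, and
    \<open>q ^ 4\<close> from \<open>th4_div_q\<close>.\<close>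
  also have "(b0 * b1 * b2 * b3 * t ^ card A) * (q\<^sup>2 / (q ^ 4 * u ^ (4 + 2 * card A))) =
      1 / (q * u ^ (4 + 2 * card A))"
    unfolding bal using assms by (simp add: field_simps power2_eq_square power4_eq_xxxx)
  finally show ?thesis .
qed

lemma bc_num_q:
  assumes "finite A" "u \<noteq> 0" "\<And>k. k \<in> A \<Longrightarrow> z k \<noteq> 0" "b0 \<noteq> 0" "b1 \<noteq> 0" "b2 \<noteq> 0" "b3 \<noteq> 0" "t \<noteq> 0"
    and bal: "b0 * b1 * b2 * b3 * t ^ card A = q"
  shows "bc_num b0 b1 b2 b3 t A z (q * u) = 1 / (q * u ^ (4 + 2 * card A)) * bc_num b0 b1 b2 b3 t A z u"
  unfolding bc_num_def sum_distrib_left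
proof (intro sum.cong refl)
  fix E assume "E \<in> Pow A"
  have "\<And>k. k \<in> A \<Longrightarrow> flip E z k \<noteq> 0" using assms(3) by (simp add: flip_nonzero)
  note * = bc_plus_q[OF assms(1,2) this assms(4-9)] bc_minus_q[OF assms(1,2) this assms(4-9)]
  show "bc_term b0 b1 b2 b3 t A (flip E z) *
      (bc_plus b0 b1 b2 b3 t A (flip E z) (q * u) - bc_minus b0 b1 b2 b3 t A (flip E z) (q * u)) =
      1 / (q * u ^ (4 + 2 * card A)) * (bc_term b0 b1 b2 b3 t A (flip E z) *
      (bc_plus b0 b1 b2 b3 t A (flip E z) u - bc_minus b0 b1 b2 b3 t A (flip E z) u))"
    by (subst *, assumption, subst *, assumption) (simp add: algebra_simps)
qed

text \<open>Since the zeros of \<open>th\<close> form a group, a common zero of two factors would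
  make \<open>th\<close> vanish at \<open>(z k)\<^sup>2\<close>, \<open>z j * z k\<close> or
  \<open>z j / z k\<close>, against genericity.\<close>

lemma bc_den_simple_zeros:
  assumes A: "finite A" and gen: "generic A z"
  shows "simple_zeros (bc_den A z)"
  unfolding bc_den_def
proof (rule simple_zeros_mult)
  have z: "z k \<noteq> 0" "th ((z k)\<^sup>2) \<noteq> 0" if "k \<in> A" for k
    using gen that by (auto simp: generic_def)
  have zz: "th (z j * z k) \<noteq> 0" "th (z j / z k) \<noteq> 0" if "j \<in> A" "k \<in> A" "j \<noteq> k" for j k
    using gen that by (auto simp: generic_def)
  show "(\<lambda>u. th (u\<^sup>2)) holomorphic_on - {0}"
    by (intro holomorphic_intros) auto
  show "(\<lambda>u. \<Prod>k\<in>A. th (u * z k) * th (u / z k)) holomorphic_on - {0}"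
    using z by (intro holomorphic_intros) auto
  show "simple_zeros (\<lambda>z. th (z\<^sup>2))" by (rule simple_zeros_th_square)
  show "simple_zeros (\<lambda>u. \<Prod>k\<in>A. th (u * z k) * th (u / z k))"
  proof (rule simple_zeros_prod[OF A])
    fix k assume k: "k \<in> A"
    show "(\<lambda>u. th (u * z k) * th (u / z k)) holomorphic_on - {0}"
      using z[OF k] by (intro holomorphic_intros) auto
    show "simple_zeros (\<lambda>u. th (u * z k) * th (u / z k))"
    proof (rule simple_zeros_mult)
      show "(\<lambda>u. th (u * z k)) holomorphic_on - {0}" "(\<lambda>u. th (u / z k)) holomorphic_on - {0}"
        using z[OF k] by (intro holomorphic_intros; auto)+
      show "simple_zeros (\<lambda>u. th (u * z k))" "simple_zeros (\<lambda>u. th (u / z k))"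
        using simple_zeros_th_scale[of "z k"] simple_zeros_th_scale[of "1 / z k"] z[OF k]
        by (simp_all add: mult.commute)
      fix u :: complex assume u: "u \<noteq> 0" "th (u * z k) = 0"
      show "th (u / z k) \<noteq> 0"
        using th_zero_div[of "u * z k" "u / z k"] u z[OF k] by (auto simp: power2_eq_square)
    qed
  next
    fix j k u assume jk: "j \<in> A" "k \<in> A" "j \<noteq> k" "u \<noteq> 0" "th (u * z j) * th (u / z j) = 0"
    show "th (u * z k) * th (u / z k) \<noteq> 0"
      using th_zero_div[of "u * z j" "u * z k"] th_zero_div[of "u * z j" "u / z k"]
        th_zero_div[of "u * z k" "u / z j"] th_zero_div[of "u / z k" "u / z j"]
        zz[of j k] zz[of k j] jk z[of j] z[of k] by (auto simp: mult_ac)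
  qed
next
  fix u :: complex assume u: "u \<noteq> 0" "th (u\<^sup>2) = 0"
  show "(\<Prod>k\<in>A. th (u * z k) * th (u / z k)) \<noteq> 0"
  proof -
    have "th (u * z k) * th (u / z k) \<noteq> 0" if k: "k \<in> A" for k
    proof
      have zk: "z k \<noteq> 0" "th ((z k)\<^sup>2) \<noteq> 0" using gen k by (auto simp: generic_def)
      assume "th (u * z k) * th (u / z k) = 0"
      then consider "th (u * z k) = 0" | "th (u / z k) = 0" by auto
      then show False
      proof cases
        case 1
        then have "th ((u * z k) * (u * z k) / u\<^sup>2) = 0"
          using u zk by (intro th_zero_div th_zero_mult[of "u * z k" "u * z k"]) auto
        then show False using u zk by (simp add: power2_eq_square mult_ac)
      next
        case 2
        then have "th (u\<^sup>2 / ((u / z k) * (u / z k))) = 0"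
          using u zk th_zero_mult[of "u / z k" "u / z k"] by (intro th_zero_div) auto
        then show False using u zk by (simp add: power2_eq_square mult_ac)
      qed
    qed
    then show ?thesis using A by (simp add: prod_zero_iff)
  qed
qed

text \<open>Here \<open>1 / u\<close> is \<open>u\<close> or \<open>u / q\<close>. In both cases
  \<open>bc_plus\<close> and \<open>bc_minus\<close> agree for each subset separately; in the second
  case the factors produced by quasi-periodicity cancel by the balancing condition.\<close>

lemma bc_num_zero_square:
  assumes A: "finite A" and nz: "u \<noteq> 0" "\<And>k. k \<in> A \<Longrightarrow> z k \<noteq> 0" "b0 \<noteq> 0" "b1 \<noteq> 0" "b2 \<noteq> 0" "b3 \<noteq> 0" "t \<noteq> 0"
    and bal: "b0 * b1 * b2 * b3 * t ^ card A = q"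
    and u: "u\<^sup>2 = 1 \<or> u\<^sup>2 = q"
  shows "bc_num b0 b1 b2 b3 t A z u = 0"
  unfolding bc_num_def
proof (intro sum.neutral ballI)
  fix E assume "E \<in> Pow A"
  define w where "w = flip E z"
  have w: "w k \<noteq> 0" if "k \<in> A" for k using nz(2)[OF that] by (simp add: w_def flip_nonzero)
  have "bc_minus b0 b1 b2 b3 t A w u = bc_plus b0 b1 b2 b3 t A w u"
    using u
  proof
    assume u1: "u\<^sup>2 = 1"
    then have inv: "1 / u = u" using nz(1) by (simp add: field_simps power2_eq_square)
    have "(\<Prod>k\<in>A. - (u / w k) * th (t * w k / u) * th (u * w k)) =
        (\<Prod>k\<in>A. th (t * u * w k) * th (u / w k))"
    proof (intro prod.cong refl)
      fix k assume k: "k \<in> A"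
      have "th (u * w k) = th (1 / (u / w k))"
        using inv by (metis divide_divide_eq_right mult.commute mult.right_neutral times_divide_eq_left)
      also have "\<dots> = - th (u / w k) / (u / w k)"
        using w[OF k] nz by (intro th_inverse) auto
      finally have "- (u / w k) * th (u * w k) = th (u / w k)"
        using w[OF k] nz by simp
      moreover have "t * w k / u = t * u * w k"
        using inv by (metis divide_inverse inverse_eq_divide mult.assoc mult.commute)
      ultimately show "- (u / w k) * th (t * w k / u) * th (u * w k) = th (t * u * w k) * th (u / w k)"
        by (metis mult.assoc mult.commute)
    qed
    then show ?thesis by (simp add: bc_minus_def bc_plus_def inv u1)
  next
    assume uq: "u\<^sup>2 = q"
    then have inv: "1 / u = u / q" using nz(1) by (simp add: field_simps power2_eq_square)
    have "(\<Prod>k\<in>A. - (u / w k) * th (t * w k / u) * th (u * w k)) =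
        (\<Prod>k\<in>A. t * (th (t * u * w k) * th (u / w k)))"
    proof (intro prod.cong refl)
      fix k assume k: "k \<in> A"
      have "th (u * w k) = th (q / (u / w k))"
        using nz unfolding uq[symmetric] by (simp add: power2_eq_square)
      also have "\<dots> = th (u / w k)"
        using w[OF k] nz by (intro theta_quasi_inverse) auto
      finally have 1: "th (u * w k) = th (u / w k)" .
      have "t * w k / u = t * u * w k / q"
        using nz unfolding uq[symmetric] by (simp add: power2_eq_square)
      then have "th (t * w k / u) = - (t * u * w k / q) * th (t * u * w k)"
        using th_div_q[of "t * u * w k"] w[OF k] nz by simp
      then have "- (u / w k) * th (t * w k / u) = (u\<^sup>2 / q) * t * th (t * u * w k)"
        using w[OF k] nz by (simp add: power2_eq_square)
      then show "- (u / w k) * th (t * w k / u) * th (u * w k) = t * (th (t * u * w k) * th (u / w k))"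
        unfolding 1 uq by simp
    qed
    moreover have "u ^ 4 = q\<^sup>2"
      unfolding uq[symmetric] by simp
    ultimately have "bc_minus b0 b1 b2 b3 t A w u =
        q * (b0 * b1 * b2 * b3 * t ^ card A) * q\<^sup>2 / q ^ 4 * bc_plus b0 b1 b2 b3 t A w u"
      unfolding bc_minus_def bc_plus_def inv uq using nz
      by (simp add: th4_div_q prod.distrib mult_ac)
    also have "q * (b0 * b1 * b2 * b3 * t ^ card A) * q\<^sup>2 / q ^ 4 = 1"
      unfolding bal by (simp add: power2_eq_square power4_eq_xxxx)
    finally show ?thesis by simp
  qed
  then show "bc_term b0 b1 b2 b3 t A (flip E z) *
      (bc_plus b0 b1 b2 b3 t A (flip E z) u - bc_minus b0 b1 b2 b3 t A (flip E z) u) = 0"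
    by (simp add: w_def)
qed

text \<open>The points \<open>w\<close> and \<open>w'\<close> differ by inverting the coordinate
  \<open>k\<close>. Each loses one of its two parts to a factor \<open>th 1\<close>:
  \<open>bc_plus\<close> at \<open>w\<close> contains \<open>th (v / w k)\<close>, and
  \<open>bc_minus\<close> at \<open>w'\<close> contains \<open>th (v * w' k)\<close>. The two
  remaining products are equal and enter with opposite signs.\<close>

lemma bc_pair_cancel:
  assumes A: "finite A" "k \<notin> A" and nz: "v \<noteq> 0" "\<And>l. l \<in> A \<Longrightarrow> w l \<noteq> 0"
    and v: "th (v\<^sup>2) \<noteq> 0" and vw: "\<And>l. l \<in> A \<Longrightarrow> th (v * w l) \<noteq> 0" "\<And>l. l \<in> A \<Longrightarrow> th (v / w l) \<noteq> 0"
    and w': "\<And>l. l \<in> A \<Longrightarrow> w' l = w l" "w k = v" "w' k = 1 / v"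
  shows "bc_term b0 b1 b2 b3 t (insert k A) w * (bc_plus b0 b1 b2 b3 t (insert k A) w v - bc_minus b0 b1 b2 b3 t (insert k A) w v)
       + bc_term b0 b1 b2 b3 t (insert k A) w' * (bc_plus b0 b1 b2 b3 t (insert k A) w' v - bc_minus b0 b1 b2 b3 t (insert k A) w' v) = 0"
proof -
  define T where "T = bc_term b0 b1 b2 b3 t A w"
  define X where "X = (\<Prod>l\<in>A. th (t * w l / v) * th (t * v * w l) * (- (v / w l)))"
  define Nv where "Nv = th4 b0 b1 b2 b3 v"
  define Ni where "Ni = th4 b0 b1 b2 b3 (1 / v)"
  have T': "bc_term b0 b1 b2 b3 t A w' = T"
    unfolding T_def by (intro bc_term_cong w')
  have th2: "th ((1 / v)\<^sup>2) = - th (v\<^sup>2) / v\<^sup>2"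
    using th_inverse[of "v\<^sup>2"] nz by (simp add: power_divide)
  have p0: "bc_plus b0 b1 b2 b3 t (insert k A) w v = 0"
    using A nz by (simp add: bc_plus_def w')
  have m0: "bc_minus b0 b1 b2 b3 t (insert k A) w' v = 0"
    using A nz by (simp add: bc_minus_def w')
  have prod1: "(\<Prod>l\<in>A. th (t * v * w l) / th (v * w l)) * (\<Prod>l\<in>A. - (v / w l) * th (t * w l / v) * th (v * w l)) = X"
    unfolding X_def prod.distrib[symmetric] using vw by (intro prod.cong) auto
  have prod2: "(\<Prod>l\<in>A. th (t * (1 / v) * w l) / th (1 / v * w l)) * (\<Prod>l\<in>A. th (t * v * w l) * th (v / w l)) = X"
    unfolding X_def prod.distrib[symmetric]
  proof (intro prod.cong refl)
    fix l assume l: "l \<in> A"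
    have "th (1 / v * w l) = - th (v / w l) * w l / v"
      using th_inverse[of "v / w l"] nz(1) nz(2)[OF l] by simp
    then show "th (t * (1 / v) * w l) / th (1 / v * w l) * (th (t * v * w l) * th (v / w l)) =
        th (t * w l / v) * th (t * v * w l) * (- (v / w l))"
      using vw(2)[OF l] nz(1) nz(2)[OF l] by simp
  qed
  have "bc_term b0 b1 b2 b3 t (insert k A) w * bc_minus b0 b1 b2 b3 t (insert k A) w v =
      T * (Nv / th (v\<^sup>2)) * (v\<^sup>2 * Ni * (- 1 * th t * th (v\<^sup>2))) *
      ((\<Prod>l\<in>A. th (t * v * w l) / th (v * w l)) * (\<Prod>l\<in>A. - (v / w l) * th (t * w l / v) * th (v * w l)))"
    unfolding bc_term_insert[OF A] bc_minus_def prod.insert[OF A] w' T_def Nv_def Ni_def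
    using nz(1) by (simp add: power2_eq_square mult_ac)
  also have "\<dots> = - v\<^sup>2 * T * Nv * Ni * th t * X"
    unfolding prod1 using v by simp
  finally have 1: "bc_term b0 b1 b2 b3 t (insert k A) w * bc_minus b0 b1 b2 b3 t (insert k A) w v =
      - v\<^sup>2 * T * Nv * Ni * th t * X" .
  have "bc_plus b0 b1 b2 b3 t (insert k A) w' v =
      Nv * (th t * th (v\<^sup>2) * (\<Prod>l\<in>A. th (t * v * w l) * th (v / w l)))"
    unfolding bc_plus_def prod.insert[OF A] w'(3) Nv_def using nz(1)
    by (simp add: w' power2_eq_square cong: prod.cong)
  moreover have "bc_term b0 b1 b2 b3 t (insert k A) w' =
      T * (Ni / (- th (v\<^sup>2) / v\<^sup>2) * (\<Prod>l\<in>A. th (t * (1 / v) * w l) / th (1 / v * w l)))"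
    unfolding bc_term_insert[OF A] w'(3) th2 T' Ni_def by (simp add: w' cong: prod.cong)
  ultimately have "bc_term b0 b1 b2 b3 t (insert k A) w' * bc_plus b0 b1 b2 b3 t (insert k A) w' v =
      T * (Ni / (- th (v\<^sup>2) / v\<^sup>2)) * (Nv * (th t * th (v\<^sup>2))) *
      ((\<Prod>l\<in>A. th (t * (1 / v) * w l) / th (1 / v * w l)) * (\<Prod>l\<in>A. th (t * v * w l) * th (v / w l)))"
    by (simp only: mult_ac)
  also have "\<dots> = - v\<^sup>2 * T * Nv * Ni * th t * X"
    unfolding prod2 using v nz(1) by (simp add: field_simps)
  finally have 2: "bc_term b0 b1 b2 b3 t (insert k A) w' * bc_plus b0 b1 b2 b3 t (insert k A) w' v =
      - v\<^sup>2 * T * Nv * Ni * th t * X" .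
  show ?thesis unfolding p0 m0 using 1 2 by simp
qed

lemma bc_num_zero_pair:
  assumes A: "finite A" "k \<in> A" and gen: "generic A z" and v: "v = z k \<or> v = 1 / z k"
  shows "bc_num b0 b1 b2 b3 t A z v = 0"
proof -
  define A' where "A' = A - {k}"
  have A': "finite A'" "k \<notin> A'" "A = insert k A'" using A by (auto simp: A'_def)
  have zk: "z k \<noteq> 0" "th ((z k)\<^sup>2) \<noteq> 0" using gen A by (auto simp: generic_def)
  have zl: "z l \<noteq> 0" "th (z k * z l) \<noteq> 0" "th (z k / z l) \<noteq> 0" if "l \<in> A'" for l
    using gen A that by (auto simp: generic_def A'_def)
  have inv0: "th (1 / u) \<noteq> 0" if "u \<noteq> 0" "th u \<noteq> 0" for u
    using that by (simp add: th_inverse)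
  have v0: "v \<noteq> 0" using v zk by auto
  have vk: "th (v\<^sup>2) \<noteq> 0"
    using v zk inv0[of "(z k)\<^sup>2"] by (auto simp: power_divide)
  have vz: "th (v * z l) \<noteq> 0" "th (v / z l) \<noteq> 0" if "l \<in> A'" for l
    using v zk(1) zl[OF that] inv0[of "z k * z l"] inv0[of "z k / z l"] by (auto simp: mult.commute)
  show ?thesis
    unfolding bc_num_def A'(3) sum_Pow_insert[OF A'(1,2)]
  proof (intro sum.neutral ballI)
    fix E assume E: "E \<in> Pow A'"
    have fl: "flip E z l \<noteq> 0" "th (v * flip E z l) \<noteq> 0" "th (v / flip E z l) \<noteq> 0" if "l \<in> A'" for l
      using vz[OF that] zl(1)[OF that] by (auto simp: flip_def)
    have fl': "flip (insert k E) z l = flip E z l" if "l \<in> A'" for l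
      using that A' by (auto simp: flip_def)
    have fk: "flip E z k = z k" "flip (insert k E) z k = 1 / z k"
      using E A' by (auto simp: flip_def)
    show "bc_term b0 b1 b2 b3 t (insert k A') (flip E z) *
        (bc_plus b0 b1 b2 b3 t (insert k A') (flip E z) v - bc_minus b0 b1 b2 b3 t (insert k A') (flip E z) v) +
      bc_term b0 b1 b2 b3 t (insert k A') (flip (insert k E) z) *
        (bc_plus b0 b1 b2 b3 t (insert k A') (flip (insert k E) z) v - bc_minus b0 b1 b2 b3 t (insert k A') (flip (insert k E) z) v) = 0"
      using v
    proof
      assume "v = z k"
      then show ?thesis
        using fl fl' fk v0 vk by (intro bc_pair_cancel[OF A'(1,2)]) auto
    next
      \<comment> \<open>Now the subset containing \<open>k\<close> plays the role of the first
        point, hence the exchange of the summands.\<close>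
      assume "v = 1 / z k"
      then show ?thesis
        using fl fl' fk v0 vk zk
        by (subst add.commute, intro bc_pair_cancel[OF A'(1,2)]) auto
    qed
  qed
qed

text \<open>By quasi-periodicity it is enough to treat one point of each orbit of zeros of
  \<open>bc_den\<close>: the points with \<open>u\<^sup>2\<close> equal to 1 or \<open>q\<close>,
  and the points \<open>z k\<close> and \<open>1 / z k\<close>.\<close>

lemma bc_num_vanish:
  assumes A: "finite A" and gen: "generic A z"
    and nz: "b0 \<noteq> 0" "b1 \<noteq> 0" "b2 \<noteq> 0" "b3 \<noteq> 0" "t \<noteq> 0"
    and bal: "b0 * b1 * b2 * b3 * t ^ card A = q"
    and u: "u \<noteq> 0" "bc_den A z u = 0"
  shows "bc_num b0 b1 b2 b3 t A z u = 0"
proof -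
  have z: "z k \<noteq> 0" if "k \<in> A" for k using gen that by (auto simp: generic_def)
  have per: "bc_num b0 b1 b2 b3 t A z (q powi j * u') = 0 \<longleftrightarrow> bc_num b0 b1 b2 b3 t A z u' = 0"
    if "u' \<noteq> 0" for j u'
  proof (rule quasi_periodic_zero[OF _ that])
    fix x :: complex assume "x \<noteq> 0"
    then show "\<exists>m. m \<noteq> 0 \<and> bc_num b0 b1 b2 b3 t A z (q * x) = m * bc_num b0 b1 b2 b3 t A z x"
      using bc_num_q[OF A _ z nz bal, of x]
      by (intro exI[of _ "1 / (q * x ^ (4 + 2 * card A))"]) auto
  qed
  consider "th (u\<^sup>2) = 0" | k where "k \<in> A" "th (u * z k) = 0" | k where "k \<in> A" "th (u / z k) = 0"
    using u(2) A by (auto simp: bc_den_def prod_zero_iff)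
  then show ?thesis
  proof cases
    case 1
    then obtain j where j: "u\<^sup>2 = q powi j" using u(1) by (auto simp: th_eq_0_iff)
    \<comment> \<open>Dividing \<open>u\<close> by this power of \<open>q\<close> leaves a square
      \<open>q powi (j mod 2)\<close>, which is 1 or \<open>q\<close>.\<close>
    define i where "i = j div 2"
    define u0 where "u0 = u / q powi i"
    have "u0\<^sup>2 = q powi j / q powi (2 * i)"
      unfolding u0_def power_divide j by (simp add: power_int_mult mult.commute)
    also have "\<dots> = q powi (j - 2 * i)" by (simp add: power_int_diff)
    finally have "u0\<^sup>2 = q powi (j mod 2)"
      by (simp add: i_def minus_mult_div_eq_mod)
    moreover have "j mod 2 = 0 \<or> j mod 2 = 1" by auto
    ultimately have "u0\<^sup>2 = 1 \<or> u0\<^sup>2 = q" by auto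
    then have "bc_num b0 b1 b2 b3 t A z u0 = 0"
      using u(1) z nz by (intro bc_num_zero_square[OF A _ _ _ _ _ _ _ bal]) (auto simp: u0_def)
    then show ?thesis
      using per[of u0 i] u(1) by (simp add: u0_def)
  next
    case 2
    then obtain j where "u * z k = q powi j" using u(1) z by (auto simp: th_eq_0_iff)
    then have "u = q powi j * (1 / z k)" using z[OF 2(1)] by (simp add: field_simps)
    then show ?thesis
      using per[of "1 / z k" j] bc_num_zero_pair[OF A 2(1) gen, of "1 / z k"] z[OF 2(1)] by simp
  next
    case 3
    then obtain j where "u / z k = q powi j" using u(1) z by (auto simp: th_eq_0_iff)
    then have "u = q powi j * z k" using z[OF 3(1)] by (simp add: field_simps)
    then show ?thesis
      using per[of "z k" j] bc_num_zero_pair[OF A 3(1) gen, of "z k"] z[OF 3(1)] by simp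
  qed
qed

text \<open>At \<open>u = 1 / b1\<close> the factor \<open>th (b1 * u)\<close> kills every
  \<open>bc_plus\<close>. In \<open>bc_minus\<close>, \<open>th (t * w k / u)\<close> is
  \<open>th (t * b1 * w k)\<close> and replaces the factor \<open>th (b1 * w k)\<close> of
  \<open>bc_term\<close>, which is absorbed into \<open>bc_den\<close>. What remains is the same sum
  with parameter \<open>t * b1\<close>.\<close>

lemma bc_num_at_inverse:
  assumes A: "finite A" and z: "\<And>k. k \<in> A \<Longrightarrow> z k \<noteq> 0" and nz: "b1 \<noteq> 0"
  shows "bc_num b0 b1 b2 b3 t A z (1 / b1) = th (b0 * b1) * th (b2 * b1) * th (b3 * b1) *
     bc_den A z (1 / b1) * (\<Sum>E\<in>Pow A. bc_term b0 (t * b1) b2 b3 t A (flip E z))"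
  unfolding bc_num_def sum_distrib_left
proof (intro sum.cong refl)
  fix E assume "E \<in> Pow A"
  define w where "w = flip E z"
  have w: "w k \<noteq> 0" if "k \<in> A" for k using z[OF that] by (simp add: w_def flip_nonzero)
  have plus: "bc_plus b0 b1 b2 b3 t A w (1 / b1) = 0"
    using nz by (simp add: bc_plus_def th4_def)
  have fac: "(\<Prod>k\<in>A. th4 b0 b1 b2 b3 (w k) / th ((w k)\<^sup>2)) *
      (\<Prod>k\<in>A. - (1 / b1 / w k) * th (t * w k / (1 / b1)) * th (1 / b1 * w k)) =
      (\<Prod>k\<in>A. th4 b0 (t * b1) b2 b3 (w k) / th ((w k)\<^sup>2)) *
      (\<Prod>k\<in>A. th (1 / b1 * w k) * th (1 / b1 / w k))"
    unfolding prod.distrib[symmetric]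
  proof (intro prod.cong refl)
    fix k assume k: "k \<in> A"
    have "th (1 / b1 / w k) = - th (b1 * w k) / (b1 * w k)"
      using th_inverse[of "b1 * w k"] nz w[OF k] by simp
    then have 1: "th (b1 * w k) * - (1 / b1 / w k) = th (1 / b1 / w k)" by simp
    have 2: "t * w k / (1 / b1) = t * b1 * w k" by simp
    have "th4 b0 b1 b2 b3 (w k) / th ((w k)\<^sup>2) * (- (1 / b1 / w k) * th (t * w k / (1 / b1)) * th (1 / b1 * w k)) =
      th (b0 * w k) * (th (b1 * w k) * - (1 / b1 / w k)) * th (b2 * w k) * th (b3 * w k) / th ((w k)\<^sup>2) *
       (th (t * b1 * w k) * th (1 / b1 * w k))"
      unfolding th4_def 2 by (simp only: mult_ac times_divide_eq_left times_divide_eq_right)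
    also have "\<dots> = th4 b0 (t * b1) b2 b3 (w k) / th ((w k)\<^sup>2) * (th (1 / b1 * w k) * th (1 / b1 / w k))"
      unfolding 1 th4_def by (simp only: mult_ac times_divide_eq_left times_divide_eq_right)
    finally show "th4 b0 b1 b2 b3 (w k) / th ((w k)\<^sup>2) * (- (1 / b1 / w k) * th (t * w k / (1 / b1)) * th (1 / b1 * w k)) =
      th4 b0 (t * b1) b2 b3 (w k) / th ((w k)\<^sup>2) * (th (1 / b1 * w k) * th (1 / b1 / w k))" .
  qed
  have den: "bc_den A z (1 / b1) = th ((1 / b1)\<^sup>2) * (\<Prod>k\<in>A. th (1 / b1 * w k) * th (1 / b1 / w k))"
    unfolding bc_den_def w_def flip_pair ..
  have sq: "(1 / b1)\<^sup>2 * th (b1\<^sup>2) = - th ((1 / b1)\<^sup>2)"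
    using th_inverse[of "b1\<^sup>2"] nz by (simp add: power_divide)
  define Y where "Y = pairprod A (\<lambda>j k. th (t * w j * w k) / th (w j * w k))"
  have "bc_term b0 b1 b2 b3 t A w * bc_minus b0 b1 b2 b3 t A w (1 / b1) =
     Y * ((1 / b1)\<^sup>2 * th (b1\<^sup>2)) * (th (b0 * b1) * th (b2 * b1) * th (b3 * b1)) *
     ((\<Prod>k\<in>A. th4 b0 b1 b2 b3 (w k) / th ((w k)\<^sup>2)) *
      (\<Prod>k\<in>A. - (1 / b1 / w k) * th (t * w k / (1 / b1)) * th (1 / b1 * w k)))"
    unfolding bc_term_def bc_minus_def Y_def th4_def[of b0 b1 b2 b3 "1 / (1 / b1)"]
    by (simp add: power2_eq_square[of b1] mult_ac)
  also have "\<dots> = - (th (b0 * b1) * th (b2 * b1) * th (b3 * b1) * bc_den A z (1 / b1) * bc_term b0 (t * b1) b2 b3 t A w)"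
    unfolding fac sq den bc_term_def Y_def by (simp add: mult_ac)
  finally have "bc_term b0 b1 b2 b3 t A w * bc_minus b0 b1 b2 b3 t A w (1 / b1) =
    - (th (b0 * b1) * th (b2 * b1) * th (b3 * b1) * bc_den A z (1 / b1) * bc_term b0 (t * b1) b2 b3 t A w)" .
  then show "bc_term b0 b1 b2 b3 t A (flip E z) *
        (bc_plus b0 b1 b2 b3 t A (flip E z) (1 / b1) - bc_minus b0 b1 b2 b3 t A (flip E z) (1 / b1)) =
       th (b0 * b1) * th (b2 * b1) * th (b3 * b1) * bc_den A z (1 / b1) * bc_term b0 (t * b1) b2 b3 t A (flip E z)"
    unfolding w_def[symmetric] plus by simp
qed

text \<open>As a function of one coordinate the sum is an elliptic function without poles, hence a
  constant, which is read off at \<open>1 / b1\<close>. There the sum over the smaller set with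
  \<open>t * b1\<close> appears; this is why the induction runs over arbitrary \<open>b1\<close> and
  the nonvanishing conditions concern all \<open>t ^ i * b1\<close>.\<close>

theorem bc_theta_identity:
  assumes "finite A" and "generic A z"
    and "b0 \<noteq> 0" "b1 \<noteq> 0" "b2 \<noteq> 0" "b3 \<noteq> 0" "t \<noteq> 0"
    and "A \<noteq> {} \<Longrightarrow> b0 * b1 * b2 * b3 * t ^ (card A - 1) = q"
    and "\<And>k i. k \<in> A \<Longrightarrow> i < card A \<Longrightarrow> th (t ^ i * b1 * z k) \<noteq> 0 \<and> th (t ^ i * b1 / z k) \<noteq> 0"
    and "\<And>i. i < card A \<Longrightarrow> th ((t ^ i * b1)\<^sup>2) \<noteq> 0"
  shows "(\<Sum>E\<in>Pow A. bc_term b0 b1 b2 b3 t A (flip E z)) =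
     (\<Prod>i<card A. th (t ^ i * b1 * b2) * th (t ^ i * b1 * b3) * th (t ^ i * b2 * b3))"
  using assms
proof (induction A arbitrary: b1 rule: finite_induct)
  case empty
  then show ?case by (simp add: bc_term_def pairprod_def)
next
  case (insert x A)
  note gen = insert.prems(1) and nz = insert.prems(2-6)
  have gA: "generic A z" using gen by (auto simp: generic_def)
  have z: "z k \<noteq> 0" if "k \<in> insert x A" for k using gen that by (auto simp: generic_def)
  have bal: "b0 * b1 * b2 * b3 * t ^ card A = q"
    using insert.prems(7) insert.hyps by simp
  obtain C where C: "\<And>u. u \<noteq> 0 \<Longrightarrow> bc_num b0 b1 b2 b3 t A z u = C * bc_den A z u"
  proof (rule quasi_periodic_proportional)
    have "flip E z k \<noteq> 0" if "k \<in> A" for E k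
      using z[of k] that by (simp add: flip_nonzero)
    then show "bc_num b0 b1 b2 b3 t A z holomorphic_on - {0}"
      unfolding bc_num_def bc_plus_def bc_minus_def using nz
      by (intro holomorphic_intros) auto
    show "bc_den A z holomorphic_on - {0}"
      unfolding bc_den_def using z by (intro holomorphic_intros) auto
    show "simple_zeros (bc_den A z)"
      by (rule bc_den_simple_zeros[OF insert.hyps(1) gA])
    show "bc_num b0 b1 b2 b3 t A z u = 0" if "u \<noteq> 0" "bc_den A z u = 0" for u
      by (rule bc_num_vanish[OF insert.hyps(1) gA nz bal that])
    show "1 / (q * u ^ (4 + 2 * card A)) \<noteq> 0" if "u \<noteq> 0" for u :: complex
      using that by simp
    show "bc_num b0 b1 b2 b3 t A z (q * u) = 1 / (q * u ^ (4 + 2 * card A)) * bc_num b0 b1 b2 b3 t A z u"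
      if "u \<noteq> 0" for u
      using z by (intro bc_num_q[OF insert.hyps(1) that _ nz bal]) auto
    show "bc_den A z (q * u) = 1 / (q * u ^ (4 + 2 * card A)) * bc_den A z u" if "u \<noteq> 0" for u
      using z by (intro bc_den_q[OF insert.hyps(1) that]) auto
  qed (rule that)
  have inv0: "th (1 / u) \<noteq> 0" if "u \<noteq> 0" "th u \<noteq> 0" for u
    using that by (simp add: th_inverse)
  have "bc_den A z (1 / b1) \<noteq> 0"
  proof -
    have "th (1 / b1 * z k) \<noteq> 0 \<and> th (1 / b1 / z k) \<noteq> 0" if k: "k \<in> A" for k
      using inv0[of "b1 * z k"] inv0[of "b1 / z k"] insert.prems(8)[of k 0] k z[of k] nz insert.hyps
      by (auto simp: mult.commute)
    moreover have "th ((1 / b1)\<^sup>2) \<noteq> 0"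
      using inv0[of "b1\<^sup>2"] insert.prems(9)[of 0] nz insert.hyps by (simp add: power_divide)
    ultimately show ?thesis
      using insert.hyps by (simp add: bc_den_def prod_zero_iff)
  qed
  then have C_eq: "C = th (b0 * b1) * th (b2 * b1) * th (b3 * b1) *
      (\<Sum>E\<in>Pow A. bc_term b0 (t * b1) b2 b3 t A (flip E z))"
  proof (rule mult_right_cancel[THEN iffD1])
    have "C * bc_den A z (1 / b1) = bc_num b0 b1 b2 b3 t A z (1 / b1)"
      using C[of "1 / b1"] nz by simp
    also have "\<dots> = th (b0 * b1) * th (b2 * b1) * th (b3 * b1) *
        bc_den A z (1 / b1) * (\<Sum>E\<in>Pow A. bc_term b0 (t * b1) b2 b3 t A (flip E z))"
      using nz z by (intro bc_num_at_inverse insert.hyps(1)) auto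
    finally show "C * bc_den A z (1 / b1) = th (b0 * b1) * th (b2 * b1) * th (b3 * b1) *
        (\<Sum>E\<in>Pow A. bc_term b0 (t * b1) b2 b3 t A (flip E z)) * bc_den A z (1 / b1)"
      by (simp only: mult_ac)
  qed
  have IH: "(\<Sum>E\<in>Pow A. bc_term b0 (t * b1) b2 b3 t A (flip E z)) =
     (\<Prod>i<card A. th (t ^ i * (t * b1) * b2) * th (t ^ i * (t * b1) * b3) * th (t ^ i * b2 * b3))"
  proof (rule insert.IH[OF gA])
    show "b0 * (t * b1) * b2 * b3 * t ^ (card A - 1) = q" if "A \<noteq> {}"
    proof -
      have "card A \<noteq> 0" using that insert.hyps by simp
      then have "t ^ card A = t * t ^ (card A - 1)" by (cases "card A") auto
      then show ?thesis using bal by (simp add: mult_ac)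
    qed
  next
    fix k i assume "k \<in> A" "i < card A"
    then show "th (t ^ i * (t * b1) * z k) \<noteq> 0 \<and> th (t ^ i * (t * b1) / z k) \<noteq> 0"
      using insert.prems(8)[of k "Suc i"] insert.hyps by (simp add: mult_ac)
  next
    fix i assume "i < card A"
    then show "th ((t ^ i * (t * b1))\<^sup>2) \<noteq> 0"
      using insert.prems(9)[of "Suc i"] insert.hyps by (simp add: mult_ac)
  qed (use nz in auto)
  have den_x: "bc_den A z (z x) \<noteq> 0"
  proof -
    have "th (z x * z k) * th (z x / z k) \<noteq> 0" if "k \<in> A" for k
      using gen that insert.hyps by (auto simp: generic_def)
    then show ?thesis
      using gen insert.hyps by (auto simp: bc_den_def prod_zero_iff generic_def)
  qed
  \<comment> \<open>The balancing condition and \<open>th (q / u) = th u\<close> eliminate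
    \<open>b0\<close> and supply the factor with \<open>i = card A\<close> of the product of the
    \<open>th (t ^ i * b2 * b3)\<close>.\<close>
  have "b0 * b1 = q / (t ^ card A * b2 * b3)"
    using nz unfolding bal[symmetric] by simp
  then have b01: "th (b0 * b1) = th (t ^ card A * b2 * b3)"
    using theta_quasi_inverse[of "t ^ card A * b2 * b3" q] nz by simp
  have "(\<Sum>E\<in>Pow (insert x A). bc_term b0 b1 b2 b3 t (insert x A) (flip E z)) =
      bc_num b0 b1 b2 b3 t A z (z x) / bc_den A z (z x)"
    using insert.hyps z den_x by (intro bc_sum_eq_quotient) auto
  also have "\<dots> = C"
    using C[of "z x"] z[of x] den_x by simp
  also have "\<dots> = th (b1 * b2) * th (b1 * b3) * th (t ^ card A * b2 * b3) *
      (\<Prod>i<card A. th (t ^ i * (t * b1) * b2) * th (t ^ i * (t * b1) * b3) * th (t ^ i * b2 * b3))"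
    unfolding C_eq IH b01 by (simp add: mult_ac)
  also have "\<dots> = (\<Prod>i<Suc (card A). th (t ^ i * b1 * b2) * th (t ^ i * b1 * b3)) * (\<Prod>i<Suc (card A). th (t ^ i * b2 * b3))"
    unfolding prod.lessThan_Suc_shift[of "\<lambda>i. th (t ^ i * b1 * b2) * th (t ^ i * b1 * b3)"]
    by (simp add: prod.distrib mult_ac)
  finally show ?case
    using insert.hyps by (simp add: prod.distrib mult_ac)
qed

end

subsection \<open>Integration over the torus\<close>

definition torus :: "nat \<Rightarrow> (nat \<Rightarrow> complex) set" where
  "torus n = (\<Pi>\<^sub>E i\<in>{1..n}. sphere 0 1)"

abbreviation unit_measure :: "real measure" where
  "unit_measure \<equiv> restrict_space lborel {0..1}"

abbreviation torus_measure :: "nat \<Rightarrow> (nat \<Rightarrow> real) measure" where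
  "torus_measure n \<equiv> Pi\<^sub>M {1..n} (\<lambda>_. unit_measure)"

definition torus_point :: "nat \<Rightarrow> (nat \<Rightarrow> real) \<Rightarrow> nat \<Rightarrow> complex" where
  "torus_point n x = (\<lambda>i\<in>{1..n}. cis (2 * pi * x i))"

lemma torus_integral_eq:
  "torus_integral n f = (\<integral>x. f (torus_point n x) \<partial>torus_measure n)"
  by (simp add: torus_integral_cis torus_point_def)

lemma torus_point_in [simp]: "torus_point n x \<in> torus n"
  by (auto simp: torus_point_def torus_def)

lemma torus_norm: "z \<in> torus n \<Longrightarrow> i \<in> {1..n} \<Longrightarrow> norm (z i) = 1"
  by (auto simp: torus_def PiE_iff)

lemma torus_nonzero: "z \<in> torus n \<Longrightarrow> i \<in> {1..n} \<Longrightarrow> z i \<noteq> 0"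
  using torus_norm by fastforce

lemma torus_integral_cong:
  "(\<And>z. z \<in> torus n \<Longrightarrow> f z = g z) \<Longrightarrow> torus_integral n f = torus_integral n g"
  unfolding torus_integral_eq by (intro Bochner_Integration.integral_cong) auto

text \<open>Points of the torus take the value \<open>undefined\<close> outside the index range, so
  the torus is a product of compact sets over all natural numbers and Tychonoff's theorem
  applies.\<close>

lemma compact_torus: "compact (torus n)"
proof -
  have "torus n = (\<Pi>\<^sub>E i\<in>UNIV. if i \<in> {1..n} then sphere 0 1 else {undefined})"
    by (auto simp: torus_def PiE_iff extensional_def split: if_splits)
  moreover have "compactin (product_topology (\<lambda>_. euclidean) UNIV)
      (\<Pi>\<^sub>E i\<in>(UNIV :: nat set). if i \<in> {1..n} then sphere 0 (1 :: real) else {undefined :: complex})"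
    by (subst compactin_PiE) auto
  ultimately show ?thesis
    by (simp add: euclidean_product_topology)
qed

lemma prob_space_unit: "prob_space unit_measure"
  by (rule prob_spaceI) (simp add: space_restrict_space emeasure_restrict_space)

lemma prob_space_torus: "prob_space (torus_measure n)"
  by (intro prob_space_PiM prob_space_unit)

lemma measurable_unit_borel: "f \<in> borel_measurable borel \<Longrightarrow> f \<in> borel_measurable unit_measure"
  by (intro measurable_restrict_space1) simp

lemma measurable_torus_point: "torus_point n \<in> borel_measurable (torus_measure n)"
proof (rule measurable_coordinatewise_then_product)
  fix i
  show "(\<lambda>x. torus_point n x i) \<in> borel_measurable (torus_measure n)"
  proof (cases "i \<in> {1..n}")
    case True
    have "(\<lambda>x. cis (2 * pi * x)) \<in> borel_measurable unit_measure"
      by (intro measurable_unit_borel borel_measurable_continuous_onI continuous_intros)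
    from measurable_compose[OF measurable_component_singleton[OF True] this]
    show ?thesis using True by (simp add: torus_point_def)
  next
    case False
    then have "(\<lambda>x. torus_point n x i) = (\<lambda>_. undefined)"
      by (auto simp: torus_point_def)
    then show ?thesis by simp
  qed
qed

lemma measurable_torus_continuous:
  fixes f :: "(nat \<Rightarrow> complex) \<Rightarrow> 'b :: topological_space"
  assumes "continuous_on (torus n) f"
  shows "(\<lambda>x. f (torus_point n x)) \<in> borel_measurable (torus_measure n)"
proof (rule measurable_compose[OF _ borel_measurable_continuous_on_restrict[OF assms]])
  show "torus_point n \<in> torus_measure n \<rightarrow>\<^sub>M restrict_space borel (torus n)"
    by (intro measurable_restrict_space2 measurable_torus_point) auto
qed

lemma torus_bounded:
  fixes f :: "(nat \<Rightarrow> complex) \<Rightarrow> complex"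
  assumes "continuous_on (torus n) f"
  obtains B where "\<And>z. z \<in> torus n \<Longrightarrow> norm (f z) \<le> B"
  using compact_imp_bounded[OF compact_continuous_image[OF assms compact_torus]]
  by (auto simp: bounded_iff)

lemma integrable_torus:
  fixes f :: "(nat \<Rightarrow> complex) \<Rightarrow> complex"
  assumes "continuous_on (torus n) f"
  shows "integrable (torus_measure n) (\<lambda>x. f (torus_point n x))"
proof -
  interpret prob_space "torus_measure n" by (rule prob_space_torus)
  obtain B where "\<And>z. z \<in> torus n \<Longrightarrow> norm (f z) \<le> B"
    using torus_bounded[OF assms] by blast
  then show ?thesis
    by (intro integrable_const_bound[of _ B] measurable_torus_continuous assms) auto
qed

lemma torus_integral_cmult: "torus_integral n (\<lambda>z. c * f z) = c * torus_integral n f"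
  unfolding torus_integral_eq by simp

lemma torus_integral_sum:
  assumes "\<And>k. k \<in> K \<Longrightarrow> continuous_on (torus n) (f k)"
  shows "torus_integral n (\<lambda>z. \<Sum>k\<in>K. f k z) = (\<Sum>k\<in>K. torus_integral n (f k))"
  unfolding torus_integral_eq
  by (intro Bochner_Integration.integral_sum integrable_torus assms)

lemma torus_integral_diff:
  assumes "continuous_on (torus n) f" "continuous_on (torus n) g"
  shows "torus_integral n (\<lambda>z. f z - g z) = torus_integral n f - torus_integral n g"
  unfolding torus_integral_eq
  by (intro Bochner_Integration.integral_diff integrable_torus assms)

section \<open>Integrals depending on a parameter\<close>

lemma continuous_on_slice:
  assumes "continuous_on (S \<times> T) (\<lambda>(s, z). f s z)" "s \<in> S"
  shows "continuous_on T (f s)"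
proof -
  have "continuous_on T (\<lambda>z. (s, z))" by (intro continuous_intros)
  from continuous_on_compose2[OF assms(1) this] show ?thesis using assms(2) by auto
qed

lemma torus_integral_tendsto:
  fixes f :: "nat \<Rightarrow> (nat \<Rightarrow> complex) \<Rightarrow> complex"
  assumes cont: "\<And>k. continuous_on (torus n) (f k)"
    and lim: "\<And>z. z \<in> torus n \<Longrightarrow> (\<lambda>k. f k z) \<longlonglongrightarrow> g z"
    and bd: "\<And>k z. z \<in> torus n \<Longrightarrow> norm (f k z) \<le> B"
  shows "(\<lambda>k. torus_integral n (f k)) \<longlonglongrightarrow> torus_integral n g"
proof -
  interpret prob_space "torus_measure n" by (rule prob_space_torus)
  have meas: "(\<lambda>x. f k (torus_point n x)) \<in> borel_measurable (torus_measure n)" for k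
    by (intro measurable_torus_continuous cont)
  show ?thesis
    unfolding torus_integral_eq
  proof (rule integral_dominated_convergence[of _ _ _ "\<lambda>_. B"])
    show "(\<lambda>x. g (torus_point n x)) \<in> borel_measurable (torus_measure n)"
      by (rule borel_measurable_LIMSEQ_metric[of "\<lambda>k x. f k (torus_point n x)", OF meas]) (simp add: lim)
    show "integrable (torus_measure n) (\<lambda>_. B)" by (rule integrable_const)
  qed (use meas lim bd in auto)
qed

text \<open>A convergent sequence together with its limit is compact, so the integrands along it
  have a common bound, and dominated convergence applies.\<close>

lemma torus_integral_continuous:
  fixes f :: "'a :: heine_borel \<Rightarrow> (nat \<Rightarrow> complex) \<Rightarrow> complex"
  assumes cont: "continuous_on (S \<times> torus n) (\<lambda>(s, z). f s z)"
  shows "continuous_on S (\<lambda>s. torus_integral n (f s))"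
  unfolding continuous_on_sequentially o_def
proof safe
  fix x :: "nat \<Rightarrow> 'a" and a
  assume a: "a \<in> S" and x: "\<forall>k. x k \<in> S" and lim: "x \<longlonglongrightarrow> a"
  define K where "K = insert a (range x)"
  have "compact (K \<times> torus n)"
    unfolding K_def by (intro compact_Times compact_sequence_with_limit lim compact_torus)
  moreover have "continuous_on (K \<times> torus n) (\<lambda>(s, z). f s z)"
    using a x by (intro continuous_on_subset[OF cont]) (auto simp: K_def)
  ultimately have "bounded ((\<lambda>(s, z). f s z) ` (K \<times> torus n))"
    by (intro compact_imp_bounded compact_continuous_image)
  then obtain B where B: "\<And>s z. s \<in> K \<Longrightarrow> z \<in> torus n \<Longrightarrow> norm (f s z) \<le> B"
    unfolding bounded_iff by fastforce
  show "(\<lambda>k. torus_integral n (f (x k))) \<longlonglongrightarrow> torus_integral n (f a)"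
  proof (rule torus_integral_tendsto[of _ _ _ B])
    show "continuous_on (torus n) (f (x k))" for k
      using x by (intro continuous_on_slice[OF cont]) auto
    show "norm (f (x k) z) \<le> B" if "z \<in> torus n" for k z
      using that by (intro B) (auto simp: K_def)
    fix z assume z: "z \<in> torus n"
    have "continuous_on S (\<lambda>s. (s, z))" by (intro continuous_intros)
    from continuous_on_compose2[OF cont this] have "continuous_on S (\<lambda>s. f s z)" using z by auto
    then show "(\<lambda>k. f (x k) z) \<longlonglongrightarrow> f a z"
      using a x lim by (auto simp: continuous_on_sequentially o_def)
  qed
qed

text \<open>A bound \<open>B\<close> on a disc of radius \<open>2 * r\<close> gives by Cauchy's
  inequality the bound \<open>B / r\<close> for the derivative on the disc of radius
  \<open>r\<close>. The difference quotients are dominated by this constant, so the derivative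
  passes under the integral.\<close>

lemma torus_integral_holomorphic:
  fixes f :: "complex \<Rightarrow> (nat \<Rightarrow> complex) \<Rightarrow> complex"
  assumes S: "open S" and cont: "continuous_on (S \<times> torus n) (\<lambda>(s, z). f s z)"
    and holo: "\<And>z. z \<in> torus n \<Longrightarrow> (\<lambda>s. f s z) holomorphic_on S"
  shows "(\<lambda>s. torus_integral n (f s)) holomorphic_on S"
proof -
  define D where "D s z = deriv (\<lambda>s. f s z) s" for s z
  have "((\<lambda>s. torus_integral n (f s)) has_field_derivative torus_integral n (D a)) (at a)"
    if a: "a \<in> S" for a
  proof -
    obtain r0 where r0: "r0 > 0" "cball a r0 \<subseteq> S"
      using S a open_contains_cball by blast
    define r where "r = r0 / 2"
    have r: "r > 0" "cball a (2 * r) \<subseteq> S" using r0 by (auto simp: r_def)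
    have "compact (cball a (2 * r) \<times> torus n)"
      by (intro compact_Times compact_torus compact_cball)
    moreover have "continuous_on (cball a (2 * r) \<times> torus n) (\<lambda>(s, z). f s z)"
      using r by (intro continuous_on_subset[OF cont]) auto
    ultimately have "bounded ((\<lambda>(s, z). f s z) ` (cball a (2 * r) \<times> torus n))"
      by (intro compact_imp_bounded compact_continuous_image)
    then obtain B where B: "\<And>s z. s \<in> cball a (2 * r) \<Longrightarrow> z \<in> torus n \<Longrightarrow> norm (f s z) \<le> B"
      unfolding bounded_iff by fastforce
    have deriv: "((\<lambda>s. f s z) has_field_derivative D s z) (at s)" if "s \<in> S" "z \<in> torus n" for s z
      unfolding D_def using holo[OF that(2)] S that(1) by (rule holomorphic_derivI)
    have Dbound: "norm (D s z) \<le> B / r" if "s \<in> cball a r" "z \<in> torus n" for s z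
    proof -
      have sub: "cball s r \<subseteq> cball a (2 * r)"
      proof
        fix w assume "w \<in> cball s r"
        then show "w \<in> cball a (2 * r)"
          using that(1) dist_triangle[of a w s] by auto
      qed
      have "norm ((deriv ^^ 1) (\<lambda>s. f s z) s) \<le> fact 1 * B / r ^ 1"
      proof (rule Cauchy_inequality)
        show "(\<lambda>s. f s z) holomorphic_on ball s r"
          using sub r by (intro holomorphic_on_subset[OF holo[OF that(2)]]) (meson ball_subset_cball subset_trans)
        show "continuous_on (cball s r) (\<lambda>s. f s z)"
          using sub r by (intro holomorphic_on_imp_continuous_on holomorphic_on_subset[OF holo[OF that(2)]]) blast
        fix x assume "norm (s - x) = r"
        then have "x \<in> cball s r" by (simp add: dist_norm)
        then show "norm (f x z) \<le> B" using sub that(2) by (intro B) auto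
      qed (use r in auto)
      then show ?thesis by (simp add: D_def)
    qed
    have lip: "norm (f s z - f a z) \<le> B / r * norm (s - a)" if "s \<in> cball a r" "z \<in> torus n" for s z
    proof (rule field_differentiable_bound[of "cball a r" "\<lambda>s. f s z" "\<lambda>s. D s z"])
      fix w assume w: "w \<in> cball a r"
      then have "w \<in> S" using r by (auto simp: subset_iff)
      then show "((\<lambda>s. f s z) has_field_derivative D w z) (at w within cball a r)"
        using deriv that(2) by (blast intro: has_field_derivative_at_within)
      show "norm (D w z) \<le> B / r" using Dbound w that(2) .
    qed (use that r in auto)
    show ?thesis
      unfolding has_field_derivative_iff tendsto_at_iff_sequentially o_def
    proof (intro allI impI)
      fix X :: "nat \<Rightarrow> complex"
      assume X: "\<forall>i. X i \<in> UNIV - {a}" and lim: "X \<longlonglongrightarrow> a"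
      from lim r(1) obtain N where N: "\<And>k. k \<ge> N \<Longrightarrow> dist (X k) a < r"
        unfolding lim_sequentially by blast
      define Y where "Y k = X (k + N)" for k
      have Y: "Y k \<in> cball a r" "Y k \<noteq> a" "Y k \<in> S" for k
        using N[of "k + N"] X r(1) subsetD[OF r(2), of "X (k + N)"] by (auto simp: Y_def dist_commute)
      have Ylim: "Y \<longlonglongrightarrow> a" unfolding Y_def by (rule LIMSEQ_ignore_initial_segment[OF lim])
      have ca: "continuous_on (torus n) (f s)" if "s \<in> S" for s
        by (rule continuous_on_slice[OF cont that])
      have "(\<lambda>k. torus_integral n (\<lambda>z. (f (Y k) z - f a z) / (Y k - a))) \<longlonglongrightarrow> torus_integral n (D a)"
      proof (rule torus_integral_tendsto[of _ _ _ "B / r"])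
        show "continuous_on (torus n) (\<lambda>z. (f (Y k) z - f a z) / (Y k - a))" for k
          using Y a by (intro continuous_intros ca) auto
        fix z assume z: "z \<in> torus n"
        show "norm ((f (Y k) z - f a z) / (Y k - a)) \<le> B / r" for k
          using lip[OF Y(1)[of k] z] Y(2)[of k] by (simp add: norm_divide pos_divide_le_eq)
        show "(\<lambda>k. (f (Y k) z - f a z) / (Y k - a)) \<longlonglongrightarrow> D a z"
          using deriv[OF a z] Y Ylim
          unfolding has_field_derivative_iff tendsto_at_iff_sequentially o_def by auto
      qed
      also have "(\<lambda>k. torus_integral n (\<lambda>z. (f (Y k) z - f a z) / (Y k - a))) =
          (\<lambda>k. (torus_integral n (f (Y k)) - torus_integral n (f a)) / (Y k - a))"
      proof
        fix k
        have "torus_integral n (\<lambda>z. 1 / (Y k - a) * (f (Y k) z - f a z)) =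
            1 / (Y k - a) * (torus_integral n (f (Y k)) - torus_integral n (f a))"
          unfolding torus_integral_cmult using ca Y(3) a by (subst torus_integral_diff) auto
        then show "torus_integral n (\<lambda>z. (f (Y k) z - f a z) / (Y k - a)) =
            (torus_integral n (f (Y k)) - torus_integral n (f a)) / (Y k - a)"
          by simp
      qed
      finally show "(\<lambda>k. (torus_integral n (f (X k)) - torus_integral n (f a)) / (X k - a))
          \<longlonglongrightarrow> torus_integral n (D a)"
        unfolding Y_def by (rule LIMSEQ_offset)
    qed
  qed
  then show ?thesis
    unfolding holomorphic_on_def field_differentiable_def
    by (blast intro: has_field_derivative_at_within)
qed

subsection \<open>Symmetries of the torus\<close>

text \<open>The shifted interval is cut at 1 and its right part is moved back by the period; the
  endpoints form a null set.\<close>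

lemma nn_integral_periodic_shift:
  fixes p :: "real \<Rightarrow> ennreal"
  assumes [measurable]: "p \<in> borel_measurable borel" and per: "\<And>x. p (x + 1) = p x" and c: "0 \<le> c" "c \<le> 1"
  shows "(\<integral>\<^sup>+x. p (x + c) * indicator {0..1} x \<partial>lborel) = (\<integral>\<^sup>+x. p x * indicator {0..1} x \<partial>lborel)"
proof -
  have "(\<integral>\<^sup>+x. p x * indicator {c..1 + c} x \<partial>lborel) =
      (\<integral>\<^sup>+x. p (c + 1 * x) * indicator {c..1 + c} (c + 1 * x) \<partial>lborel)"
    using nn_integral_real_affine[of "\<lambda>x. p x * indicator {c..1 + c} x" 1 c] by simp
  also have "\<dots> = (\<integral>\<^sup>+x. p (x + c) * indicator {0..1} x \<partial>lborel)"
    by (intro nn_integral_cong) (auto simp: indicator_def add.commute)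
  finally have 1: "(\<integral>\<^sup>+x. p (x + c) * indicator {0..1} x \<partial>lborel) = (\<integral>\<^sup>+x. p x * indicator {c..1 + c} x \<partial>lborel)" ..
  have "(\<integral>\<^sup>+x. p x * indicator {1<..1 + c} x \<partial>lborel) =
      (\<integral>\<^sup>+x. p (1 + 1 * x) * indicator {1<..1 + c} (1 + 1 * x) \<partial>lborel)"
    using nn_integral_real_affine[of "\<lambda>x. p x * indicator {1<..1 + c} x" 1 1] by simp
  also have "\<dots> = (\<integral>\<^sup>+x. p x * indicator {0<..c} x \<partial>lborel)"
    using per by (intro nn_integral_cong) (auto simp: indicator_def add.commute)
  finally have 2: "(\<integral>\<^sup>+x. p x * indicator {1<..1 + c} x \<partial>lborel) = (\<integral>\<^sup>+x. p x * indicator {0<..c} x \<partial>lborel)" .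
  have "(\<integral>\<^sup>+x. p x * indicator {c..1 + c} x \<partial>lborel) =
      (\<integral>\<^sup>+x. p x * indicator {c..1} x + p x * indicator {1<..1 + c} x \<partial>lborel)"
    using c by (intro nn_integral_cong) (auto simp: indicator_def)
  also have "\<dots> = (\<integral>\<^sup>+x. p x * indicator {c..1} x \<partial>lborel) + (\<integral>\<^sup>+x. p x * indicator {0<..c} x \<partial>lborel)"
    by (subst nn_integral_add) (auto simp: 2)
  also have "\<dots> = (\<integral>\<^sup>+x. p x * indicator {c..1} x + p x * indicator {0<..c} x \<partial>lborel)"
    by (subst nn_integral_add) auto
  also have "\<dots> = (\<integral>\<^sup>+x. p x * indicator {0..1} x \<partial>lborel)"
  proof (rule nn_integral_cong_AE)
    have "AE x in lborel. x \<noteq> c" "AE x in lborel. x \<noteq> (0 :: real)"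
      by (rule AE_lborel_singleton)+
    then show "AE x in lborel. p x * indicator {c..1} x + p x * indicator {0<..c} x = p x * indicator {0..1} x"
      by eventually_elim (use c in \<open>auto simp: indicator_def\<close>)
  qed
  finally show ?thesis using 1 by simp
qed

lemma sets_unit_measure: "A \<in> sets unit_measure \<longleftrightarrow> A \<in> sets borel \<and> A \<subseteq> {0..1}"
  by (subst sets_restrict_space_iff) auto

lemma measurable_unit_unit:
  assumes "f \<in> borel_measurable borel" "\<And>x. x \<in> {0..1} \<Longrightarrow> f x \<in> {0..1}"
  shows "f \<in> unit_measure \<rightarrow>\<^sub>M unit_measure"
  using assms by (intro measurable_restrict_space3) auto

lemma distr_unit_eqI:
  assumes f [measurable]: "f \<in> borel_measurable borel" and f01: "\<And>x. x \<in> {0..1} \<Longrightarrow> f x \<in> {0..1}"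
    and *: "\<And>A. A \<in> sets borel \<Longrightarrow> A \<subseteq> {0..1} \<Longrightarrow>
      (\<integral>\<^sup>+x. indicator A (f x) * indicator {0..1} x \<partial>lborel) = (\<integral>\<^sup>+x. indicator A x * indicator {0..1} x \<partial>lborel)"
  shows "distr unit_measure unit_measure f = unit_measure"
proof (rule measure_eqI)
  fix A assume "A \<in> sets (distr unit_measure unit_measure f)"
  then have A: "A \<in> sets borel" "A \<subseteq> {0..1}" "A \<in> sets unit_measure"
    by (auto simp: sets_unit_measure)
  note A(1)[measurable]
  have em: "emeasure unit_measure B = (\<integral>\<^sup>+x. indicator B x * indicator {0..1} x \<partial>lborel)"
    if "B \<in> sets borel" "B \<subseteq> {0..1}" for B :: "real set"
  proof -
    have "emeasure unit_measure B = emeasure lborel B"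
      using that by (simp add: emeasure_restrict_space)
    also have "\<dots> = (\<integral>\<^sup>+x. indicator B x \<partial>lborel)"
      using that by simp
    also have "\<dots> = (\<integral>\<^sup>+x. indicator B x * indicator {0..1} x \<partial>lborel)"
      using that by (intro nn_integral_cong) (auto simp: indicator_def)
    finally show ?thesis .
  qed
  have "emeasure (distr unit_measure unit_measure f) A = emeasure unit_measure (f -` A \<inter> {0..1})"
    using A by (subst emeasure_distr) (auto intro!: measurable_unit_unit f f01 simp: space_restrict_space)
  also have "\<dots> = (\<integral>\<^sup>+x. indicator (f -` A \<inter> {0..1}) x * indicator {0..1} x \<partial>lborel)"
    using measurable_sets_borel[OF f A(1)] by (intro em) auto
  also have "\<dots> = (\<integral>\<^sup>+x. indicator A (f x) * indicator {0..1} x \<partial>lborel)"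
    by (intro nn_integral_cong) (auto simp: indicator_def)
  also have "\<dots> = emeasure unit_measure A"
    using A by (simp add: * em)
  finally show "emeasure (distr unit_measure unit_measure f) A = emeasure unit_measure A" .
qed simp

lemma distr_unit_rotate: "distr unit_measure unit_measure (\<lambda>x. frac (x + c)) = unit_measure"
proof (rule distr_unit_eqI)
  show [measurable]: "(\<lambda>x. frac (x + c)) \<in> borel_measurable borel"
    unfolding frac_def by measurable
  show "frac (x + c) \<in> {0..1}" for x
    using frac_ge_0[of "x + c"] frac_lt_1[of "x + c"] by simp
  fix A :: "real set" assume A [measurable]: "A \<in> sets borel" "A \<subseteq> {0..1}"
  define p :: "real \<Rightarrow> ennreal" where "p x = indicator A (frac x)" for x
  have p [measurable]: "p \<in> borel_measurable borel"
    unfolding p_def frac_def by measurable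
  have "frac (x + c) = frac (x + frac c)" for x
  proof -
    have "\<lfloor>x + c\<rfloor> = \<lfloor>x + frac c\<rfloor> + \<lfloor>c\<rfloor>"
      using floor_add_int[of "x + frac c" "\<lfloor>c\<rfloor>"] by (simp add: frac_def)
    then show ?thesis by (simp add: frac_def)
  qed
  then have "(\<integral>\<^sup>+x. indicator A (frac (x + c)) * indicator {0..1} x \<partial>lborel) =
      (\<integral>\<^sup>+x. p (x + frac c) * indicator {0..1} x \<partial>lborel)"
    by (simp add: p_def)
  also have "\<dots> = (\<integral>\<^sup>+x. p x * indicator {0..1} x \<partial>lborel)"
    by (intro nn_integral_periodic_shift p) (auto simp: p_def frac_1_eq less_imp_le frac_lt_1)
  also have "\<dots> = (\<integral>\<^sup>+x. indicator A x * indicator {0..1} x \<partial>lborel)"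
  proof (rule nn_integral_cong_AE)
    \<comment> \<open>\<open>frac\<close> sends the endpoint 1 to 0, so the two integrands are
      compared away from this null set.\<close>
    have "AE x in lborel. x \<noteq> (1 :: real)" by (rule AE_lborel_singleton)
    then show "AE x in lborel. p x * indicator {0..1} x = indicator A x * (indicator {0..1} x :: ennreal)"
      by eventually_elim (auto simp: indicator_def p_def frac_eq[THEN iffD2])
  qed
  finally show "(\<integral>\<^sup>+x. indicator A (frac (x + c)) * indicator {0..1} x \<partial>lborel) =
      (\<integral>\<^sup>+x. indicator A x * indicator {0..1} x \<partial>lborel)" .
qed

lemma distr_unit_reflect: "distr unit_measure unit_measure (\<lambda>x. 1 - x) = unit_measure"
proof (rule distr_unit_eqI)
  fix A :: "real set" assume [measurable]: "A \<in> sets borel" and "A \<subseteq> {0..1}"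
  have "(\<integral>\<^sup>+x. indicator A x * indicator {0..1} x \<partial>lborel) =
      (\<integral>\<^sup>+x. indicator A (1 + - 1 * x) * indicator {0..1} (1 + - 1 * x) \<partial>lborel)"
    using nn_integral_real_affine[of "\<lambda>x. indicator A x * indicator {0..1} x" "- 1" 1] by simp
  also have "\<dots> = (\<integral>\<^sup>+x. indicator A (1 - x) * indicator {0..1} x \<partial>lborel)"
    by (intro nn_integral_cong) (auto simp: indicator_def)
  finally show "(\<integral>\<^sup>+x. indicator A (1 - x) * indicator {0..1} x \<partial>lborel) =
      (\<integral>\<^sup>+x. indicator A x * indicator {0..1} x \<partial>lborel)" ..
qed auto

lemma distr_torus_coordinatewise:
  assumes meas: "\<And>i. g i \<in> unit_measure \<rightarrow>\<^sub>M unit_measure"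
    and distr: "\<And>i. distr unit_measure unit_measure (g i) = unit_measure"
  shows "distr (torus_measure n) (torus_measure n) (\<lambda>x. \<lambda>i\<in>{1..n}. g i (x i)) = torus_measure n"
proof -
  interpret product_prob_space "\<lambda>_ :: nat. unit_measure" "{1..n}"
    by (intro product_prob_spaceI prob_space_unit)
  note meas[measurable]
  have G: "(\<lambda>x. \<lambda>i\<in>{1..n}. g i (x i)) \<in> torus_measure n \<rightarrow>\<^sub>M torus_measure n"
    by measurable
  show ?thesis
  proof (rule PiM_eqI)
    fix A :: "nat \<Rightarrow> real set" assume A: "\<And>i. i \<in> {1..n} \<Longrightarrow> A i \<in> sets unit_measure"
    have pre: "g i -` A i \<inter> space unit_measure \<in> sets unit_measure" if "i \<in> {1..n}" for i
      using measurable_sets[OF meas A[OF that]] .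
    have "emeasure (distr (torus_measure n) (torus_measure n) (\<lambda>x. \<lambda>i\<in>{1..n}. g i (x i))) (Pi\<^sub>E {1..n} A) =
        emeasure (torus_measure n) ((\<lambda>x. \<lambda>i\<in>{1..n}. g i (x i)) -` (Pi\<^sub>E {1..n} A) \<inter> space (torus_measure n))"
      using A by (intro emeasure_distr G sets_PiM_I_finite) auto
    also have "(\<lambda>x. \<lambda>i\<in>{1..n}. g i (x i)) -` (Pi\<^sub>E {1..n} A) \<inter> space (torus_measure n) =
        (\<Pi>\<^sub>E i\<in>{1..n}. g i -` A i \<inter> space unit_measure)"
      by (auto simp: space_PiM PiE_iff)
    also have "emeasure (torus_measure n) \<dots> = (\<Prod>i\<in>{1..n}. emeasure unit_measure (g i -` A i \<inter> space unit_measure))"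
      using pre by (intro emeasure_PiM) auto
    also have "\<dots> = (\<Prod>i\<in>{1..n}. emeasure (distr unit_measure unit_measure (g i)) (A i))"
      using A by (intro prod.cong refl emeasure_distr[symmetric] meas) auto
    finally show "emeasure (distr (torus_measure n) (torus_measure n) (\<lambda>x. \<lambda>i\<in>{1..n}. g i (x i))) (Pi\<^sub>E {1..n} A) =
        (\<Prod>i\<in>{1..n}. emeasure unit_measure (A i))"
      by (simp only: distr)
  qed (simp_all only: finite_atLeastAtMost sets_distr)
qed

lemma torus_integral_coordinatewise:
  fixes h :: "nat \<Rightarrow> complex \<Rightarrow> complex"
  assumes f: "continuous_on (torus n) f"
    and meas: "\<And>i. g i \<in> unit_measure \<rightarrow>\<^sub>M unit_measure"
    and distr: "\<And>i. distr unit_measure unit_measure (g i) = unit_measure"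
    and h: "\<And>i x. cis (2 * pi * g i x) = h i (cis (2 * pi * x))"
  shows "torus_integral n (\<lambda>z. f (\<lambda>i\<in>{1..n}. h i (z i))) = torus_integral n f"
proof -
  note meas[measurable]
  have G: "(\<lambda>x. \<lambda>i\<in>{1..n}. g i (x i)) \<in> torus_measure n \<rightarrow>\<^sub>M torus_measure n"
    by measurable
  have pt: "torus_point n (\<lambda>i\<in>{1..n}. g i (x i)) = (\<lambda>i\<in>{1..n}. h i (torus_point n x i))" for x
    by (auto simp: torus_point_def h fun_eq_iff)
  have "torus_integral n f = (\<integral>x. f (torus_point n x) \<partial>distr (torus_measure n) (torus_measure n) (\<lambda>x. \<lambda>i\<in>{1..n}. g i (x i)))"
    unfolding torus_integral_eq distr_torus_coordinatewise[OF meas distr] ..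
  also have "\<dots> = (\<integral>x. f (torus_point n (\<lambda>i\<in>{1..n}. g i (x i))) \<partial>torus_measure n)"
    by (intro integral_distr G measurable_torus_continuous f)
  finally show ?thesis
    unfolding torus_integral_eq pt ..
qed

lemma torus_integral_rotate:
  assumes f: "continuous_on (torus n) f" and c: "norm c = 1"
  shows "torus_integral n (\<lambda>z. f (\<lambda>i\<in>{1..n}. if i \<in> I then c * z i else z i)) = torus_integral n f"
proof -
  obtain \<theta> where \<theta>: "c = cis (2 * pi * \<theta>)"
  proof
    show "c = cis (2 * pi * (Arg c / (2 * pi)))"
      using c cis_Arg[of c] by (cases "c = 0") (simp_all add: sgn_div_norm)
  qed
  have frac_cis: "cis (2 * pi * frac x) = cis (2 * pi * x)" for x
  proof -
    have "cis (2 * pi * frac x) = cis (2 * pi * x - 2 * pi * of_int \<lfloor>x\<rfloor>)"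
      by (simp add: frac_def algebra_simps)
    also have "\<dots> = cis (2 * pi * x) / cis (2 * pi * of_int \<lfloor>x\<rfloor>)"
      by (rule cis_divide[symmetric])
    also have "cis (2 * pi * of_int \<lfloor>x\<rfloor>) = 1"
      by (intro cis_multiple_2pi) auto
    finally show ?thesis by simp
  qed
  define g where "g i = (if i \<in> I then \<lambda>x. frac (x + \<theta>) else (\<lambda>x. x))" for i
  define h where "h i = (\<lambda>w. if i \<in> I then c * w else w)" for i
  have "torus_integral n (\<lambda>z. f (\<lambda>i\<in>{1..n}. h i (z i))) = torus_integral n f"
  proof (rule torus_integral_coordinatewise[OF f, of g])
    fix i
    have "(\<lambda>x. frac (x + \<theta>)) \<in> borel_measurable borel"
      unfolding frac_def by measurable
    then have "(\<lambda>x. frac (x + \<theta>)) \<in> unit_measure \<rightarrow>\<^sub>M unit_measure"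
      using frac_ge_0 frac_lt_1 by (intro measurable_unit_unit) (auto intro: less_imp_le)
    then show "g i \<in> unit_measure \<rightarrow>\<^sub>M unit_measure"
      by (auto simp: g_def)
    show "distr unit_measure unit_measure (g i) = unit_measure"
      by (simp add: g_def distr_unit_rotate distr_id)
    show "cis (2 * pi * g i x) = h i (cis (2 * pi * x))" for x
      by (simp add: g_def h_def frac_cis \<theta> cis_mult distrib_left add.commute)
  qed
  then show ?thesis by (simp add: h_def)
qed

lemma torus_integral_flip:
  assumes f: "continuous_on (torus n) f"
  shows "torus_integral n (\<lambda>z. f (\<lambda>i\<in>{1..n}. flip E z i)) = torus_integral n f"
proof -
  define g where "g i = (if i \<in> E then \<lambda>x. 1 - x else (\<lambda>x. x :: real))" for i :: nat
  define h where "h i = (\<lambda>w :: complex. if i \<in> E then 1 / w else w)" for i :: nat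
  have "torus_integral n (\<lambda>z. f (\<lambda>i\<in>{1..n}. h i (z i))) = torus_integral n f"
  proof (rule torus_integral_coordinatewise[OF f, of g])
    fix i
    have "(\<lambda>x. 1 - x) \<in> unit_measure \<rightarrow>\<^sub>M unit_measure"
      by (intro measurable_unit_unit) auto
    then show "g i \<in> unit_measure \<rightarrow>\<^sub>M unit_measure"
      by (auto simp: g_def)
    show "distr unit_measure unit_measure (g i) = unit_measure"
      by (simp add: g_def distr_unit_reflect distr_id)
    have "cis (2 * pi * (1 - x)) = 1 / cis (2 * pi * x)" for x
      by (simp add: right_diff_distrib flip: cis_divide)
    then show "cis (2 * pi * g i x) = h i (cis (2 * pi * x))" for x
      by (simp add: g_def h_def)
  qed
  then show ?thesis by (simp add: h_def flip_def)
qed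

lemma torus_integral_permute:
  assumes f: "continuous_on (torus n) f" and p: "p permutes {1..n}"
  shows "torus_integral n (\<lambda>z. f (\<lambda>i\<in>{1..n}. z (p i))) = torus_integral n f"
proof -
  have pin: "p i \<in> {1..n}" if "i \<in> {1..n}" for i using permutes_in_image[OF p] that by blast
  have G: "(\<lambda>x. \<lambda>i\<in>{1..n}. x (p i)) \<in> torus_measure n \<rightarrow>\<^sub>M torus_measure n"
    using pin by (intro measurable_restrict measurable_component_singleton) auto
  have distr: "distr (torus_measure n) (torus_measure n) (\<lambda>x. \<lambda>i\<in>{1..n}. x (p i)) = torus_measure n"
    using distr_PiM_reindex[of "{1..n}" "\<lambda>_. unit_measure" p "{1..n}"] prob_space_unit pin permutes_inj_on[OF p]
    by auto
  have pt: "torus_point n (\<lambda>i\<in>{1..n}. x (p i)) = (\<lambda>i\<in>{1..n}. torus_point n x (p i))" for x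
    using pin by (auto simp: torus_point_def fun_eq_iff)
  have "torus_integral n f = (\<integral>x. f (torus_point n x) \<partial>distr (torus_measure n) (torus_measure n) (\<lambda>x. \<lambda>i\<in>{1..n}. x (p i)))"
    unfolding torus_integral_eq distr ..
  also have "\<dots> = (\<integral>x. f (torus_point n (\<lambda>i\<in>{1..n}. x (p i))) \<partial>torus_measure n)"
    by (intro integral_distr G measurable_torus_continuous f)
  finally show ?thesis
    unfolding torus_integral_eq pt ..
qed

text \<open>
  Shifting the contours of the variables with index in \<open>I\<close> simultaneously: the integral is holomorphic
  in \<open>s\<close> and constant on the unit circle.
\<close>

lemma torus_integral_scale:
  assumes S: "S = {s. r1 < norm s \<and> norm s < r2}" "r1 < 1" "1 < r2" and "s \<in> S"
    and cont: "continuous_on (S \<times> torus n) (\<lambda>(s, z). F s z)"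
    and holo: "\<And>z. z \<in> torus n \<Longrightarrow> (\<lambda>s. F s z) holomorphic_on S"
    and rot: "\<And>c z. norm c = 1 \<Longrightarrow> z \<in> torus n \<Longrightarrow>
       F c z = F 1 (\<lambda>i\<in>{1..n}. if i \<in> I then c * z i else z i)"
  shows "torus_integral n (F s) = torus_integral n (F 1)"
proof -
  have opn: "open S"
  proof -
    have "S = norm -` {r1<..<r2}" using S(1) by auto
    then show ?thesis by (auto intro!: open_vimage continuous_intros)
  qed
  have con: "connected S"
    using connected_annulus(1)[of r1 "0 :: complex" r2] S(1) by (simp add: DIM_complex)
  define A where "A s = torus_integral n (F s)" for s
  have A_holo: "(\<lambda>s. A s - A 1) holomorphic_on S"
    unfolding A_def by (intro holomorphic_intros torus_integral_holomorphic opn cont holo)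
  have one: "1 \<in> S" using S by simp
  have zero: "A c - A 1 = 0" if "c \<in> sphere 0 1" for c
  proof -
    have "A c = torus_integral n (\<lambda>z. F 1 (\<lambda>i\<in>{1..n}. if i \<in> I then c * z i else z i))"
      unfolding A_def using that by (intro torus_integral_cong rot) auto
    also have "\<dots> = A 1"
      unfolding A_def using that
      by (intro torus_integral_rotate continuous_on_slice[OF cont one]) auto
    finally show ?thesis by simp
  qed
  have "A s - A 1 = 0"
  proof (rule analytic_continuation[OF A_holo opn con _ one _ _ \<open>s \<in> S\<close>])
    show "sphere 0 1 \<subseteq> S" using S by auto
    show "1 islimpt sphere (0 :: complex) 1"
    proof (rule connected_imp_perfect)
      have "- 1 \<in> sphere (0 :: complex) 1" "1 \<in> sphere (0 :: complex) 1" by auto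
      then show "sphere (0 :: complex) 1 \<noteq> {x}" for x by (metis one_neq_neg_one singletonD)
    qed (auto simp: connected_sphere_eq DIM_complex)
  qed (rule zero)
  then show ?thesis by (simp add: A_def)
qed

text \<open>Since \<open>m z\<close> has absolute value 1, the partial sums are dominated by a bound
  of \<open>G\<close> times the sum of the \<open>norm (c k)\<close>, and termwise integration is
  dominated convergence.\<close>

lemma torus_integral_power_series:
  assumes G: "continuous_on (torus n) G" and m: "continuous_on (torus n) m"
    and norm_m: "\<And>z. z \<in> torus n \<Longrightarrow> norm (m z) = 1"
    and c: "summable (\<lambda>k. norm (c k))"
    and h: "\<And>w. norm w = 1 \<Longrightarrow> h w = (\<Sum>k. c k * w ^ k)"
    and zero: "\<And>k. torus_integral n (\<lambda>z. G z * m z ^ k) = (0 :: complex)"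
  shows "torus_integral n (\<lambda>z. G z * h (m z)) = 0"
proof -
  obtain B where B: "\<And>z. z \<in> torus n \<Longrightarrow> norm (G z) \<le> B"
    using torus_bounded[OF G] by blast
  have "(\<lambda>N. torus_integral n (\<lambda>z. \<Sum>k<N. c k * (G z * m z ^ k))) \<longlonglongrightarrow> torus_integral n (\<lambda>z. G z * h (m z))"
  proof (rule torus_integral_tendsto[of _ _ _ "B * (\<Sum>k. norm (c k))"])
    show "continuous_on (torus n) (\<lambda>z. \<Sum>k<N. c k * (G z * m z ^ k))" for N
      by (intro continuous_intros G m)
    fix z assume z: "z \<in> torus n"
    have nsum: "summable (\<lambda>k. norm (c k * m z ^ k))"
      using c norm_m[OF z] by (simp add: norm_mult norm_power)
    then have "(\<lambda>N. G z * (\<Sum>k<N. c k * m z ^ k)) \<longlonglongrightarrow> G z * h (m z)"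
      unfolding h[OF norm_m[OF z]] by (intro tendsto_mult tendsto_const summable_LIMSEQ summable_norm_cancel[OF nsum])
    then show "(\<lambda>N. \<Sum>k<N. c k * (G z * m z ^ k)) \<longlonglongrightarrow> G z * h (m z)"
      by (simp add: sum_distrib_left mult_ac)
    have "norm (\<Sum>k<N. c k * (G z * m z ^ k)) \<le> (\<Sum>k<N. B * norm (c k))" for N
      using B[OF z] norm_m[OF z]
      by (intro sum_norm_le) (simp add: norm_mult norm_power mult.commute mult_right_mono)
    also have "(\<Sum>k<N. B * norm (c k)) \<le> B * (\<Sum>k. norm (c k))" for N
    proof -
      have "0 \<le> B" using B[OF z] norm_ge_zero order_trans by blast
      then show ?thesis
        unfolding sum_distrib_left[symmetric] by (intro mult_left_mono sum_le_suminf c) auto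
    qed
    finally show "norm (\<Sum>k<N. c k * (G z * m z ^ k)) \<le> B * (\<Sum>k. norm (c k))" for N .
  qed
  moreover have 0: "torus_integral n (\<lambda>z. \<Sum>k<N. c k * (G z * m z ^ k)) = 0" for N
    using zero by (subst torus_integral_sum) (auto intro!: continuous_intros G m simp: torus_integral_cmult)
  ultimately show ?thesis by (simp add: LIMSEQ_const_iff)
qed

subsection \<open>Alternating sums\<close>

text \<open>The Leibniz formula for the determinant of an \<open>n\<close> by \<open>n\<close>
  matrix with rows and columns indexed by \<open>{1..n}\<close>.\<close>

definition alt :: "nat \<Rightarrow> (nat \<Rightarrow> nat \<Rightarrow> complex) \<Rightarrow> complex" where
  "alt n M = (\<Sum>w | w permutes {1..n}. of_int (sign w) * (\<Prod>i=1..n. M i (w i)))"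

definition vdm :: "nat \<Rightarrow> (nat \<Rightarrow> complex) \<Rightarrow> complex" where
  "vdm n z = pairprod {1..n} (\<lambda>j k. z k - z j)"

lemma alt_permute_columns:
  assumes p: "p permutes {1..n}"
  shows "alt n (\<lambda>i k. M i (p k)) = of_int (sign p) * alt n M"
proof -
  have "alt n M = (\<Sum>w | w permutes {1..n}. of_int (sign (p \<circ> w)) * (\<Prod>i=1..n. M i ((p \<circ> w) i)))"
    unfolding alt_def by (rule setum_permutations_compose_left[OF p])
  also have "\<dots> = of_int (sign p) * alt n (\<lambda>i k. M i (p k))"
    unfolding alt_def sum_distrib_left
  proof (intro sum.cong refl)
    fix w assume "w \<in> {w. w permutes {1..n}}"
    then have "sign (p \<circ> w) = sign p * sign w"
      using p by (intro sign_compose permutation_permutes[THEN iffD2]) (auto intro: exI[of _ "{1..n}"])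
    then show "of_int (sign (p \<circ> w)) * (\<Prod>i=1..n. M i ((p \<circ> w) i)) =
       of_int (sign p) * (of_int (sign w) * (\<Prod>i=1..n. M i (p (w i)))) "
      by simp
  qed
  finally have eq: "alt n M = of_int (sign p) * alt n (\<lambda>i k. M i (p k))" .
  have "of_int (sign p) * of_int (sign p) = (1 :: complex)"
    by (simp flip: of_int_mult)
  then show ?thesis
    unfolding eq mult.assoc[symmetric] by simp
qed

lemma alt_permute_rows:
  assumes p: "p permutes {1..n}"
  shows "alt n (\<lambda>i k. M (p i) k) = of_int (sign p) * alt n M"
proof -
  have ip: "inv p permutes {1..n}" by (rule permutes_inv[OF p])
  have pp: "permutation p" using p by (auto simp: permutation_permutes intro: exI[of _ "{1..n}"])
  have "alt n M = (\<Sum>w | w permutes {1..n}. of_int (sign (w \<circ> inv p)) * (\<Prod>i=1..n. M i ((w \<circ> inv p) i)))"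
    unfolding alt_def by (rule sum_permutations_compose_right[OF ip])
  also have "\<dots> = of_int (sign p) * alt n (\<lambda>i k. M (p i) k)"
    unfolding alt_def sum_distrib_left
  proof (intro sum.cong refl)
    fix w assume "w \<in> {w. w permutes {1..n}}"
    then have "permutation w" by (auto simp: permutation_permutes intro: exI[of _ "{1..n}"])
    then have "sign (w \<circ> inv p) = sign w * sign p"
      using pp by (simp add: sign_compose permutation_inverse sign_inverse)
    moreover have "(\<Prod>i=1..n. M i ((w \<circ> inv p) i)) = (\<Prod>i=1..n. M (p i) (w i))"
      using prod.permute[OF p, of "\<lambda>i. M i ((w \<circ> inv p) i)"] permutes_inverses(2)[OF p]
      by (simp add: o_def)
    ultimately show "of_int (sign (w \<circ> inv p)) * (\<Prod>i=1..n. M i ((w \<circ> inv p) i)) =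
       of_int (sign p) * (of_int (sign w) * (\<Prod>i=1..n. M (p i) (w i)))"
      by simp
  qed
  finally have eq: "alt n M = of_int (sign p) * alt n (\<lambda>i k. M (p i) k)" .
  have "of_int (sign p) * of_int (sign p) = (1 :: complex)"
    by (simp flip: of_int_mult)
  then show ?thesis
    unfolding eq mult.assoc[symmetric] by simp
qed

lemma alt_equal_columns:
  assumes "j \<in> {1..n}" "k \<in> {1..n}" "j \<noteq> k" "\<And>i. i \<in> {1..n} \<Longrightarrow> M i j = M i k"
  shows "alt n M = 0"
proof -
  have "alt n (\<lambda>i l. M i (Transposition.transpose j k l)) = - alt n M"
    using alt_permute_columns[OF permutes_swap_id[OF assms(1,2)], of M] assms(3) by (simp add: sign_swap_id)
  moreover have "alt n (\<lambda>i l. M i (Transposition.transpose j k l)) = alt n M"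
    unfolding alt_def
    by (intro sum.cong refl arg_cong2[of _ _ _ _ "(*)"] prod.cong) (auto simp: Transposition.transpose_def assms(4))
  ultimately show ?thesis by simp
qed

lemma alt_equal_rows:
  assumes "j \<in> {1..n}" "k \<in> {1..n}" "j \<noteq> k" "M j = M k"
  shows "alt n M = 0"
proof -
  have "alt n (\<lambda>i l. M (Transposition.transpose j k i) l) = - alt n M"
    using alt_permute_rows[OF permutes_swap_id[OF assms(1,2)], of M] assms(3) by (simp add: sign_swap_id)
  moreover have "(\<lambda>i l. M (Transposition.transpose j k i) l) = M"
    using assms(4) by (auto simp: Transposition.transpose_def fun_eq_iff)
  ultimately show ?thesis by simp
qed

text \<open>Replace column \<open>k0\<close> by the vanishing combination of columns. Expanding
  linearly, each column \<open>k\<close> other than \<open>k0\<close> gives a determinant with a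
  repeated column, so only \<open>c k0 * alt n M\<close> survives.\<close>

lemma alt_dependent_columns:
  assumes dep: "\<And>i. i \<in> {1..n} \<Longrightarrow> (\<Sum>k=1..n. c k * M i k) = 0"
    and k0: "k0 \<in> {1..n}" "c k0 \<noteq> 0"
  shows "alt n M = 0"
proof -
  define R where "R k i l = (if l = k0 then M i k else M i l)" for k i l
  have R0: "alt n (R k) = 0" if "k \<in> {1..n}" "k \<noteq> k0" for k
    using that k0 by (intro alt_equal_columns[of k n k0]) (auto simp: R_def)
  have "(\<Sum>k=1..n. c k * alt n (R k)) = (\<Sum>k\<in>{k0}. c k * alt n (R k))"
    using k0 R0 by (intro sum.mono_neutral_right) auto
  moreover have "R k0 = M" by (auto simp: R_def fun_eq_iff)
  ultimately have "c k0 * alt n M = (\<Sum>k=1..n. c k * alt n (R k))" by simp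
  also have "\<dots> = (\<Sum>w | w permutes {1..n}. of_int (sign w) * (\<Sum>k=1..n. c k * (\<Prod>i=1..n. R k i (w i))))"
    unfolding alt_def sum_distrib_left by (subst sum.swap) (simp add: mult_ac)
  also have "\<dots> = 0"
  proof (intro sum.neutral ballI)
    fix w assume "w \<in> {w. w permutes {1..n}}"
    then have w: "w permutes {1..n}" by simp
    define j where "j = inv w k0"
    have j: "j \<in> {1..n}" "w j = k0"
      using permutes_in_image[OF permutes_inv[OF w]] k0 permutes_inverses(1)[OF w] by (auto simp: j_def)
    have wi: "w i \<noteq> k0" if "i \<noteq> j" for i
      using that j(2) permutes_inj[OF w] by (metis injD)
    have "(\<Prod>i=1..n. R k i (w i)) = M j k * (\<Prod>i\<in>{1..n} - {j}. M i (w i))" for k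
      using j wi by (subst prod.remove[of _ j]) (auto simp: R_def intro!: prod.cong)
    then have "(\<Sum>k=1..n. c k * (\<Prod>i=1..n. R k i (w i))) =
        (\<Sum>k=1..n. c k * M j k) * (\<Prod>i\<in>{1..n} - {j}. M i (w i))"
      by (simp add: sum_distrib_right mult_ac)
    then show "of_int (sign w) * (\<Sum>k=1..n. c k * (\<Prod>i=1..n. R k i (w i))) = 0"
      using dep[OF j(1)] by simp
  qed
  finally show ?thesis using k0 by simp
qed

lemma vdm_Suc: "vdm (Suc m) z = vdm m z * (\<Prod>j=1..m. z (Suc m) - z j)"
proof -
  have 1: "(\<Prod>k\<in>{k \<in> {1..Suc m}. j < k}. z k - z j) = (\<Prod>k\<in>{k \<in> {1..m}. j < k}. z k - z j) * (z (Suc m) - z j)"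
    if "j \<in> {1..m}" for j
  proof -
    have "{k \<in> {1..Suc m}. j < k} = insert (Suc m) {k \<in> {1..m}. j < k}" using that by auto
    then show ?thesis by (simp add: mult.commute)
  qed
  have 2: "{k \<in> {1..Suc m}. Suc m < k} = {}" by auto
  have "{1..Suc m} = insert (Suc m) {1..m}" by auto
  then have "vdm (Suc m) z = (\<Prod>j\<in>insert (Suc m) {1..m}. \<Prod>k\<in>{k \<in> {1..Suc m}. j < k}. z k - z j)"
    by (simp only: vdm_def pairprod_def)
  also have "\<dots> = (\<Prod>k\<in>{k \<in> {1..Suc m}. Suc m < k}. z k - z (Suc m)) *
      (\<Prod>j=1..m. \<Prod>k\<in>{k \<in> {1..Suc m}. j < k}. z k - z j)"
    by (subst prod.insert) auto
  also have "\<dots> = (\<Prod>j=1..m. (\<Prod>k\<in>{k \<in> {1..m}. j < k}. z k - z j) * (z (Suc m) - z j))"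
    unfolding 2 by (simp only: prod.empty mult_1 1 cong: prod.cong)
  finally show ?thesis by (simp add: vdm_def pairprod_def prod.distrib)
qed

text \<open>As a polynomial in the last variable the determinant has degree at most
  \<open>m\<close>, the coefficient \<open>vdm m z\<close> of degree \<open>m\<close>, and the roots
  \<open>z 1, ..., z m\<close>. If these are distinct they determine it; otherwise both sides
  vanish.\<close>

lemma vandermonde: "vdm n z = alt n (\<lambda>i k. z i ^ (k - 1))"
proof (induction n arbitrary: z)
  case 0
  have "{w :: nat \<Rightarrow> nat. w permutes {1..0}} = {id}" by (auto simp: permutes_empty)
  then show ?case by (simp add: vdm_def alt_def pairprod_def sign_id)
next
  case (Suc m)
  let ?S = "{w. w permutes {1..Suc m}}"
  define C where "C w = of_int (sign w) * (\<Prod>i=1..m. z i ^ (w i - 1))" for w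
  define P where "P = (\<Sum>w\<in>?S. monom (C w) (w (Suc m) - 1))"
  have fin: "finite ?S" by (intro finite_permutations) auto
  have P_eval: "poly P x = alt (Suc m) (\<lambda>i k. (z(Suc m := x)) i ^ (k - 1))" for x
    by (simp add: P_def alt_def poly_sum poly_monom C_def mult_ac)
  have lt: "w (Suc m) \<in> {1..Suc m}" if "w \<in> ?S" for w
    using permutes_in_image[of w "{1..Suc m}" "Suc m"] that by simp
  have deg: "degree P \<le> m"
    unfolding P_def
  proof (rule degree_sum_le[OF fin])
    fix w assume "w \<in> ?S"
    then show "degree (monom (C w) (w (Suc m) - 1)) \<le> m"
      using lt[of w] degree_monom_le[of "C w" "w (Suc m) - 1"] by (intro order_trans[OF degree_monom_le]) auto
  qed
  have lead: "coeff P m = vdm m z"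
  proof -
    have "coeff P m = (\<Sum>w\<in>?S. if w (Suc m) = Suc m then C w else 0)"
      unfolding P_def coeff_sum coeff_monom using lt by (intro sum.cong) force+
    also have "\<dots> = (\<Sum>w\<in>{w \<in> ?S. w (Suc m) = Suc m}. C w)"
      using fin by (simp add: sum.If_cases Int_def)
    also have "{w \<in> ?S. w (Suc m) = Suc m} = {w. w permutes {1..m}}"
    proof (intro set_eqI iffI)
      fix w assume "w \<in> {w \<in> ?S. w (Suc m) = Suc m}"
      then have w: "w permutes {1..Suc m}" "w (Suc m) = Suc m" by auto
      have "w permutes {1..Suc m} - {Suc m}"
        using w by (intro permutes_superset[OF w(1)]) auto
      moreover have "{1..Suc m} - {Suc m} = {1..m}" by auto
      ultimately show "w \<in> {w. w permutes {1..m}}" by simp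
    next
      fix w assume "w \<in> {w. w permutes {1..m}}"
      then show "w \<in> {w \<in> ?S. w (Suc m) = Suc m}"
        using permutes_subset[of w "{1..m}" "{1..Suc m}"] permutes_not_in[of w "{1..m}" "Suc m"] by auto
    qed
    finally show ?thesis by (simp add: Suc.IH alt_def C_def)
  qed
  have root: "poly P (z j) = 0" if "j \<in> {1..m}" for j
    unfolding P_eval using that by (intro alt_equal_rows[of j _ "Suc m"]) auto
  show ?case
  proof (cases "inj_on z {1..m}")
    case False
    then obtain j k where jk: "j \<in> {1..m}" "k \<in> {1..m}" "j \<noteq> k" "z j = z k"
      by (auto simp: inj_on_def)
    have "vdm m z = 0"
      unfolding Suc.IH using jk by (intro alt_equal_rows[of j _ k]) auto
    moreover have "alt (Suc m) (\<lambda>i k. z i ^ (k - 1)) = 0"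
      using jk by (intro alt_equal_rows[of j _ k]) auto
    ultimately show ?thesis by (simp add: vdm_Suc)
  next
    case True
    define Q where "Q = (\<Prod>j=1..m. [:- z j, 1:])"
    have Qdeg: "degree Q = m" unfolding Q_def by (subst degree_prod_eq_sum_degree) auto
    have "lead_coeff Q = 1" unfolding Q_def by (simp add: lead_coeff_prod)
    then have Qlead: "coeff Q m = 1" by (simp add: Qdeg)
    define D where "D = P - smult (vdm m z) Q"
    have "D = 0"
    proof (rule ccontr)
      assume D: "D \<noteq> 0"
      have "degree D \<le> m"
        unfolding D_def by (intro degree_diff_le deg) (simp add: Qdeg degree_smult_le order_trans[OF degree_smult_le])
      moreover have "coeff D m = 0" by (simp add: D_def lead Qlead)
      moreover have "coeff D (degree D) \<noteq> 0" using D by simp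
      ultimately have "degree D < m" by (metis le_neq_implies_less)
      have "poly Q (z j) = 0" if "j \<in> {1..m}" for j
        unfolding Q_def poly_prod using that by (intro prod_zero) auto
      then have "z ` {1..m} \<subseteq> {x. poly D x = 0}"
        using root by (auto simp: D_def)
      then have "card (z ` {1..m}) \<le> card {x. poly D x = 0}"
        using poly_roots_finite[OF D] by (intro card_mono)
      also have "\<dots> \<le> degree D" using card_poly_roots_bound[OF D] .
      finally show False using True \<open>degree D < m\<close> by (simp add: card_image)
    qed
    then have "poly P (z (Suc m)) = vdm m z * poly Q (z (Suc m))"
      by (simp add: D_def)
    then show ?thesis
      unfolding P_eval by (simp add: vdm_Suc Q_def poly_prod)
  qed
qed

lemma vdm_permute:
  assumes "p permutes {1..n}"
  shows "vdm n (\<lambda>i. z (p i)) = of_int (sign p) * vdm n z"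
  unfolding vandermonde using alt_permute_rows[OF assms, of "\<lambda>i k. z i ^ (k - 1)"] .

section \<open>The alternating sum of the Macdonald operators as a determinant\<close>

definition scale :: "complex \<Rightarrow> nat set \<Rightarrow> (nat \<Rightarrow> complex) \<Rightarrow> nat \<Rightarrow> complex" where
  "scale c I z i = (if i \<in> I then c * z i else z i)"

text \<open>After the Vandermonde factor is expanded, the choice of \<open>I\<close> is an
  independent choice for each row, so the sum over subsets is a product of two-term sums.\<close>

lemma sum_Pow_vdm:
  "(\<Sum>I\<in>Pow {1..n}. (-1) ^ card I * vdm n (scale t I z) * (\<Prod>i\<in>I. f i)) =
     alt n (\<lambda>i k. z i ^ (k - 1) - (t * z i) ^ (k - 1) * f i)"
proof -
  have "(\<Sum>I\<in>Pow {1..n}. (-1) ^ card I * vdm n (scale t I z) * (\<Prod>i\<in>I. f i)) =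
      (\<Sum>I\<in>Pow {1..n}. \<Sum>w | w permutes {1..n}. of_int (sign w) *
         ((\<Prod>i\<in>I. - ((t * z i) ^ (w i - 1) * f i)) * (\<Prod>i\<in>{1..n} - I. z i ^ (w i - 1))))"
    unfolding vandermonde alt_def sum_distrib_left sum_distrib_right
  proof (intro sum.cong refl)
    fix I w assume "I \<in> Pow {1..n}"
    then have I: "I \<subseteq> {1..n}" "finite I" by (auto intro: finite_subset)
    have "(\<Prod>i=1..n. scale t I z i ^ (w i - 1)) =
        (\<Prod>i\<in>I. (t * z i) ^ (w i - 1)) * (\<Prod>i\<in>{1..n} - I. z i ^ (w i - 1))"
      by (subst prod.subset_diff[OF I(1)]) (auto simp: scale_def mult.commute)
    moreover have "(\<Prod>i\<in>I. - ((t * z i) ^ (w i - 1) * f i)) =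
        (-1) ^ card I * ((\<Prod>i\<in>I. (t * z i) ^ (w i - 1)) * (\<Prod>i\<in>I. f i))"
      by (simp add: prod_uminus prod.distrib)
    ultimately show "(-1) ^ card I * (of_int (sign w) * (\<Prod>i=1..n. scale t I z i ^ (w i - 1))) * (\<Prod>i\<in>I. f i) =
      of_int (sign w) *
         ((\<Prod>i\<in>I. - ((t * z i) ^ (w i - 1) * f i)) * (\<Prod>i\<in>{1..n} - I. z i ^ (w i - 1)))"
      by (simp only: mult_ac)
  qed
  also have "\<dots> = (\<Sum>w | w permutes {1..n}. of_int (sign w) *
      (\<Sum>I\<in>Pow {1..n}. (\<Prod>i\<in>I. - ((t * z i) ^ (w i - 1) * f i)) * (\<Prod>i\<in>{1..n} - I. z i ^ (w i - 1))))"
    unfolding sum_distrib_left by (rule sum.swap)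
  also have "\<dots> = (\<Sum>w | w permutes {1..n}. of_int (sign w) *
      (\<Prod>i=1..n. - ((t * z i) ^ (w i - 1) * f i) + z i ^ (w i - 1)))"
    by (subst prod_add) auto
  finally show ?thesis by (simp add: alt_def)
qed

text \<open>The functional equation of \<open>p\<close> is a linear dependence of the columns of the
  determinant, column \<open>k\<close> taken with the coefficient of degree \<open>k - 1\<close>.
  The nonzero constant coefficient makes it nontrivial.\<close>

lemma sum_Pow_vdm_zero:
  assumes deg: "degree p < n" and c0: "coeff p 0 \<noteq> 0"
    and p: "\<And>i. i \<in> {1..n} \<Longrightarrow> poly p (x i) = f i * poly p (t * x i)"
  shows "(\<Sum>I\<in>Pow {1..n}. (-1) ^ card I * vdm n (scale t I x) * (\<Prod>i\<in>I. f i)) = 0"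
  unfolding sum_Pow_vdm
proof (rule alt_dependent_columns[of _ "\<lambda>k. coeff p (k - 1)" _ 1])
  fix i assume i: "i \<in> {1..n}"
  have ev: "poly p y = (\<Sum>k=1..n. coeff p (k - 1) * y ^ (k - 1))" for y
  proof -
    have "poly p y = (\<Sum>k<n. coeff p k * y ^ k)"
      unfolding poly_altdef using deg by (intro sum.mono_neutral_left) (auto simp: coeff_eq_0)
    also have "\<dots> = (\<Sum>k=1..n. coeff p (k - 1) * y ^ (k - 1))"
      by (intro sum.reindex_bij_witness[of _ "\<lambda>k. k - 1" Suc]) auto
    finally show ?thesis .
  qed
  have "(\<Sum>k=1..n. coeff p (k - 1) * (x i ^ (k - 1) - (t * x i) ^ (k - 1) * f i)) =
     poly p (x i) - f i * poly p (t * x i)"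
    unfolding ev by (simp add: sum_distrib_left sum_subtractf right_diff_distrib mult_ac)
  then show "(\<Sum>k=1..n. coeff p (k - 1) * (x i ^ (k - 1) - (t * x i) ^ (k - 1) * f i)) = 0"
    using p[OF i] by simp
qed (use deg c0 in auto)

subsection \<open>A strict rearrangement inequality\<close>

text \<open>\<open>B\<close> without the upper segment and the upper segment without
  \<open>B\<close> have equally many elements, and \<open>l k\<close> separates the values of
  \<open>l\<close> on them.\<close>

lemma sum_upper_set_max:
  fixes l :: "nat \<Rightarrow> nat"
  assumes mono: "\<And>i j. i \<in> {1..n} \<Longrightarrow> j \<in> {1..n} \<Longrightarrow> i \<le> j \<Longrightarrow> l i \<le> l j"
    and B: "B \<subseteq> {1..n}" "card B = card {k..n}" and k: "k \<in> {1..n}"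
  shows "sum l B \<le> sum l {k..n}"
proof -
  let ?U = "{k..n}"
  have fin: "finite B" using B(1) by (rule finite_subset) simp
  have "card (B - ?U) = card (?U - B)"
    using B(2) fin card_Diff_subset_Int[of B ?U] card_Diff_subset_Int[of ?U B] by (simp add: Int_commute)
  moreover have "sum l (B - ?U) \<le> card (B - ?U) * l k"
  proof -
    have "sum l (B - ?U) \<le> (\<Sum>i\<in>B - ?U. l k)"
      using B(1) k by (intro sum_mono mono) auto
    then show ?thesis by simp
  qed
  moreover have "card (?U - B) * l k \<le> sum l (?U - B)"
  proof -
    have "(\<Sum>i\<in>?U - B. l k) \<le> sum l (?U - B)"
      using k by (intro sum_mono mono) auto
    then show ?thesis by simp
  qed
  ultimately have "sum l (B - ?U) \<le> sum l (?U - B)" by simp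
  moreover have "sum l B = sum l (B - ?U) + sum l (B \<inter> ?U)"
    using fin by (metis Diff_Int_distrib2 Int_Diff Un_Diff_Int add.commute sum.Int_Diff)
  moreover have "sum l ?U = sum l (?U - B) + sum l (B \<inter> ?U)"
    by (metis Int_commute add.commute finite_atLeastAtMost sum.Int_Diff)
  ultimately show ?thesis by simp
qed

text \<open>Summation by parts: the index \<open>i\<close> lies in the tails starting at
  \<open>2, ..., i\<close>, which are \<open>i - 1\<close> in number.\<close>

lemma sum_weights_tails:
  "(\<Sum>i=1..n. (i - 1) * f i) = (\<Sum>k=2..n. \<Sum>i=k..n. f i :: nat)"
proof -
  have "(\<Sum>k=2..n. \<Sum>i=k..n. f i) = (\<Sum>k\<in>{2..n}. \<Sum>i\<in>{i \<in> {1..n}. k \<le> i}. f i)"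
    by (intro sum.cong) auto
  also have "\<dots> = (\<Sum>i\<in>{1..n}. \<Sum>k\<in>{k \<in> {2..n}. k \<le> i}. f i)"
    by (rule sum.swap_restrict) auto
  also have "\<dots> = (\<Sum>i=1..n. (i - 1) * f i)"
  proof (intro sum.cong refl)
    fix i assume "i \<in> {1..n}"
    then have "{k \<in> {2..n}. k \<le> i} = {2..i}" by auto
    then show "(\<Sum>k\<in>{k \<in> {2..n}. k \<le> i}. f i) = (i - 1) * f i" by simp
  qed
  finally show ?thesis ..
qed

text \<open>Permuting a nondecreasing sequence cannot increase any tail sum. If no tail sum
  decreased, differences of consecutive tails would give \<open>l (p i) = l i\<close> for all
  \<open>i\<close>.\<close>

lemma rearrangement_strict:
  fixes l :: "nat \<Rightarrow> nat"
  assumes mono: "\<And>i j. i \<in> {1..n} \<Longrightarrow> j \<in> {1..n} \<Longrightarrow> i \<le> j \<Longrightarrow> l i \<le> l j"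
    and p: "p permutes {1..n}" and ne: "\<exists>i\<in>{1..n}. l (p i) \<noteq> l i"
  shows "(\<Sum>i=1..n. (i - 1) * l (p i)) < (\<Sum>i=1..n. (i - 1) * l i)"
proof -
  have tail: "(\<Sum>i=k..n. l (p i)) \<le> (\<Sum>i=k..n. l i)" if "k \<in> {1..n}" for k
  proof -
    have "(\<Sum>i=k..n. l (p i)) = sum l (p ` {k..n})"
      using permutes_inj_on[OF p] by (simp add: sum.reindex)
    also have "\<dots> \<le> sum l {k..n}"
    proof (rule sum_upper_set_max[OF mono])
      show "p ` {k..n} \<subseteq> {1..n}"
        using that permutes_image[OF p] by (metis atLeastatMost_subset_iff atLeastAtMost_iff image_mono order_refl)
      show "card (p ` {k..n}) = card {k..n}" using permutes_inj_on[OF p] by (rule card_image)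
    qed (use that in auto)
    finally show ?thesis .
  qed
  have le: "(\<Sum>k=2..n. \<Sum>i=k..n. l (p i)) \<le> (\<Sum>k=2..n. \<Sum>i=k..n. l i)"
    by (intro sum_mono tail) auto
  have "(\<Sum>k=2..n. \<Sum>i=k..n. l (p i)) \<noteq> (\<Sum>k=2..n. \<Sum>i=k..n. l i)"
  proof
    assume eq: "(\<Sum>k=2..n. \<Sum>i=k..n. l (p i)) = (\<Sum>k=2..n. \<Sum>i=k..n. l i)"
    have tail_eq: "(\<Sum>i=k..n. l (p i)) = (\<Sum>i=k..n. l i)" if "k \<in> {1..n}" for k
    proof (cases "k = 1")
      case True
      then show ?thesis using sum.permute[OF p, of l] by (simp add: o_def)
    next
      case False
      then show ?thesis
        using that by (intro sum_mono_inv[OF eq]) (auto intro: tail)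
    qed
    have "l (p i) = l i" if "i \<in> {1..n}" for i
    proof (cases "i = n")
      case True
      then show ?thesis using tail_eq[of n] that by simp
    next
      case False
      then have "Suc i \<in> {1..n}" using that by auto
      then show ?thesis
        using tail_eq[OF that] tail_eq[of "Suc i"] that
        by (simp add: sum.atLeast_Suc_atMost[of i n])
    qed
    then show False using ne by blast
  qed
  then show ?thesis using le unfolding sum_weights_tails by simp
qed

lemma sorting_permutation:
  fixes b :: "nat \<Rightarrow> nat"
  assumes inj: "inj_on b {1..n}"
  obtains p where "p permutes {1..n}" "\<And>i j. i \<in> {1..n} \<Longrightarrow> j \<in> {1..n} \<Longrightarrow> i < j \<Longrightarrow> b (p i) < b (p j)"
proof -
  have card: "card (b ` {1..n}) = n" using inj by (simp add: card_image)
  obtain h where h: "bij_betw h {..<n} (b ` {1..n})" "strict_mono_on {..<n} h"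
    using ex_bij_betw_strict_mono_card[of "b ` {1..n}"] card by auto
  define p where "p i = (if i \<in> {1..n} then inv_into {1..n} b (h (i - 1)) else i)" for i
  have "bij_betw (\<lambda>i. i - 1) {1..n} {..<n}"
    by (rule bij_betw_byWitness[where f' = Suc]) auto
  then have "bij_betw (inv_into {1..n} b \<circ> (h \<circ> (\<lambda>i. i - 1))) {1..n} {1..n}"
    using h(1) inj by (intro bij_betw_trans bij_betw_inv_into) (auto simp: bij_betw_def)
  then have "bij_betw p {1..n} {1..n}"
    by (rule bij_betw_cong[THEN iffD1, rotated]) (auto simp: p_def)
  then have "p permutes {1..n}" by (rule bij_imp_permutes) (auto simp: p_def)
  moreover have bp: "b (p i) = h (i - 1)" if "i \<in> {1..n}" for i
  proof -
    have "i - 1 \<in> {..<n}" using that by auto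
    then have "h (i - 1) \<in> b ` {1..n}" using h(1) by (auto simp: bij_betw_def)
    then show ?thesis using that by (simp add: p_def f_inv_into_f)
  qed
  moreover have "b (p i) < b (p j)" if "i \<in> {1..n}" "j \<in> {1..n}" "i < j" for i j
    unfolding bp[OF that(1)] bp[OF that(2)] using that by (intro strict_mono_onD[OF h(2)]) auto
  ultimately show ?thesis by (rule_tac that)
qed

section \<open>Products over pairs and permutations of the indices\<close>

lemma pairprod_ordered:
  assumes "finite A"
  shows "pairprod A (\<lambda>j k. H j k * H k j) = (\<Prod>j\<in>A. \<Prod>k\<in>A - {j}. H j k)"
proof -
  have "(\<Prod>k\<in>A - {j}. H j k) = (\<Prod>k\<in>{k \<in> A. j < k}. H j k) * (\<Prod>k\<in>{k \<in> A. k < j}. H j k)" for j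
  proof -
    have "A - {j} = {k \<in> A. j < k} \<union> {k \<in> A. k < j}" by auto
    then show ?thesis using assms by (simp add: prod.union_disjoint[of "{k \<in> A. j < k}" "{k \<in> A. k < j}"] disjoint_iff)
  qed
  then have "(\<Prod>j\<in>A. \<Prod>k\<in>A - {j}. H j k) =
     (\<Prod>j\<in>A. \<Prod>k\<in>{k \<in> A. j < k}. H j k) * (\<Prod>j\<in>A. \<Prod>k\<in>{k \<in> A. k < j}. H j k)"
    by (simp add: prod.distrib)
  also have "(\<Prod>j\<in>A. \<Prod>k\<in>{k \<in> A. k < j}. H j k) = (\<Prod>k\<in>A. \<Prod>j\<in>{j \<in> A. k < j}. H j k)"
    by (rule prod.swap_restrict) (use assms in auto)
  finally show ?thesis by (simp add: pairprod_def prod.distrib)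
qed

text \<open>Both sides are products over all ordered pairs of distinct indices, which a permutation
  merely rearranges.\<close>

lemma pairprod_permute:
  assumes A: "finite A" and p: "p permutes A"
  shows "pairprod A (\<lambda>j k. H (p j) (p k) * H (p k) (p j)) = pairprod A (\<lambda>j k. H j k * H k j)"
proof -
  have "(\<Prod>j\<in>A. \<Prod>k\<in>A - {j}. H j k) = (\<Prod>j\<in>A. \<Prod>k\<in>A - {p j}. H (p j) k)"
    using prod.permute[OF p, of "\<lambda>j. \<Prod>k\<in>A - {j}. H j k"] by (simp add: o_def)
  also have "\<dots> = (\<Prod>j\<in>A. \<Prod>k\<in>A - {j}. H (p j) (p k))"
  proof (rule prod.cong[OF refl])
    fix j assume "j \<in> A"
    have "bij_betw p (A - {j}) (A - {p j})"
      using bij_betw_DiffI[OF permutes_imp_bij[OF p], of "{j}" "{p j}"] \<open>j \<in> A\<close> permutes_in_image[OF p]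
      by (simp add: bij_betw_singletonI)
    then show "(\<Prod>k\<in>A - {p j}. H (p j) k) = (\<Prod>k\<in>A - {j}. H (p j) (p k))"
      by (rule prod.reindex_bij_betw[symmetric])
  qed
  finally show ?thesis
    unfolding pairprod_ordered[OF A] pairprod_ordered[OF A, of "\<lambda>j k. H (p j) (p k)"] ..
qed

lemma pairprod_mult: "pairprod A (\<lambda>j k. F j k * G j k) = pairprod A F * pairprod A G"
  by (simp add: pairprod_def prod.distrib)

lemma continuous_on_pairprod [continuous_intros]:
  assumes "\<And>j k. j \<in> A \<Longrightarrow> k \<in> A \<Longrightarrow> j < k \<Longrightarrow> continuous_on S (\<lambda>x. F x j k)"
  shows "continuous_on S (\<lambda>x. pairprod A (F x))"
  unfolding pairprod_def using assms by (intro continuous_on_prod) auto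

lemma holomorphic_on_pairprod [holomorphic_intros]:
  assumes "\<And>j k. j \<in> A \<Longrightarrow> k \<in> A \<Longrightarrow> j < k \<Longrightarrow> (\<lambda>x. F x j k) holomorphic_on S"
  shows "(\<lambda>x. pairprod A (F x)) holomorphic_on S"
  unfolding pairprod_def using assms by (intro holomorphic_on_prod) auto

subsection \<open>Vanishing moments of the kernel\<close>

text \<open>\<open>ker\<close> is the factor of Cauchy's kernel belonging to one variable, and
  \<open>f\<close> its multiplier under multiplication of the argument by \<open>q\<close>. If p(x)
  is the product of the 1 - y x over the second set of variables y, the multiplier is p(x) / p(t x),
  which is the relation \<open>p_t\<close>; the bound on the degree says that there are fewer than
  \<open>n\<close> such variables. The number \<open>r\<close> leaves room to shift
  contours.\<close>

locale kernel = nome +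
  fixes n :: nat and t :: complex and r :: real and ker f :: "complex \<Rightarrow> complex" and p :: "complex poly"
  assumes t_nz: "t \<noteq> 0" and t_le: "norm t \<le> r" and r_less: "r < 1"
    and ker_holo: "ker holomorphic_on ball 0 (1 / r)"
    and ker_q: "\<And>x. norm x = 1 \<Longrightarrow> ker (q * x) = f x * ker x"
    and p_deg: "degree p < n" and p_0: "coeff p 0 \<noteq> 0"
    and p_t: "\<And>x. norm x = 1 \<Longrightarrow> poly p x = f x * poly p (t * x)"
begin

lemma r_pos: "0 < r" and t_less: "norm t < 1"
  using t_nz t_le r_less by (auto simp: order_less_le_trans[OF _ t_le])

text \<open>The Macdonald weight of a pair without the factors 1 - u and 1 - 1/u; those are carried
  by two Vandermonde products, in \<open>z\<close> and in \<open>1 / z\<close>.\<close>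

definition pair_weight :: "complex \<Rightarrow> complex" where
  "pair_weight u = qp (q * u) * qp (q / u) / (qp (t * u) * qp (t / u))"

text \<open>The factor of a pair with exactly one index in \<open>I\<close>. On the unit circle and
  on the circle of radius 1/|q| it is \<open>pair_weight\<close>, at \<open>u\<close> and at
  \<open>q * u\<close>, times two linear factors; being holomorphic in between, it carries one side
  of the self-adjointness relation to the other.\<close>

definition cross :: "complex \<Rightarrow> complex" where
  "cross u = (1 - 1 / u) * (qp (q * u) * qp (q / u)) / (qp (q * t * u) * qp (t / u))"

definition density :: "(nat \<Rightarrow> complex) \<Rightarrow> complex" where
  "density z = pairprod {1..n} (\<lambda>j k. pair_weight (z j / z k)) * (\<Prod>i=1..n. ker (1 / z i))"

text \<open>Only one of the two Vandermonde factors of the weight is included, so the integral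
  alternates in the exponents; the other factor is treated as part of the function being
  integrated.\<close>

definition moment :: "(nat \<Rightarrow> nat) \<Rightarrow> complex" where
  "moment b = torus_integral n (\<lambda>z. vdm n (\<lambda>i. 1 / z i) * density z * (\<Prod>i=1..n. z i ^ b i))"

text \<open>Scaling the variables in \<open>I\<close> by \<open>s\<close> does not change ratios
  within \<open>I\<close> or within its complement, so \<open>s\<close> appears only in
  \<open>cross\<close>.\<close>

definition pair_factor :: "nat set \<Rightarrow> complex \<Rightarrow> (nat \<Rightarrow> complex) \<Rightarrow> nat \<Rightarrow> nat \<Rightarrow> complex" where
  "pair_factor I s z j k =
     (if (j \<in> I) = (k \<in> I)
      then (1 / z k - 1 / z j) * (z k - z j) * (if j \<in> I then t else 1) * pair_weight (z j / z k)
      else cross (s * (if j \<in> I then z j / z k else z k / z j)))"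

text \<open>The contribution of the subset \<open>I\<close> to the operator, with the variables in
  \<open>I\<close> scaled by \<open>s\<close>. For \<open>s = 1\<close> the operator acts on the
  monomial with exponents \<open>l\<close>, for \<open>s = 1 / q\<close> on the kernel.\<close>

definition shifted :: "nat set \<Rightarrow> (nat \<Rightarrow> nat) \<Rightarrow> complex \<Rightarrow> (nat \<Rightarrow> complex) \<Rightarrow> complex" where
  "shifted I l s z = pairprod {1..n} (pair_factor I s z) *
     (\<Prod>i=1..n. if i \<in> I then ker (1 / (s * z i)) * (q * s * z i) ^ l i else ker (1 / z i) * z i ^ l i)"

text \<open>The inner radius keeps \<open>1 / (s * z i)\<close> in the domain of \<open>ker\<close>
  and the factor \<open>qp (t / u)\<close> of \<open>cross\<close> nonzero; the outer radius does
  the latter for \<open>qp (q * t * u)\<close>. Both 1 and \<open>1 / q\<close> lie inside.\<close>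

definition shift_annulus :: "complex set" where
  "shift_annulus = {s. r < norm s \<and> norm s < 1 / (r * norm q)}"

lemma annulus_bounds: "1 < 1 / (r * norm q)"
  using r_pos r_less q_less mult_strict_mono[of r 1 "norm q" 1] by simp

lemma one_in_annulus: "1 \<in> shift_annulus"
  using annulus_bounds r_less by (simp add: shift_annulus_def)

lemma inverse_q_in_annulus: "1 / q \<in> shift_annulus"
proof -
  have "1 < norm (1 / q)" using q_less by (simp add: norm_divide)
  moreover have "norm (1 / q) < 1 / (r * norm q)"
    using r_pos r_less by (simp add: norm_divide field_simps)
  ultimately show ?thesis using r_less by (simp add: shift_annulus_def)
qed

lemma annulus_nonzero: "s \<in> shift_annulus \<Longrightarrow> s \<noteq> 0"
  using r_pos by (auto simp: shift_annulus_def)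

lemma cross_denominators:
  assumes "u \<in> shift_annulus"
  shows "qp (q * t * u) \<noteq> 0" "qp (t / u) \<noteq> 0"
proof -
  have u: "r < norm u" "norm u < 1 / (r * norm q)" using assms by (auto simp: shift_annulus_def)
  have "norm (q * t * u) \<le> norm q * r * norm u"
    using t_le r_pos by (auto simp: norm_mult intro!: mult_mono)
  also have "\<dots> < 1"
    using u r_pos by (simp add: pos_less_divide_eq mult_ac)
  finally show "qp (q * t * u) \<noteq> 0" by (rule qp_nonzero)
  have "norm (t / u) < 1"
    using u r_pos t_le by (simp add: norm_divide divide_less_eq)
  then show "qp (t / u) \<noteq> 0" by (rule qp_nonzero)
qed

lemma cross_holomorphic: "cross holomorphic_on shift_annulus"
  unfolding cross_def using cross_denominators annulus_nonzero by (intro holomorphic_intros) auto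

lemma pair_weight_denominators:
  assumes "norm u = 1"
  shows "qp (t * u) \<noteq> 0" "qp (t / u) \<noteq> 0"
  using assms t_less by (auto intro!: qp_nonzero simp: norm_mult norm_divide)

lemma pair_weight_continuous: "continuous_on (sphere 0 1) pair_weight"
  unfolding pair_weight_def using pair_weight_denominators by (intro continuous_intros) auto

lemma scale_in_annulus: "s \<in> shift_annulus \<Longrightarrow> norm u = 1 \<Longrightarrow> s * u \<in> shift_annulus"
  by (simp add: shift_annulus_def norm_mult)

lemma ratio_norm: "z \<in> torus n \<Longrightarrow> j \<in> {1..n} \<Longrightarrow> k \<in> {1..n} \<Longrightarrow> norm (z j / z k) = 1"
  by (simp add: norm_divide torus_norm)

lemma inverse_in_ball:
  assumes "s \<in> shift_annulus" "norm w = 1"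
  shows "1 / (s * w) \<in> ball 0 (1 / r)"
  using assms r_pos by (simp add: norm_divide norm_mult shift_annulus_def frac_less2)

lemma shifted_continuous:
  "continuous_on (shift_annulus \<times> torus n) (\<lambda>(s, z). shifted I l s z)"
proof -
  let ?X = "shift_annulus \<times> torus n"
  have coord: "continuous_on ?X (\<lambda>x. snd x i)" for i
    by (rule continuous_on_product_then_coordinatewise[OF continuous_on_snd[OF continuous_on_id]])
  have nz: "snd x i \<noteq> 0" if "x \<in> ?X" "i \<in> {1..n}" for x i
    using that torus_nonzero[of "snd x" n i] by auto
  have fnz: "fst x \<noteq> 0" if "x \<in> ?X" for x
    using that annulus_nonzero by auto
  have ratio: "continuous_on ?X (\<lambda>x. snd x j / snd x k)" if "j \<in> {1..n}" "k \<in> {1..n}" for j k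
    using nz that by (intro continuous_intros coord) auto
  have weight: "continuous_on ?X (\<lambda>x. pair_weight (snd x j / snd x k))" if "j \<in> {1..n}" "k \<in> {1..n}" for j k
    using that by (intro continuous_on_compose2[OF pair_weight_continuous ratio]) (auto simp: ratio_norm)
  have crs: "continuous_on ?X (\<lambda>x. cross (fst x * (snd x j / snd x k)))" if "j \<in> {1..n}" "k \<in> {1..n}" for j k
  proof (rule continuous_on_compose2[OF holomorphic_on_imp_continuous_on[OF cross_holomorphic]])
    show "continuous_on ?X (\<lambda>x. fst x * (snd x j / snd x k))"
      by (intro continuous_on_mult continuous_on_fst continuous_on_id ratio that)
    show "(\<lambda>x. fst x * (snd x j / snd x k)) ` ?X \<subseteq> shift_annulus"
      using scale_in_annulus ratio_norm that by fastforce
  qed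
  have "continuous_on ?X (\<lambda>x. pair_factor I (fst x) (snd x) j k)" if jk: "j \<in> {1..n}" "k \<in> {1..n}" for j k
  proof (cases "(j \<in> I) = (k \<in> I)")
    case True
    have "continuous_on ?X (\<lambda>x. (1 / snd x k - 1 / snd x j) * (snd x k - snd x j) * (if j \<in> I then t else 1) *
        pair_weight (snd x j / snd x k))"
      using nz jk by (intro continuous_intros coord weight) auto
    then show ?thesis
      unfolding pair_factor_def using True by simp
  next
    case False
    then show ?thesis
      unfolding pair_factor_def using crs jk by (cases "j \<in> I") auto
  qed
  moreover have "continuous_on ?X (\<lambda>x. if i \<in> I then ker (1 / (fst x * snd x i)) * (q * fst x * snd x i) ^ l i
        else ker (1 / snd x i) * snd x i ^ l i)" if i: "i \<in> {1..n}" for i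
  proof -
    have "continuous_on ?X (\<lambda>x. ker (1 / (fst x * snd x i)))"
      using i nz fnz
      by (intro continuous_on_compose2[OF holomorphic_on_imp_continuous_on[OF ker_holo]] continuous_intros coord)
        (auto intro!: inverse_in_ball simp del: mem_ball simp: torus_norm)
    moreover have "continuous_on ?X (\<lambda>x. ker (1 / snd x i))"
      using i nz inverse_in_ball[OF one_in_annulus]
      by (intro continuous_on_compose2[OF holomorphic_on_imp_continuous_on[OF ker_holo]] continuous_intros coord)
        (auto simp del: mem_ball simp: torus_norm)
    ultimately show ?thesis
      by (cases "i \<in> I") (auto intro!: continuous_intros coord)
  qed
  ultimately show ?thesis
    unfolding shifted_def case_prod_unfold by (intro continuous_intros) auto
qed

lemma shifted_holomorphic:
  assumes z: "z \<in> torus n"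
  shows "(\<lambda>s. shifted I l s z) holomorphic_on shift_annulus"
proof -
  have crs: "(\<lambda>s. cross (s * (z j / z k))) holomorphic_on shift_annulus" if "j \<in> {1..n}" "k \<in> {1..n}" for j k
    using scale_in_annulus[OF _ ratio_norm[OF z that]]
    by (intro holomorphic_on_compose_gen[OF _ cross_holomorphic, unfolded o_def] holomorphic_intros) blast
  have "(\<lambda>s. pair_factor I s z j k) holomorphic_on shift_annulus" if "j \<in> {1..n}" "k \<in> {1..n}" for j k
    unfolding pair_factor_def using crs that
    by (cases "(j \<in> I) = (k \<in> I)"; cases "j \<in> I") auto
  moreover have "(\<lambda>s. if i \<in> I then ker (1 / (s * z i)) * (q * s * z i) ^ l i
        else ker (1 / z i) * z i ^ l i) holomorphic_on shift_annulus" if i: "i \<in> {1..n}" for i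
  proof -
    have "(\<lambda>s. ker (1 / (s * z i))) holomorphic_on shift_annulus"
      using i z torus_nonzero annulus_nonzero
      by (intro holomorphic_on_compose_gen[OF _ ker_holo, unfolded o_def] holomorphic_intros)
        (auto intro!: inverse_in_ball simp del: mem_ball simp: torus_norm)
    then show ?thesis by (cases "i \<in> I") (auto intro!: holomorphic_intros)
  qed
  ultimately show ?thesis
    unfolding shifted_def by (intro holomorphic_intros) auto
qed

lemma shifted_rotate:
  assumes c: "norm c = 1" and z: "z \<in> torus n"
  shows "shifted I l c z = shifted I l 1 (\<lambda>i\<in>{1..n}. if i \<in> I then c * z i else z i)"
proof -
  have c0: "c \<noteq> 0" using c by auto
  have "pair_factor I c z j k = pair_factor I 1 (\<lambda>i\<in>{1..n}. if i \<in> I then c * z i else z i) j k"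
    if "j \<in> {1..n}" "k \<in> {1..n}" for j k
  proof -
    have "z j \<noteq> 0" "z k \<noteq> 0" using that z torus_nonzero by auto
    then have "(1 / (c * z k) - 1 / (c * z j)) * (c * z k - c * z j) = (1 / z k - 1 / z j) * (z k - z j)"
      using c0 by (simp add: field_simps)
    then show ?thesis
      using that c0 by (simp add: pair_factor_def)
  qed
  then have "pairprod {1..n} (pair_factor I c z) =
      pairprod {1..n} (pair_factor I 1 (\<lambda>i\<in>{1..n}. if i \<in> I then c * z i else z i))"
    by (intro pairprod_cong)
  then show ?thesis
    unfolding shifted_def by (auto intro!: arg_cong2[of _ _ _ _ "(*)"] prod.cong simp: mult.assoc)
qed

lemma shift_contour:
  "torus_integral n (shifted I l (1 / q)) = torus_integral n (shifted I l 1)"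
proof (rule torus_integral_scale[where S = shift_annulus and I = I])
  show "continuous_on (shift_annulus \<times> torus n) (\<lambda>(s, z). shifted I l s z)"
    by (rule shifted_continuous)
  show "(\<lambda>s. shifted I l s z) holomorphic_on shift_annulus" if "z \<in> torus n" for z
    by (rule shifted_holomorphic[OF that])
  show "shifted I l c z = shifted I l 1 (\<lambda>i\<in>{1..n}. if i \<in> I then c * z i else z i)"
    if "norm c = 1" "z \<in> torus n" for c z
    by (rule shifted_rotate[OF that])
qed (rule shift_annulus_def r_less annulus_bounds inverse_q_in_annulus)+

text \<open>By \<open>qp_rec\<close>, \<open>cross u\<close> is here \<open>pair_weight u\<close>
  times (1 - 1/u) (1 - t u), which is what the two Vandermonde products contribute for a pair
  separated by \<open>I\<close>.\<close>

lemma shifted_one: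
  assumes z: "z \<in> torus n"
  shows "shifted I l 1 z =
     vdm n (\<lambda>i. 1 / z i) * density z * (vdm n (scale t I z) * (\<Prod>i=1..n. scale q I z i ^ l i))"
proof -
  have "pair_factor I 1 z j k =
      (1 / z k - 1 / z j) * (scale t I z k - scale t I z j) * pair_weight (z j / z k)"
    if "j \<in> {1..n}" "k \<in> {1..n}" for j k
  proof -
    have nz: "z j \<noteq> 0" "z k \<noteq> 0" using that z torus_nonzero by auto
    have norms: "norm (z j / z k) = 1" "norm (z k / z j) = 1"
      using ratio_norm[OF z] that by auto
    have rec: "cross u = (1 - 1 / u) * (1 - t * u) * pair_weight u" if "norm u = 1" for u
      using pair_weight_denominators[OF that] cross_denominators(1)[of u] scale_in_annulus[OF one_in_annulus that]
      by (simp add: cross_def pair_weight_def qp_rec[of "t * u"] mult_ac)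
    have sym: "pair_weight (z k / z j) = pair_weight (z j / z k)"
      by (simp add: pair_weight_def mult_ac)
    show ?thesis
      using nz rec[OF norms(1)] rec[OF norms(2)] sym
      by (auto simp: pair_factor_def scale_def) (simp_all add: field_simps)
  qed
  then have "pairprod {1..n} (pair_factor I 1 z) = vdm n (\<lambda>i. 1 / z i) * vdm n (scale t I z) *
      pairprod {1..n} (\<lambda>j k. pair_weight (z j / z k))"
    unfolding vdm_def pairprod_mult[symmetric] by (intro pairprod_cong)
  moreover have "(\<Prod>i=1..n. if i \<in> I then ker (1 / (1 * z i)) * (q * 1 * z i) ^ l i else ker (1 / z i) * z i ^ l i) =
      (\<Prod>i=1..n. ker (1 / z i)) * (\<Prod>i=1..n. scale q I z i ^ l i)"
    unfolding prod.distrib[symmetric] by (intro prod.cong) (auto simp: scale_def)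
  ultimately show ?thesis
    by (simp add: shifted_def density_def mult_ac)
qed

text \<open>The scaling by \<open>1 / q\<close> cancels the \<open>q\<close> in the monomial, and
  the kernel acquires the multipliers \<open>f (1 / z i)\<close> instead. The Vandermonde products
  in \<open>z\<close> and in \<open>1 / z\<close> exchange their roles.\<close>

lemma shifted_inverse_q:
  assumes z: "z \<in> torus n" and I: "I \<subseteq> {1..n}"
  shows "shifted I l (1 / q) z = vdm n z * density z * (\<Prod>i=1..n. z i ^ l i) *
     (vdm n (scale t I (\<lambda>i. 1 / z i)) * (\<Prod>i\<in>I. f (1 / z i)))"
proof -
  have "pair_factor I (1 / q) z j k =
      (z k - z j) * (scale t I (\<lambda>i. 1 / z i) k - scale t I (\<lambda>i. 1 / z i) j) * pair_weight (z j / z k)"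
    if "j \<in> {1..n}" "k \<in> {1..n}" for j k
  proof -
    have nz: "z j \<noteq> 0" "z k \<noteq> 0" using that z torus_nonzero by auto
    have norms: "norm (z j / z k) = 1" "norm (z k / z j) = 1"
      using ratio_norm[OF z] that by auto
    have rec: "cross (1 / q * u) = (1 - u) * (1 - t / u) * pair_weight u" if u: "norm u = 1" for u
    proof -
      have u0: "u \<noteq> 0" using u by auto
      have "cross (1 / q * u) = (1 - q / u) * (qp u * qp (q * (q / u))) / (qp (t * u) * qp (q * (t / u)))"
        using u0 by (simp add: cross_def mult_ac)
      also have "\<dots> = qp u * ((1 - q / u) * qp (q * (q / u))) / (qp (t * u) * qp (q * (t / u)))"
        by (simp only: mult_ac)
      also have "(1 - q / u) * qp (q * (q / u)) = qp (q / u)"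
        by (simp only: qp_rec[of "q / u", symmetric])
      also have "qp u * qp (q / u) / (qp (t * u) * qp (q * (t / u))) =
          (1 - t / u) * (qp u * qp (q / u)) / (qp (t * u) * qp (t / u))"
      proof -
        have "qp (t / u) = (1 - t / u) * qp (q * (t / u))" by (rule qp_rec)
        then show ?thesis using pair_weight_denominators[OF u] by auto
      qed
      also have "\<dots> = (1 - u) * (1 - t / u) * pair_weight u"
        by (simp add: pair_weight_def qp_rec[of u])
      finally show ?thesis .
    qed
    have sym: "pair_weight (z k / z j) = pair_weight (z j / z k)"
      by (simp add: pair_weight_def mult_ac)
    show ?thesis
      using nz rec[OF norms(1)] rec[OF norms(2)] sym
      by (auto simp: pair_factor_def scale_def) (simp_all add: field_simps)
  qed
  then have 1: "pairprod {1..n} (pair_factor I (1 / q) z) = vdm n z * vdm n (scale t I (\<lambda>i. 1 / z i)) *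
      pairprod {1..n} (\<lambda>j k. pair_weight (z j / z k))"
    unfolding vdm_def pairprod_mult[symmetric] by (intro pairprod_cong)
  have "(\<Prod>i=1..n. if i \<in> I then ker (1 / (1 / q * z i)) * (q * (1 / q) * z i) ^ l i else ker (1 / z i) * z i ^ l i) =
      (\<Prod>i=1..n. ker (1 / z i)) * (\<Prod>i=1..n. z i ^ l i) * (\<Prod>i=1..n. if i \<in> I then f (1 / z i) else 1)"
    unfolding prod.distrib[symmetric]
  proof (intro prod.cong refl)
    fix i assume "i \<in> {1..n}"
    then have "ker (q * (1 / z i)) = f (1 / z i) * ker (1 / z i)"
      using z by (intro ker_q) (simp add: norm_divide torus_norm)
    then show "(if i \<in> I then ker (1 / (1 / q * z i)) * (q * (1 / q) * z i) ^ l i else ker (1 / z i) * z i ^ l i) =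
        ker (1 / z i) * z i ^ l i * (if i \<in> I then f (1 / z i) else 1)"
      by simp
  qed
  also have "(\<Prod>i=1..n. if i \<in> I then f (1 / z i) else 1) = (\<Prod>i\<in>I. f (1 / z i))"
    using I by (simp add: prod.If_cases Int_absorb1 Int_def[symmetric] flip: Collect_mem_eq)
  finally show ?thesis
    unfolding shifted_def 1 by (simp add: density_def mult_ac)
qed

lemma density_continuous: "continuous_on (torus n) density"
proof -
  have coord: "continuous_on (torus n) (\<lambda>z. z i)" for i
    by (rule continuous_on_product_then_coordinatewise[OF continuous_on_id])
  have "continuous_on (torus n) (\<lambda>z. pair_weight (z j / z k))" if "j \<in> {1..n}" "k \<in> {1..n}" for j k
    using that torus_nonzero ratio_norm
    by (intro continuous_on_compose2[OF pair_weight_continuous] continuous_intros coord) auto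
  moreover have "continuous_on (torus n) (\<lambda>z. ker (1 / z i))" if "i \<in> {1..n}" for i
    using that torus_nonzero inverse_in_ball[OF one_in_annulus]
    by (intro continuous_on_compose2[OF holomorphic_on_imp_continuous_on[OF ker_holo]] continuous_intros coord)
      (auto simp del: mem_ball simp: torus_norm)
  ultimately show ?thesis
    unfolding density_def by (intro continuous_intros) auto
qed

lemma coord_continuous: "continuous_on S (\<lambda>z :: nat \<Rightarrow> complex. z i)"
  by (rule continuous_on_product_then_coordinatewise[OF continuous_on_id])

lemma vdm_inverse_continuous: "continuous_on (torus n) (\<lambda>z. vdm n (\<lambda>i. 1 / z i))"
  unfolding vdm_def using torus_nonzero by (intro continuous_intros coord_continuous) auto

text \<open>
  The operator \<open>g \<mapsto> V\<^sup>-\<^sup>1 \<Sum>\<^sub>I (-1)\<^sup>|\<^sup>I\<^sup>| V(t\<^sup>I z) g(q\<^sup>I z)\<close> (a generating function of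
  Macdonald operators) is self-adjoint and annihilates the kernel. Applied to a monomial this gives:
\<close>

lemma moment_relation:
  "(\<Sum>w | w permutes {1..n}. of_int (sign w) * (\<Prod>i=1..n. 1 - t ^ (w i - 1) * q ^ l i) *
      moment (\<lambda>i. l i + (w i - 1))) = 0"
proof -
  let ?V = "\<lambda>z. vdm n (\<lambda>i. 1 / z i) * density z"
  have cont: "continuous_on (torus n) (shifted I l s)" if "s \<in> shift_annulus" for I s
    using that by (rule continuous_on_slice[OF shifted_continuous])
  \<comment> \<open>A variable in \<open>I\<close> contributes \<open>t\<close> through the
    Vandermonde product and \<open>q ^ l i\<close> through the monomial; \<open>sum_Pow_vdm\<close>
    then yields one factor \<open>1 - t ^ (w i - 1) * q ^ l i\<close> per row.\<close>
  have alt_z: "(\<Sum>I\<in>Pow {1..n}. (-1) ^ card I * (vdm n (scale t I z) * (\<Prod>i=1..n. scale q I z i ^ l i))) =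
      (\<Sum>w | w permutes {1..n}. of_int (sign w) * (\<Prod>i=1..n. 1 - t ^ (w i - 1) * q ^ l i) * (\<Prod>i=1..n. z i ^ (l i + (w i - 1))))"
    for z
  proof -
    have "(\<Sum>I\<in>Pow {1..n}. (-1) ^ card I * (vdm n (scale t I z) * (\<Prod>i=1..n. scale q I z i ^ l i))) =
       (\<Prod>i=1..n. z i ^ l i) * (\<Sum>I\<in>Pow {1..n}. (-1) ^ card I * vdm n (scale t I z) * (\<Prod>i\<in>I. q ^ l i))"
      unfolding sum_distrib_left
    proof (intro sum.cong refl)
      fix I assume I: "I \<in> Pow {1..n}"
      have "(\<Prod>i=1..n. scale q I z i ^ l i) = (\<Prod>i=1..n. z i ^ l i) * (\<Prod>i=1..n. if i \<in> I then q ^ l i else 1)"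
        unfolding prod.distrib[symmetric] by (intro prod.cong) (auto simp: scale_def power_mult_distrib)
      also have "(\<Prod>i=1..n. if i \<in> I then q ^ l i else 1) = (\<Prod>i\<in>I. q ^ l i)"
        using I by (simp add: prod.If_cases Int_absorb1 Int_def[symmetric] flip: Collect_mem_eq)
      finally show "(-1) ^ card I * (vdm n (scale t I z) * (\<Prod>i=1..n. scale q I z i ^ l i)) =
         (\<Prod>i=1..n. z i ^ l i) * ((-1) ^ card I * vdm n (scale t I z) * (\<Prod>i\<in>I. q ^ l i))"
        by (simp only: mult_ac)
    qed
    also have "\<dots> = (\<Sum>w | w permutes {1..n}. of_int (sign w) *
        ((\<Prod>i=1..n. z i ^ l i) * (\<Prod>i=1..n. z i ^ (w i - 1) - (t * z i) ^ (w i - 1) * q ^ l i)))"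
      unfolding sum_Pow_vdm alt_def sum_distrib_left by (simp only: mult_ac)
    also have "\<dots> = (\<Sum>w | w permutes {1..n}. of_int (sign w) * (\<Prod>i=1..n. 1 - t ^ (w i - 1) * q ^ l i) * (\<Prod>i=1..n. z i ^ (l i + (w i - 1))))"
    proof (rule sum.cong[OF refl])
      fix w :: "nat \<Rightarrow> nat"
      have "(\<Prod>i=1..n. z i ^ l i) * (\<Prod>i=1..n. z i ^ (w i - 1) - (t * z i) ^ (w i - 1) * q ^ l i) =
          (\<Prod>i=1..n. 1 - t ^ (w i - 1) * q ^ l i) * (\<Prod>i=1..n. z i ^ (l i + (w i - 1)))"
        unfolding prod.distrib[symmetric]
        by (rule prod.cong[OF refl]) (simp add: power_add power_mult_distrib algebra_simps)
      then show "of_int (sign w) *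
        ((\<Prod>i=1..n. z i ^ l i) * (\<Prod>i=1..n. z i ^ (w i - 1) - (t * z i) ^ (w i - 1) * q ^ l i)) =
        of_int (sign w) * (\<Prod>i=1..n. 1 - t ^ (w i - 1) * q ^ l i) * (\<Prod>i=1..n. z i ^ (l i + (w i - 1)))"
        by (simp only: mult.assoc)
    qed
    finally show ?thesis .
  qed
  have "(\<Sum>w | w permutes {1..n}. of_int (sign w) * (\<Prod>i=1..n. 1 - t ^ (w i - 1) * q ^ l i) *
      moment (\<lambda>i. l i + (w i - 1))) =
     torus_integral n (\<lambda>z. \<Sum>w | w permutes {1..n}. of_int (sign w) * (\<Prod>i=1..n. 1 - t ^ (w i - 1) * q ^ l i) *
       (?V z * (\<Prod>i=1..n. z i ^ (l i + (w i - 1)))))"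
    unfolding moment_def
    by (subst torus_integral_sum)
      (auto intro!: continuous_intros vdm_inverse_continuous density_continuous coord_continuous simp: torus_integral_cmult)
  also have "\<dots> = torus_integral n (\<lambda>z. \<Sum>I\<in>Pow {1..n}. (-1) ^ card I * shifted I l 1 z)"
  proof (rule torus_integral_cong)
    fix z assume z: "z \<in> torus n"
    have "(\<Sum>I\<in>Pow {1..n}. (-1) ^ card I * shifted I l 1 z) =
       ?V z * (\<Sum>I\<in>Pow {1..n}. (-1) ^ card I * (vdm n (scale t I z) * (\<Prod>i=1..n. scale q I z i ^ l i)))"
      unfolding sum_distrib_left shifted_one[OF z] by (simp only: mult_ac)
    then show "(\<Sum>w | w permutes {1..n}. of_int (sign w) * (\<Prod>i=1..n. 1 - t ^ (w i - 1) * q ^ l i) *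
       (?V z * (\<Prod>i=1..n. z i ^ (l i + (w i - 1))))) = (\<Sum>I\<in>Pow {1..n}. (-1) ^ card I * shifted I l 1 z)"
      unfolding alt_z sum_distrib_left by (simp only: mult_ac)
  qed
  also have "\<dots> = (\<Sum>I\<in>Pow {1..n}. (-1) ^ card I * torus_integral n (shifted I l 1))"
    using cont[OF one_in_annulus] by (subst torus_integral_sum) (auto intro!: continuous_intros simp: torus_integral_cmult)
  \<comment> \<open>Self-adjointness: moving the contours of the variables in \<open>I\<close>
    transfers the \<open>q\<close>-shift from the monomial to the kernel.\<close>
  also have "\<dots> = (\<Sum>I\<in>Pow {1..n}. (-1) ^ card I * torus_integral n (shifted I l (1 / q)))"
    unfolding shift_contour ..
  also have "\<dots> = torus_integral n (\<lambda>z. \<Sum>I\<in>Pow {1..n}. (-1) ^ card I * shifted I l (1 / q) z)"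
    using cont[OF inverse_q_in_annulus] by (subst torus_integral_sum) (auto intro!: continuous_intros simp: torus_integral_cmult)
  \<comment> \<open>The kernel is annihilated pointwise, by \<open>sum_Pow_vdm_zero\<close> at the
    points \<open>1 / z i\<close>. The integrand is written \<open>0 * 0\<close> so that
    \<open>torus_integral_cmult\<close> evaluates the integral to zero.\<close>
  also have "\<dots> = torus_integral n (\<lambda>z. 0 * 0)"
  proof (rule torus_integral_cong)
    fix z assume z: "z \<in> torus n"
    have "(\<Sum>I\<in>Pow {1..n}. (-1) ^ card I * shifted I l (1 / q) z) =
       vdm n z * density z * (\<Prod>i=1..n. z i ^ l i) *
        (\<Sum>I\<in>Pow {1..n}. (-1) ^ card I * vdm n (scale t I (\<lambda>i. 1 / z i)) * (\<Prod>i\<in>I. f (1 / z i)))"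
      unfolding sum_distrib_left using shifted_inverse_q[OF z] by (intro sum.cong) (auto simp: mult_ac)
    also have "(\<Sum>I\<in>Pow {1..n}. (-1) ^ card I * vdm n (scale t I (\<lambda>i. 1 / z i)) * (\<Prod>i\<in>I. f (1 / z i))) = 0"
    proof (rule sum_Pow_vdm_zero[OF p_deg p_0])
      fix i assume "i \<in> {1..n}"
      then have "norm (1 / z i) = 1" using z by (simp add: norm_divide torus_norm)
      then show "poly p (1 / z i) = f (1 / z i) * poly p (t * (1 / z i))" by (rule p_t)
    qed
    finally show "(\<Sum>I\<in>Pow {1..n}. (-1) ^ card I * shifted I l (1 / q) z) = 0 * 0" by simp
  qed
  also have "\<dots> = 0" unfolding torus_integral_cmult by simp
  finally show ?thesis .
qed

lemma moment_cong: "(\<And>i. i \<in> {1..n} \<Longrightarrow> b i = c i) \<Longrightarrow> moment b = moment c"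
  unfolding moment_def by (intro torus_integral_cong arg_cong2[of _ _ _ _ "(*)"] refl prod.cong) auto

text \<open>\<open>density\<close> is symmetric and the Vandermonde factor alternating, so renaming
  the variables costs exactly the sign.\<close>

lemma moment_permute:
  assumes w: "w permutes {1..n}"
  shows "moment (\<lambda>i. b (w i)) = of_int (sign w) * moment b"
proof -
  define F where "F z = vdm n (\<lambda>i. 1 / z i) * density z * (\<Prod>i=1..n. z i ^ b (w i))" for z
  define g where "g u = qp (q * u) / qp (t * u)" for u
  have win: "w i \<in> {1..n}" if "i \<in> {1..n}" for i using permutes_in_image[OF w] that by blast
  have dens: "density (\<lambda>i. z (w i)) = density z" for z
  proof -
    have "pair_weight (z j / z k) = g (z j / z k) * g (z k / z j)" for j k and z :: "nat \<Rightarrow> complex"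
      by (simp add: pair_weight_def g_def)
    then have "pairprod {1..n} (\<lambda>j k. pair_weight (z (w j) / z (w k))) = pairprod {1..n} (\<lambda>j k. pair_weight (z j / z k))"
      using pairprod_permute[OF _ w, of "\<lambda>j k. g (z j / z k)"] by simp
    moreover have "(\<Prod>i=1..n. ker (1 / z (w i))) = (\<Prod>i=1..n. ker (1 / z i))"
      using prod.permute[OF w, of "\<lambda>i. ker (1 / z i)"] by (simp add: o_def)
    ultimately show ?thesis by (simp add: density_def)
  qed
  have F_cong: "F z = F z'" if "\<And>i. i \<in> {1..n} \<Longrightarrow> z i = z' i" for z z'
    unfolding F_def vdm_def density_def using that
    by (intro arg_cong2[of _ _ _ _ "(*)"] prod.cong pairprod_cong) auto
  have contF: "continuous_on (torus n) F"
    unfolding F_def by (intro continuous_intros vdm_inverse_continuous density_continuous coord_continuous)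
  have "moment (\<lambda>i. b (w i)) = torus_integral n F"
    by (simp add: moment_def F_def[abs_def])
  also have "\<dots> = torus_integral n (\<lambda>z. F (\<lambda>i\<in>{1..n}. z (w i)))"
    by (rule torus_integral_permute[OF contF w, symmetric])
  also have "\<dots> = torus_integral n (\<lambda>z. of_int (sign w) * (vdm n (\<lambda>i. 1 / z i) * density z * (\<Prod>i=1..n. z i ^ b i)))"
  proof (rule torus_integral_cong)
    fix z
    have restr: "F (\<lambda>i\<in>{1..n}. z (w i)) = F (\<lambda>i. z (w i))"
      by (intro F_cong) simp
    have "F (\<lambda>i. z (w i)) = of_int (sign w) * vdm n (\<lambda>i. 1 / z i) * density z * (\<Prod>i=1..n. z (w i) ^ b (w i))"
      unfolding F_def dens using vdm_permute[OF w, of "\<lambda>i. 1 / z i"] by simp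
    also have "(\<Prod>i=1..n. z (w i) ^ b (w i)) = (\<Prod>i=1..n. z i ^ b i)"
      using prod.permute[OF w, of "\<lambda>i. z i ^ b i"] by (simp add: o_def)
    finally show "F (\<lambda>i\<in>{1..n}. z (w i)) =
       of_int (sign w) * (vdm n (\<lambda>i. 1 / z i) * density z * (\<Prod>i=1..n. z i ^ b i))"
      unfolding restr by (simp only: mult_ac)
  qed
  finally show ?thesis by (simp add: torus_integral_cmult moment_def)
qed

text \<open>The relation is triangular with respect to the sum of the squares of the exponents.\<close>

theorem moment_zero:
  assumes "\<And>i. i \<in> {1..n} \<Longrightarrow> 1 \<le> b i"
  shows "moment b = 0"
  using assms
proof (induction "\<Sum>i=1..n. (b i)\<^sup>2" arbitrary: b rule: less_induct)
  case less
  show ?case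
  proof (cases "inj_on b {1..n}")
    case False
    then obtain j k where jk: "j \<in> {1..n}" "k \<in> {1..n}" "j \<noteq> k" "b j = b k"
      by (auto simp: inj_on_def)
    have "(\<lambda>i. b (Transposition.transpose j k i)) = b"
      using jk by (auto simp: Transposition.transpose_def fun_eq_iff)
    then have "moment b = - moment b"
      using moment_permute[OF permutes_swap_id[OF jk(1,2)], of b] jk(3) by (simp add: sign_swap_id)
    then show ?thesis by simp
  next
    case True
    obtain v where v: "v permutes {1..n}"
      and inc: "\<And>i j. i \<in> {1..n} \<Longrightarrow> j \<in> {1..n} \<Longrightarrow> i < j \<Longrightarrow> b (v i) < b (v j)"
      using sorting_permutation[OF True] by blast
    define c where "c i = b (v i)" for i
    have c1: "1 \<le> c i" if "i \<in> {1..n}" for i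
      using less.prems permutes_in_image[OF v] that by (auto simp: c_def)
    have c_gt: "i \<le> c i" if "i \<in> {1..n}" for i
      using that
    proof (induction i)
      case (Suc i)
      show ?case
      proof (cases "i = 0")
        case True then show ?thesis using c1[of 1] Suc.prems by simp
      next
        case False
        then have "i \<in> {1..n}" using Suc.prems by auto
        then show ?thesis using Suc.IH inc[of i "Suc i"] Suc.prems by (auto simp: c_def)
      qed
    qed simp
    \<comment> \<open>Removing the staircase \<open>i - 1\<close> turns the strictly increasing
      exponents \<open>c i\<close>, which are at least \<open>i\<close>, into a nondecreasing
      sequence with values at least 1; the truncated subtraction is exact.\<close>
    define l where "l i = c i - (i - 1)" for i
    have cl: "c i = l i + (i - 1)" "1 \<le> l i" if "i \<in> {1..n}" for i
      using c_gt[OF that] that by (auto simp: l_def)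
    have mono: "l i \<le> l j" if "i \<in> {1..n}" "j \<in> {1..n}" "i \<le> j" for i j
    proof -
      have "c i + k \<le> c (i + k)" if "i + k \<in> {1..n}" for k
        using that
      proof (induction k)
        case (Suc k)
        then have "c (i + k) < c (i + Suc k)"
          using inc[of "i + k" "i + Suc k"] \<open>i \<in> {1..n}\<close> by (simp add: c_def)
        then show ?case using Suc \<open>i \<in> {1..n}\<close> by simp
      qed simp
      from this[of "j - i"] have "c i + (j - i) \<le> c j" using that by simp
      then show ?thesis using that by (simp add: l_def)
    qed
    have sq_c: "(\<Sum>i=1..n. (c i)\<^sup>2) = (\<Sum>i=1..n. (b i)\<^sup>2)"
      using sum.permute[OF v, of "\<lambda>i. (b i)\<^sup>2"] by (simp add: o_def c_def)
    \<comment> \<open>The diagonal coefficient of the relation. As \<open>l i\<close> is at least 1,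
      each \<open>t ^ (i - 1) * q ^ l i\<close> has absolute value at most |q|, so no factor
      vanishes; here the positivity of the exponents is used.\<close>
    define K where "K = (\<Prod>i=1..n. 1 - t ^ (i - 1) * q ^ l i)"
    have K: "K \<noteq> 0"
    proof -
      have "t ^ (i - 1) * q ^ l i \<noteq> 1" if "i \<in> {1..n}" for i
      proof -
        have "norm (t ^ (i - 1) * q ^ l i) \<le> 1 * norm (q ^ l i)"
          using t_less by (auto simp: norm_mult norm_power power_le_one intro!: mult_right_mono)
        also have "\<dots> \<le> norm q ^ 1"
          unfolding norm_power mult_1 using cl(2)[OF that] q_less by (intro power_decreasing) auto
        finally show ?thesis using q_less by auto
      qed
      then show ?thesis by (simp add: K_def prod_zero_iff)
    qed
    \<comment> \<open>If \<open>w\<close> preserves \<open>l\<close>, the exponents are those of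
      \<open>c\<close> permuted by \<open>w\<close>, and the sign from \<open>moment_permute\<close>
      cancels \<open>sign w\<close>. So these terms add up to \<open>card Stab\<close> equal copies
      of \<open>K * moment c\<close>, without cancellation.\<close>
    define Stab where "Stab = {w. w permutes {1..n} \<and> (\<forall>i\<in>{1..n}. l (w i) = l i)}"
    have finS: "finite {w. w permutes {1..n}}" by (intro finite_permutations) simp
    have "(\<Sum>w | w permutes {1..n}. of_int (sign w) * (\<Prod>i=1..n. 1 - t ^ (w i - 1) * q ^ l i) *
        moment (\<lambda>i. l i + (w i - 1))) = (\<Sum>w\<in>Stab. K * moment c)"
    proof (rule sum.mono_neutral_cong_right[OF finS])
      show "Stab \<subseteq> {w. w permutes {1..n}}" by (auto simp: Stab_def)
      show "of_int (sign w) * (\<Prod>i=1..n. 1 - t ^ (w i - 1) * q ^ l i) * moment (\<lambda>i. l i + (w i - 1)) = K * moment c"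
        if "w \<in> Stab" for w
      proof -
        have w: "w permutes {1..n}" and lw: "\<And>i. i \<in> {1..n} \<Longrightarrow> l (w i) = l i"
          using that by (auto simp: Stab_def)
        have win: "w i \<in> {1..n}" if "i \<in> {1..n}" for i using permutes_in_image[OF w] that by blast
        have "moment (\<lambda>i. l i + (w i - 1)) = moment (\<lambda>i. c (w i))"
          using win lw cl by (intro moment_cong) auto
        moreover have "(\<Prod>i=1..n. 1 - t ^ (w i - 1) * q ^ l i) = (\<Prod>i=1..n. 1 - t ^ (w i - 1) * q ^ l (w i))"
          using lw by (intro prod.cong) auto
        moreover have "\<dots> = K"
          using prod.permute[OF w, of "\<lambda>i. 1 - t ^ (i - 1) * q ^ l i"] by (simp add: o_def K_def)
        moreover have "of_int (sign w) * of_int (sign w) = (1 :: complex)"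
          by (simp flip: of_int_mult)
        ultimately show ?thesis
          using moment_permute[OF w, of c] by (simp add: mult_ac)
      qed
      show "\<forall>w\<in>{w. w permutes {1..n}} - Stab. of_int (sign w) * (\<Prod>i=1..n. 1 - t ^ (w i - 1) * q ^ l i) *
          moment (\<lambda>i. l i + (w i - 1)) = 0"
      proof
        fix w assume "w \<in> {w. w permutes {1..n}} - Stab"
        then have w: "w permutes {1..n}" and ne: "\<exists>i\<in>{1..n}. l (w i) \<noteq> l i" by (auto simp: Stab_def)
        have wi: "inv w permutes {1..n}" by (rule permutes_inv[OF w])
        have ne': "\<exists>i\<in>{1..n}. l (inv w i) \<noteq> l i"
          using ne permutes_in_image[OF w] permutes_inverses(2)[OF w] by metis
        \<comment> \<open>In the sum of squares of the exponents only the cross term depends on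
          \<open>w\<close>. Moving the permutation to \<open>l\<close> replaces \<open>w\<close> by
          its inverse, and strict rearrangement makes the cross term smaller.\<close>
        have "(\<Sum>i=1..n. (w i - 1) * l i) = (\<Sum>i=1..n. (i - 1) * l (inv w i))"
          using sum.permute[OF w, of "\<lambda>i. (i - 1) * l (inv w i)"] permutes_inverses(2)[OF w] by (simp add: o_def)
        also have "\<dots> < (\<Sum>i=1..n. (i - 1) * l i)"
          by (rule rearrangement_strict[OF mono wi ne'])
        finally have lt: "(\<Sum>i=1..n. (w i - 1) * l i) < (\<Sum>i=1..n. (i - 1) * l i)" .
        have sq: "(\<Sum>i=1..n. (l i + e i)\<^sup>2) = (\<Sum>i=1..n. (l i)\<^sup>2) + (\<Sum>i=1..n. (e i)\<^sup>2) + 2 * (\<Sum>i=1..n. e i * l i)"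
          for e :: "nat \<Rightarrow> nat"
          by (simp add: power2_sum sum.distrib sum_distrib_left mult_ac)
        have "(\<Sum>i=1..n. (w i - 1)\<^sup>2) = (\<Sum>i=1..n. (i - 1)\<^sup>2)"
          using sum.permute[OF w, of "\<lambda>i. (i - 1)\<^sup>2"] by (simp add: o_def)
        then have "(\<Sum>i=1..n. (l i + (w i - 1))\<^sup>2) < (\<Sum>i=1..n. (l i + (i - 1))\<^sup>2)"
          unfolding sq using lt by simp
        also have "\<dots> = (\<Sum>i=1..n. (c i)\<^sup>2)"
          using cl(1) by (intro sum.cong) auto
        finally have "moment (\<lambda>i. l i + (w i - 1)) = 0"
          unfolding sq_c using cl(2) by (intro less.hyps) (auto intro: trans_le_add1)
        then show "of_int (sign w) * (\<Prod>i=1..n. 1 - t ^ (w i - 1) * q ^ l i) * moment (\<lambda>i. l i + (w i - 1)) = 0"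
          by simp
      qed
    qed
    from trans[OF sym[OF this] moment_relation] have "of_nat (card Stab) * (K * moment c) = 0"
      by (simp only: sum_constant)
    moreover have "id \<in> Stab" by (simp add: Stab_def permutes_id)
    moreover have "finite Stab" by (rule finite_subset[OF _ finS]) (auto simp: Stab_def)
    ultimately have "card Stab \<noteq> 0" "of_nat (card Stab) * (K * moment c) = 0"
      by auto
    then have "moment c = 0" using K by simp
    then show ?thesis
      using moment_permute[OF v, of b] by (simp add: c_def[abs_def])
  qed
qed

end

section \<open>From monomials to functions holomorphic on a neighbourhood of the closed
  polydisc\<close>

context kernel
begin

text \<open>The condition ranges over all positive exponent vectors, which makes it stable under
  multiplication by monomials and hence by convergent power series.\<close>

definition null :: "((nat \<Rightarrow> complex) \<Rightarrow> complex) \<Rightarrow> bool" where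
  "null g \<longleftrightarrow> continuous_on (torus n) g \<and> (\<forall>b. (\<forall>i\<in>{1..n}. 1 \<le> b i) \<longrightarrow>
     torus_integral n (\<lambda>z. vdm n (\<lambda>i. 1 / z i) * density z * (\<Prod>i=1..n. z i ^ b i) * g z) = 0)"

lemma base_continuous: "continuous_on (torus n) (\<lambda>z. vdm n (\<lambda>i. 1 / z i) * density z * (\<Prod>i=1..n. z i ^ b i))"
  by (intro continuous_intros vdm_inverse_continuous density_continuous coord_continuous)

lemma null_one: "null (\<lambda>_. 1)"
  using moment_zero by (auto simp: null_def moment_def)

lemma null_diff:
  assumes "null g" "null h"
  shows "null (\<lambda>z. g z - h z)"
  using assms unfolding null_def
  by (auto simp: right_diff_distrib intro!: continuous_intros) 
    (subst torus_integral_diff, auto intro!: continuous_on_mult base_continuous[simplified])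

text \<open>The Taylor series at 0 is integrated termwise: the \<open>k\<close>-th power of the
  monomial raises the exponents \<open>b i\<close> by \<open>e i * k\<close> and leaves them
  positive.\<close>

lemma null_series:
  assumes g: "null g" and h: "h holomorphic_on ball 0 R" "1 < R"
  shows "null (\<lambda>z. g z * h (\<Prod>i=1..n. z i ^ e i))"
proof -
  define m where "m z = (\<Prod>i=1..n. z i ^ e i)" for z :: "nat \<Rightarrow> complex"
  have m: "continuous_on (torus n) m"
    unfolding m_def by (intro continuous_intros coord_continuous)
  have norm_m: "norm (m z) = 1" if "z \<in> torus n" for z
    unfolding m_def prod_norm[symmetric] using that by (intro prod.neutral) (auto simp: norm_power torus_norm)
  have gc: "continuous_on (torus n) g" using g by (simp add: null_def)
  define c where "c k = (deriv ^^ k) h 0 / fact k" for k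
  have sums: "(\<lambda>k. c k * w ^ k) sums h w" if "norm w < R" for w
    using holomorphic_power_series[OF h(1), of w] that by (simp add: c_def)
  \<comment> \<open>A point strictly outside the unit circle where the series converges, which gives
    absolute summability of the coefficients.\<close>
  define x where "x = complex_of_real ((1 + R) / 2)"
  have x: "1 < norm x" "norm x < R"
    using h(2) unfolding x_def norm_of_real by (simp_all add: abs_if)
  have csum: "summable (\<lambda>k. norm (c k))"
    using powser_insidea[OF sums_summable[OF sums[OF x(2)]], of 1] x(1) by simp
  show ?thesis
    unfolding null_def m_def[symmetric]
  proof (intro conjI allI impI)
    show "continuous_on (torus n) (\<lambda>z. g z * h (m z))"
      using norm_m h(2)
      by (intro continuous_on_mult gc continuous_on_compose2[OF holomorphic_on_imp_continuous_on[OF h(1)] m]) auto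
    fix b :: "nat \<Rightarrow> nat" assume b: "\<forall>i\<in>{1..n}. 1 \<le> b i"
    define G where "G z = vdm n (\<lambda>i. 1 / z i) * density z * (\<Prod>i=1..n. z i ^ b i) * g z" for z
    have "torus_integral n (\<lambda>z. G z * h (m z)) = 0"
    proof (rule torus_integral_power_series[OF _ m norm_m csum])
      show "continuous_on (torus n) G"
        unfolding G_def by (intro continuous_on_mult base_continuous gc)
      show "h w = (\<Sum>k. c k * w ^ k)" if "norm w = 1" for w
        using sums[of w] that h(2) by (simp add: sums_iff)
      fix k
      have "torus_integral n (\<lambda>z. G z * m z ^ k) =
          torus_integral n (\<lambda>z. vdm n (\<lambda>i. 1 / z i) * density z * (\<Prod>i=1..n. z i ^ (b i + e i * k)) * g z)"
        unfolding G_def m_def power_add power_mult prod.distrib prod_power_distrib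
        by (intro torus_integral_cong) (simp only: mult_ac)
      also have "\<dots> = 0"
      proof -
        have "\<forall>i\<in>{1..n}. 1 \<le> b i + e i * k" using b by (auto intro: trans_le_add1)
        moreover have "\<forall>b. (\<forall>i\<in>{1..n}. 1 \<le> b i) \<longrightarrow>
            torus_integral n (\<lambda>z. vdm n (\<lambda>i. 1 / z i) * density z * (\<Prod>i=1..n. z i ^ b i) * g z) = 0"
          using g by (simp add: null_def)
        ultimately show ?thesis by (elim allE[of _ "\<lambda>i. b i + e i * k"] impE) auto
      qed
      finally show "torus_integral n (\<lambda>z. G z * m z ^ k) = 0" .
    qed
    then show "torus_integral n (\<lambda>z. vdm n (\<lambda>i. 1 / z i) * density z * (\<Prod>i=1..n. z i ^ b i) * (g z * h (m z))) = 0"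
      by (simp add: G_def mult_ac)
  qed
qed

lemma null_coord:
  assumes "null g" "h holomorphic_on ball 0 R" "1 < R" "j \<in> {1..n}"
  shows "null (\<lambda>z. g z * h (z j))"
proof -
  have "(\<Prod>i=1..n. z i ^ (if i = j then 1 else 0)) = z j" for z :: "nat \<Rightarrow> complex"
    using assms(4) by (subst prod.remove[of _ j]) auto
  then show ?thesis using null_series[OF assms(1-3), of "\<lambda>i. if i = j then 1 else 0"] by simp
qed

lemma null_pair:
  assumes "null g" "h holomorphic_on ball 0 R" "1 < R" "j \<in> {1..n}" "k \<in> {1..n}" "j \<noteq> k"
  shows "null (\<lambda>z. g z * h (z j * z k))"
proof -
  have "(\<Prod>i=1..n. z i ^ (if i = j \<or> i = k then 1 else 0)) = z j * z k" for z :: "nat \<Rightarrow> complex"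
  proof -
    have "(\<Prod>i=1..n. z i ^ (if i = j \<or> i = k then 1 else 0)) =
        z j * (\<Prod>i\<in>{1..n} - {j}. z i ^ (if i = j \<or> i = k then 1 else 0))"
      using assms(4) by (subst prod.remove[of _ j]) auto
    also have "(\<Prod>i\<in>{1..n} - {j}. z i ^ (if i = j \<or> i = k then 1 else 0)) = z k"
      using assms(5,6) by (subst prod.remove[of _ k]) (auto intro!: prod.neutral)
    finally show ?thesis .
  qed
  then show ?thesis using null_series[OF assms(1-3), of "\<lambda>i. if i = j \<or> i = k then 1 else 0"] by simp
qed

lemma null_prod:
  assumes "finite A" "null g" and "\<And>i g. i \<in> A \<Longrightarrow> null g \<Longrightarrow> null (\<lambda>z. g z * h i z)"
  shows "null (\<lambda>z. g z * (\<Prod>i\<in>A. h i z))"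
  using assms(1,3)
proof (induction A rule: finite_induct)
  case empty
  then show ?case using assms(2) by simp
next
  case (insert a A)
  then have "null (\<lambda>z. (g z * (\<Prod>i\<in>A. h i z)) * h a z)" by blast
  then show ?case using insert.hyps by (simp add: mult_ac)
qed

lemma null_pairprod:
  assumes "null g"
    and "\<And>j k g. j \<in> {1..n} \<Longrightarrow> k \<in> {1..n} \<Longrightarrow> j \<noteq> k \<Longrightarrow> null g \<Longrightarrow> null (\<lambda>z. g z * h z j k)"
  shows "null (\<lambda>z. g z * pairprod {1..n} (h z))"
  unfolding pairprod_def
proof (rule null_prod[OF _ assms(1)])
  fix j g assume "j \<in> {1..n}" "null g"
  then show "null (\<lambda>z. g z * (\<Prod>k\<in>{k \<in> {1..n}. j < k}. h z j k))"
    using assms(2) by (intro null_prod) auto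
qed simp

text \<open>Starting from the constant 1, the factors of the second Vandermonde product, the
  \<open>h (z i)\<close> and the \<open>g (z j * z k)\<close> are multiplied on one at a time. The
  product of the \<open>z i\<close> is the monomial with all exponents 1.\<close>

theorem kernel_integral_zero:
  assumes R: "1 < R" and h: "h holomorphic_on ball 0 R" and g: "g holomorphic_on ball 0 R"
  shows "torus_integral n (\<lambda>z. vdm n (\<lambda>i. 1 / z i) * density z * vdm n z * (\<Prod>i=1..n. z i) *
     (\<Prod>i=1..n. h (z i)) * pairprod {1..n} (\<lambda>j k. g (z j * z k))) = 0"
proof -
  have "null (\<lambda>z. 1 * vdm n z)"
    unfolding vdm_def
  proof (rule null_pairprod[OF null_one])
    fix j k g assume jk: "j \<in> {1..n}" "k \<in> {1..n}" and g: "null g"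
    have "null (\<lambda>z. g z * z k - g z * z j)"
      using null_coord[OF g, of "\<lambda>w. w" 2] jk by (intro null_diff) auto
    then show "null (\<lambda>z. g z * (z k - z j))"
      by (simp add: right_diff_distrib)
  qed
  then have "null (\<lambda>z. 1 * vdm n z * (\<Prod>i=1..n. h (z i)))"
    by (intro null_prod) (auto intro: null_coord[OF _ h R])
  then have "null (\<lambda>z. 1 * vdm n z * (\<Prod>i=1..n. h (z i)) * pairprod {1..n} (\<lambda>j k. g (z j * z k)))"
    by (intro null_pairprod) (auto intro: null_pair[OF _ g R])
  then have "torus_integral n (\<lambda>z. vdm n (\<lambda>i. 1 / z i) * density z * (\<Prod>i=1..n. z i ^ 1) *
     (1 * vdm n z * (\<Prod>i=1..n. h (z i)) * pairprod {1..n} (\<lambda>j k. g (z j * z k)))) = 0"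
    unfolding null_def by (elim conjE allE[of _ "\<lambda>_. 1"] impE) auto
  then show ?thesis by (simp add: mult_ac)
qed

end

subsection \<open>Zeros of the integral as a function of v\<close>

lemma prod_1_2: "(\<Prod>j=1..(2::nat). f j) = f 1 * f 2"
  by (simp add: numeral_2_eq_2)

lemma prod_3_6: "(\<Prod>j=3..(6::nat). f j) = f 3 * f 4 * f 5 * f 6"
  by (simp add: numeral_eq_Suc mult_ac)

lemma prod_1_5: "(\<Prod>j=1..(5::nat). f j) = f 1 * f 2 * f 3 * f 4 * f 5"
  by (simp add: numeral_eq_Suc mult_ac)

lemma prod_pairs_eq: "(\<Prod>j=1..n. \<Prod>k\<in>{j<..n}. F j k) = pairprod {1..n} F"
  unfolding pairprod_def by (intro prod.cong) auto

context nome
begin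

lemma degree_prod_linear_le: "degree (\<Prod>i<m. [:1, c i :: complex:]) \<le> m"
proof -
  have "degree (\<Prod>i<m. [:1, c i:]) \<le> sum (degree \<circ> (\<lambda>i. [:1, c i:])) {..<m}"
    by (rule degree_prod_sum_le) simp
  also have "\<dots> \<le> (\<Sum>i<m. 1)"
    by (intro sum_mono) simp
  finally show ?thesis by simp
qed

text \<open>Replacing \<open>x\<close> by \<open>t * x\<close> shifts the index of the product by
  one, so both sides are the same product of \<open>m + 1\<close> linear factors.\<close>

lemma poly_prod_linear_scale:
  fixes x :: complex
  shows "(1 - b * x) * poly (\<Prod>i<m. [:1, - (b * t ^ i):]) (t * x) =
         (1 - b * t ^ m * x) * poly (\<Prod>i<m. [:1, - (b * t ^ i):]) x"
proof -
  have "(1 - b * x) * poly (\<Prod>i<m. [:1, - (b * t ^ i):]) (t * x) = (\<Prod>i<Suc m. 1 - b * t ^ i * x)"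
    unfolding prod.lessThan_Suc_shift poly_prod by (simp add: mult_ac)
  also have "\<dots> = (1 - b * t ^ m * x) * poly (\<Prod>i<m. [:1, - (b * t ^ i):]) x"
    by (simp add: poly_prod mult_ac)
  finally show ?thesis .
qed

text \<open>For this \<open>v\<close> the theta factors become multiples of
  \<open>th (c1 / z i)\<close> and \<open>th (c2 / z i)\<close>. Their halves in
  \<open>1 / z i\<close>, over the denominators in \<open>1 / z i\<close>, form \<open>ker\<close>;
  everything else in one variable is holomorphic in \<open>z i\<close> and goes into
  \<open>h\<close>. The polynomials \<open>p1\<close> and \<open>p2\<close> encode the
  \<open>m\<close> and \<open>n - 1 - m\<close> kernel variables built from \<open>a 1\<close> and
  \<open>a 2\<close>.\<close>

lemma J_vanishes_1:
  assumes n: "m < n" and t: "t \<noteq> 0" "norm t < 1"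
    and a: "\<And>i. i \<in> {1..6} \<Longrightarrow> a i \<noteq> 0 \<and> norm (a i) < 1"
  shows "torus_integral n (J_integrand n q t (1 / (a 1 * t ^ m)) a) = 0"
proof -
  define r where "r = Max (insert (norm t) ((\<lambda>i. norm (a i)) ` {1..6}))"
  have r: "norm t \<le> r" "r < 1" and ar: "\<And>i. i \<in> {1..6} \<Longrightarrow> norm (a i) \<le> r"
    using t a unfolding r_def by (simp, simp, intro Max_ge) auto
  have r0: "0 < r" using r t by (meson less_le_trans zero_less_norm_iff)
  define c1 where "c1 = a 1 * t ^ m"
  define c2 where "c2 = a 2 * t ^ (n - 1 - m)"
  have a12: "a 1 \<noteq> 0" "a 2 \<noteq> 0" "norm (a 1) \<le> r" "norm (a 2) \<le> r"
    using a[of 1] a[of 2] ar[of 1] ar[of 2] by auto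
  have cnz: "c1 \<noteq> 0" "c2 \<noteq> 0" using a12 t by (auto simp: c1_def c2_def)
  have cr: "norm c1 \<le> r" "norm c2 \<le> r"
  proof -
    have "norm (x * t ^ k) \<le> r" if "norm x \<le> r" for x k
    proof -
      have "norm (x * t ^ k) \<le> r * 1"
        unfolding norm_mult norm_power using that t r0 by (intro mult_mono power_le_one) auto
      then show ?thesis by simp
    qed
    then show "norm c1 \<le> r" "norm c2 \<le> r" using a12 by (auto simp: c1_def c2_def)
  qed
  have small: "qp (c * w) \<noteq> 0" if "norm c \<le> r" "norm w < 1 / r" for c w
  proof -
    have "norm (c * w) \<le> r * norm w"
      unfolding norm_mult using that by (intro mult_right_mono) auto
    also have "\<dots> < 1" using that r0 by (simp add: pos_less_divide_eq mult.commute)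
    finally show ?thesis by (rule qp_nonzero)
  qed
  have lin: "1 - c * x \<noteq> 0" if "norm c \<le> r" "norm x = 1" for c x :: complex
  proof -
    have "norm (c * x) = norm c" using that by (simp add: norm_mult)
    also have "\<dots> < 1" using that(1) r(2) by linarith
    finally show ?thesis by auto
  qed
  have R: "1 < 1 / r" using r0 r by simp
  define ker where "ker x = qp (c1 * x) * qp (c2 * x) / (qp (a 1 * x) * qp (a 2 * x))" for x
  define f where "f x = (1 - a 1 * x) * (1 - a 2 * x) / ((1 - c1 * x) * (1 - c2 * x))" for x
  define p1 where "p1 = (\<Prod>i<m. [:1, - (a 1 * t ^ i):])"
  define p2 where "p2 = (\<Prod>i<n - 1 - m. [:1, - (a 2 * t ^ i):])"
  interpret kernel q n t r ker f "p1 * p2"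
  proof
    show "ker holomorphic_on ball 0 (1 / r)"
      unfolding ker_def using small[OF a12(3)] small[OF a12(4)] by (intro holomorphic_intros) auto
    show "ker (q * x) = f x * ker x" if x: "norm x = 1" for x
    proof -
      have "norm x < 1 / r" using x R by simp
      note nz = small[OF a12(3) this] small[OF a12(4) this] lin[OF a12(3) x] lin[OF a12(4) x]
        lin[OF cr(1) x] lin[OF cr(2) x]
      have rec: "qp (c * x) = (1 - c * x) * qp (c * (q * x))" for c
        using qp_rec[of "c * x"] by (simp add: mult_ac)
      show ?thesis
        using nz unfolding ker_def f_def rec[of "a 1"] rec[of "a 2"] rec[of c1] rec[of c2]
        by (simp add: divide_simps)
    qed
    have "degree (p1 * p2) \<le> degree p1 + degree p2" by (rule degree_mult_le)
    also have "degree p1 \<le> m"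
      unfolding p1_def by (rule degree_prod_linear_le)
    also have "degree p2 \<le> n - 1 - m"
      unfolding p2_def by (rule degree_prod_linear_le)
    also have "m + (n - 1 - m) < n" using n by simp
    finally show "degree (p1 * p2) < n" by simp
    show "coeff (p1 * p2) 0 \<noteq> 0"
      by (simp add: p1_def p2_def poly_prod flip: poly_0_coeff_0)
    show "poly (p1 * p2) x = f x * poly (p1 * p2) (t * x)" if x: "norm x = 1" for x
    proof -
      note nz = lin[OF cr(1) x] lin[OF cr(2) x]
      have "(1 - a 1 * x) * poly p1 (t * x) = (1 - c1 * x) * poly p1 x"
        "(1 - a 2 * x) * poly p2 (t * x) = (1 - c2 * x) * poly p2 x"
        unfolding p1_def p2_def c1_def c2_def by (rule poly_prod_linear_scale)+
      then have "(1 - c1 * x) * (1 - c2 * x) * (poly p1 x * poly p2 x) =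
          (1 - a 1 * x) * (1 - a 2 * x) * (poly p1 (t * x) * poly p2 (t * x))"
        by (metis mult.assoc mult.left_commute)
      then show ?thesis using nz by (simp add: f_def nonzero_eq_divide_eq mult_ac)
    qed
  qed (use t r in auto)
  \<comment> \<open>The factor \<open>- 1 / c1\<close> arises from turning
    \<open>th (z i / c1)\<close> into \<open>th (c1 / z i)\<close>. This inversion also releases the
    factor \<open>z i\<close> that makes the exponents of all monomials positive.\<close>
  define h where "h w = (1 - w\<^sup>2) * (- 1 / c1) * qp (q / c1 * w) * qp (q / c2 * w) / (qp (a 1 * w) * qp (a 2 * w)) *
     (\<Prod>k=3..6. qp (q / a k * w) / qp (a k * w))" for w
  define g where "g w = (1 - w) * (qp (q / t * w) / qp (t * w))" for w
  have h: "h holomorphic_on ball 0 (1 / r)"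
    unfolding h_def using small ar a12 cnz a
    by (intro holomorphic_intros) auto
  have g: "g holomorphic_on ball 0 (1 / r)"
    unfolding g_def using small[OF r(1)] t by (intro holomorphic_intros) auto
  have "torus_integral n (J_integrand n q t (1 / (a 1 * t ^ m)) a) =
     torus_integral n (\<lambda>z. vdm n (\<lambda>i. 1 / z i) * density z * vdm n z * (\<Prod>i=1..n. z i) *
     (\<Prod>i=1..n. h (z i)) * pairprod {1..n} (\<lambda>j k. g (z j * z k)))"
  proof (rule torus_integral_cong)
    fix z assume z: "z \<in> torus n"
    have tpow: "t ^ (n - 1) = t ^ m * t ^ (n - 1 - m)" using n by (simp flip: power_add)
    have single: "qpoch_quot ((z i)\<^sup>2) q *
        (th (t ^ (n - 1) * a 1 * a 2 * (1 / (a 1 * t ^ m)) / z i) * th (1 / (a 1 * t ^ m) * z i) /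
           (\<Prod>j=1..2. qp (a j * z i) * qp (a j / z i))) *
        (\<Prod>k=3..6. qp (q / a k * z i) / qp (a k * z i)) = ker (1 / z i) * z i * h (z i)"
      if i: "i \<in> {1..n}" for i
    proof -
      have zi: "z i \<noteq> 0" using torus_nonzero[OF z i] .
      have "t ^ (n - 1) * a 1 * a 2 * (1 / (a 1 * t ^ m)) / z i = c2 / z i"
        unfolding c2_def tpow using a12 t by (simp add: mult_ac)
      moreover have "th (1 / (a 1 * t ^ m) * z i) = - (z i / c1) * th (c1 / z i)"
        using th_inverse[of "c1 / z i"] zi cnz by (simp add: c1_def mult.commute)
      ultimately show ?thesis
        unfolding prod_1_2 h_def ker_def qpoch_quot_def using zi
        by (simp add: theta_def mult_ac)
    qed
    have pair: "qpoch_quot (z j * z k) q *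
        (qp (z j / z k) * qp (z k / z j) / (qp (t * z j / z k) * qp (t * z k / z j))) *
        (qp (q / t * z j * z k) / qp (t * z j * z k)) =
        (1 / z k - 1 / z j) * pair_weight (z j / z k) * (z k - z j) * g (z j * z k)"
      if "j \<in> {1..n}" "k \<in> {1..n}" for j k
    proof -
      have nz: "z j \<noteq> 0" "z k \<noteq> 0" using torus_nonzero[OF z] that by auto
      have "qp (z j / z k) * qp (z k / z j) = (1 - z j / z k) * (1 - z k / z j) * (qp (q * (z j / z k)) * qp (q * (z k / z j)))"
        using qp_rec[of "z j / z k"] qp_rec[of "z k / z j"] by simp
      also have "(1 - z j / z k) * (1 - z k / z j) = (1 / z k - 1 / z j) * (z k - z j)"
        using nz by (simp add: field_simps)
      finally have "qp (z j / z k) * qp (z k / z j) =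
        (1 / z k - 1 / z j) * (z k - z j) * (qp (q * (z j / z k)) * qp (q * (z k / z j)))" .
      then show ?thesis
        by (simp add: pair_weight_def g_def qpoch_quot_def mult_ac)
    qed
    have "J_integrand n q t (1 / (a 1 * t ^ m)) a z =
       (\<Prod>i=1..n. ker (1 / z i) * z i * h (z i)) *
       pairprod {1..n} (\<lambda>j k. (1 / z k - 1 / z j) * pair_weight (z j / z k) * (z k - z j) * g (z j * z k))"
      unfolding J_integrand_def prod_pairs_eq
      by (intro arg_cong2[of _ _ _ _ "(*)"] prod.cong refl pairprod_cong single pair)
    then show "J_integrand n q t (1 / (a 1 * t ^ m)) a z = vdm n (\<lambda>i. 1 / z i) * density z * vdm n z * (\<Prod>i=1..n. z i) *
     (\<Prod>i=1..n. h (z i)) * pairprod {1..n} (\<lambda>j k. g (z j * z k))"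
      by (simp add: pairprod_mult prod.distrib vdm_def density_def mult_ac)
  qed
  also have "\<dots> = 0" by (rule kernel_integral_zero[OF R h g])
  finally show ?thesis .
qed

text \<open>The integrand is symmetric in \<open>a 1\<close> and \<open>a 2\<close>, so exchanging
  them reduces the second family of points to the first.\<close>

lemma J_vanishes:
  assumes n: "m < n" and t: "t \<noteq> 0" "norm t < 1"
    and a: "\<And>i. i \<in> {1..6} \<Longrightarrow> a i \<noteq> 0 \<and> norm (a i) < 1" and l: "l \<in> {1..2}"
  shows "torus_integral n (J_integrand n q t (1 / (a l * t ^ m)) a) = 0"
proof (cases "l = 1")
  case True
  then show ?thesis using J_vanishes_1[OF n t a] by simp
next
  case False
  then have l: "l = 2" using l by auto
  define b where "b = a(1 := a 2, 2 := a 1)"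
  have "J_integrand n q t v a = J_integrand n q t v b" for v
    unfolding J_integrand_def[abs_def] prod_1_2 prod_3_6 b_def by (simp add: mult_ac)
  moreover have "torus_integral n (J_integrand n q t (1 / (b 1 * t ^ m)) b) = 0"
    using a by (intro J_vanishes_1[OF n t]) (auto simp: b_def)
  ultimately show ?thesis by (simp add: l b_def)
qed

end

subsection \<open>Regularity of the integrands\<close>

text \<open>Bounds on absolute values that keep the denominators of both integrands away from zero
  at \<open>z\<close>. They are stated for points that need not lie on the torus, because
  \<open>J_sum_flip\<close> perturbs the radii of the coordinates.\<close>

definition admissible :: "nat \<Rightarrow> complex \<Rightarrow> (nat \<Rightarrow> complex) \<Rightarrow> (nat \<Rightarrow> complex) \<Rightarrow> bool" where
  "admissible n t a z \<longleftrightarrow> t \<noteq> 0 \<and> (\<forall>k\<in>{1..6}. a k \<noteq> 0) \<and>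
     (\<forall>i\<in>{1..n}. z i \<noteq> 0 \<and> (\<forall>k\<in>{1..6}. norm (a k * z i) < 1 \<and> norm (a k / z i) < 1)) \<and>
     (\<forall>j\<in>{1..n}. \<forall>k\<in>{1..n}. norm (t * z j / z k) < 1 \<and> norm (t * z j * z k) < 1 \<and> norm (t / (z j * z k)) < 1)"

text \<open>Arguments with one coordinate are bounded by \<open>r * c\<close> and those with two by
  \<open>r * c\<^sup>2\<close>, which is the larger bound since \<open>c\<close> is at least
  1.\<close>

lemma admissible_near_torus:
  assumes "t \<noteq> 0" "norm t \<le> r" and a: "\<And>k. k \<in> {1..6} \<Longrightarrow> a k \<noteq> 0 \<and> norm (a k) \<le> r"
    and c: "1 \<le> c" "r * c\<^sup>2 < 1" and z: "\<And>i. i \<in> {1..n} \<Longrightarrow> z i \<noteq> 0 \<and> norm (z i) \<le> c \<and> norm (1 / z i) \<le> c"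
  shows "admissible n t a z"
proof -
  have r0: "0 \<le> r" using assms(2) norm_ge_zero order_trans by blast
  have "c \<le> c\<^sup>2" using c by (simp add: power2_eq_square)
  then have rc: "r * c < 1" using c r0 mult_left_mono[of c "c\<^sup>2" r] by linarith
  have one: "norm (x * y) < 1" if "norm x \<le> r" "norm y \<le> c" for x y :: complex
  proof -
    have "norm (x * y) \<le> r * c" unfolding norm_mult using that r0 by (intro mult_mono) auto
    then show ?thesis using rc by simp
  qed
  have two: "norm (t * x * y) < 1" if "norm x \<le> c" "norm y \<le> c" for x y
  proof -
    have "norm (t * x * y) \<le> r * c * c"
      unfolding norm_mult using that r0 c assms(2) by (intro mult_mono) auto
    then show ?thesis using c by (simp add: power2_eq_square mult.assoc)
  qed
  have "norm (a k * z i) < 1 \<and> norm (a k / z i) < 1" if "k \<in> {1..6}" "i \<in> {1..n}" for k i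
    using one[of "a k" "z i"] one[of "a k" "1 / z i"] a[OF that(1)] z[OF that(2)] by simp
  moreover have "norm (t * z j / z k) < 1 \<and> norm (t * z j * z k) < 1 \<and> norm (t / (z j * z k)) < 1"
    if "j \<in> {1..n}" "k \<in> {1..n}" for j k
    using two[of "z j" "1 / z k"] two[of "z j" "z k"] two[of "1 / z j" "1 / z k"] z[OF that(1)] z[OF that(2)] by simp
  ultimately show ?thesis
    unfolding admissible_def using assms z by blast
qed

lemma admissible_torus:
  assumes "t \<noteq> 0" "norm t < 1" and a: "\<And>k. k \<in> {1..6} \<Longrightarrow> a k \<noteq> 0 \<and> norm (a k) < 1"
    and z: "z \<in> torus n"
  shows "admissible n t a z"
proof -
  define r where "r = Max (insert (norm t) ((\<lambda>i. norm (a i)) ` {1..6}))"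
  have "r < 1" "norm t \<le> r" using assms by (auto simp: r_def)
  moreover have "norm (a k) \<le> r" if "k \<in> {1..6}" for k
    unfolding r_def using that by (intro Max_ge) auto
  ultimately show ?thesis
    using assms torus_norm[OF z] torus_nonzero[OF z]
    by (intro admissible_near_torus[of t r a 1]) (auto simp: norm_divide)
qed

lemma J_integrand_cong:
  assumes "\<And>i. i \<in> {1..n} \<Longrightarrow> z i = z' i"
  shows "J_integrand n q t v a z = J_integrand n q t v a z'"
  unfolding J_integrand_def prod_pairs_eq using assms
  by (intro arg_cong2[of _ _ _ _ "(*)"] prod.cong pairprod_cong) auto

context nome
begin

lemma admissible_denominators:
  assumes "admissible n t a z" "i \<in> {1..n}" "k \<in> {1..6}"
  shows "qp (a k * z i) \<noteq> 0" "qp (a k / z i) \<noteq> 0" "z i \<noteq> 0" "a k \<noteq> 0"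
  using assms qp_nonzero unfolding admissible_def by blast+

lemma admissible_pair_denominators:
  assumes "admissible n t a z" "j \<in> {1..n}" "k \<in> {1..n}"
  shows "qp (t * z j / z k) \<noteq> 0" "qp (t * z j * z k) \<noteq> 0" "qp (t / (z j * z k)) \<noteq> 0" "t \<noteq> 0"
  using assms qp_nonzero unfolding admissible_def by blast+

lemma J_integrand_continuous:
  fixes X :: "'a :: topological_space set"
  assumes t: "continuous_on X t" and v: "continuous_on X v"
    and a: "\<And>k. k \<in> {1..6} \<Longrightarrow> continuous_on X (\<lambda>x. a x k)"
    and z: "\<And>i. i \<in> {1..n} \<Longrightarrow> continuous_on X (\<lambda>x. z x i)"
    and adm: "\<And>x. x \<in> X \<Longrightarrow> admissible n (t x) (a x) (z x)" and vnz: "\<And>x. x \<in> X \<Longrightarrow> v x \<noteq> 0"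
  shows "continuous_on X (\<lambda>x. J_integrand n q (t x) (v x) (a x) (z x))"
proof -
  note den = admissible_denominators[OF adm] admissible_pair_denominators[OF adm]
  have nz: "t x \<noteq> 0 \<and> a x 1 \<noteq> 0 \<and> a x 2 \<noteq> 0" if "x \<in> X" for x
    using adm[OF that] by (auto simp: admissible_def)
  have single: "continuous_on X (\<lambda>x. qpoch_quot ((z x i)\<^sup>2) q *
        (th (t x ^ (n - 1) * a x 1 * a x 2 * v x / z x i) * th (v x * z x i) /
           (\<Prod>j=1..2. qp (a x j * z x i) * qp (a x j / z x i))) *
        (\<Prod>k=3..6. qp (q / a x k * z x i) / qp (a x k * z x i)))" if "i \<in> {1..n}" for i
  proof -
    have d: "qp (a x k * z x i) \<noteq> 0" "qp (a x k / z x i) \<noteq> 0" "z x i \<noteq> 0" "a x k \<noteq> 0"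
      if "x \<in> X" "k \<in> {1..6}" for x k
      using den(1-4)[OF that(1) \<open>i \<in> {1..n}\<close> that(2)] by auto
    have d0: "z x i \<noteq> 0" "t x \<noteq> 0" "v x \<noteq> 0" if "x \<in> X" for x
      using d(3)[OF that, of 1] nz[OF that] vnz[OF that] by auto
    show ?thesis
      unfolding qpoch_quot_def prod_1_2 prod_3_6
      by (intro continuous_intros t v a z that; simp add: d d0)
  qed
  have pair: "continuous_on X (\<lambda>x. qpoch_quot (z x j * z x k) q *
        (qp (z x j / z x k) * qp (z x k / z x j) / (qp (t x * z x j / z x k) * qp (t x * z x k / z x j))) *
        (qp (q / t x * z x j * z x k) / qp (t x * z x j * z x k)))" if "j \<in> {1..n}" "k \<in> {1..n}" for j k
  proof -
    have d: "qp (t x * z x j / z x k) \<noteq> 0" "qp (t x * z x k / z x j) \<noteq> 0" "qp (t x * z x j * z x k) \<noteq> 0"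
      "t x \<noteq> 0" "z x j \<noteq> 0" "z x k \<noteq> 0" if "x \<in> X" for x
      using den(5-8)[OF that] den(3)[OF that, of _ 1] \<open>j \<in> {1..n}\<close> \<open>k \<in> {1..n}\<close> by auto
    show ?thesis
      unfolding qpoch_quot_def by (intro continuous_intros t z that; simp add: d)
  qed
  show ?thesis
    unfolding J_integrand_def prod_pairs_eq by (rule continuous_on_mult, rule continuous_on_prod, erule single, rule continuous_on_pairprod, erule (1) pair)
qed

lemma I_integrand_continuous:
  fixes X :: "'a :: topological_space set"
  assumes t: "continuous_on X t"
    and a: "\<And>k. k \<in> {1..6} \<Longrightarrow> continuous_on X (\<lambda>x. a x k)"
    and z: "\<And>i. i \<in> {1..n} \<Longrightarrow> continuous_on X (\<lambda>x. z x i)"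
    and adm: "\<And>x. x \<in> X \<Longrightarrow> admissible n (t x) (a x) (z x)"
  shows "continuous_on X (\<lambda>x. I_integrand n q (t x) (a x) (z x))"
proof -
  note den = admissible_denominators[OF adm] admissible_pair_denominators[OF adm]
  have single: "continuous_on X (\<lambda>x. qp ((z x i)\<^sup>2) * qp (1 / (z x i)\<^sup>2) * qp (q / a x 6 * z x i) * qp (q / a x 6 / z x i) /
        (\<Prod>m=1..5. qp (a x m * z x i) * qp (a x m / z x i)))" if "i \<in> {1..n}" for i
  proof -
    have d: "qp (a x k * z x i) \<noteq> 0" "qp (a x k / z x i) \<noteq> 0" "z x i \<noteq> 0" "a x k \<noteq> 0"
      if "x \<in> X" "k \<in> {1..6}" for x k
      using den(1-4)[OF that(1) \<open>i \<in> {1..n}\<close> that(2)] by auto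
    have d0: "z x i \<noteq> 0" if "x \<in> X" for x using d(3)[OF that, of 1] by auto
    show ?thesis
      unfolding prod_1_5 by (intro continuous_intros t a z that; simp add: d d0)
  qed
  have pair: "continuous_on X (\<lambda>x. (qp (z x j / z x k) * qp (z x k / z x j) *
         qp (z x j * z x k) * qp (1 / (z x j * z x k))) /
        (qp (t x * z x j / z x k) * qp (t x * z x k / z x j) *
         qp (t x * z x j * z x k) * qp (t x / (z x j * z x k))))" if "j \<in> {1..n}" "k \<in> {1..n}" for j k
  proof -
    have d: "qp (t x * z x j / z x k) \<noteq> 0" "qp (t x * z x k / z x j) \<noteq> 0" "qp (t x * z x j * z x k) \<noteq> 0"
      "qp (t x / (z x j * z x k)) \<noteq> 0" "z x j \<noteq> 0" "z x k \<noteq> 0" if "x \<in> X" for x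
      using den(5-8)[OF that] den(3)[OF that, of _ 1] \<open>j \<in> {1..n}\<close> \<open>k \<in> {1..n}\<close> by auto
    show ?thesis
      by (intro continuous_intros t z that; simp add: d)
  qed
  show ?thesis
    unfolding I_integrand_def prod_pairs_eq by (rule continuous_on_mult, rule continuous_on_prod, erule single, rule continuous_on_pairprod, erule (1) pair)
qed

subsection \<open>Dependence on v\<close>

lemma J_integrand_holomorphic:
  assumes adm: "admissible n t a z"
  shows "(\<lambda>v. J_integrand n q t v a z) holomorphic_on - {0}"
proof -
  have nz: "t \<noteq> 0" "a 1 \<noteq> 0" "a 2 \<noteq> 0" "\<And>i. i \<in> {1..n} \<Longrightarrow> z i \<noteq> 0"
    using adm by (auto simp: admissible_def)
  note den = admissible_denominators[OF adm]
  show ?thesis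
    unfolding J_integrand_def
    by (intro holomorphic_intros) (use den nz in auto)
qed

text \<open>\<open>v\<close> occurs with \<open>z i\<close> in one theta factor and with
  \<open>1 / z i\<close> in the other, so \<open>z i\<close> cancels from the multiplier, which can
  then leave the integral.\<close>

lemma J_integrand_q:
  assumes adm: "admissible n t a z" and v: "v \<noteq> 0"
  shows "J_integrand n q t (q * v) a z = (1 / (t ^ (n - 1) * a 1 * a 2 * v\<^sup>2)) ^ n * J_integrand n q t v a z"
proof -
  let ?c = "t ^ (n - 1) * a 1 * a 2"
  have nz: "t \<noteq> 0" "a 1 \<noteq> 0" "a 2 \<noteq> 0" "\<And>i. i \<in> {1..n} \<Longrightarrow> z i \<noteq> 0"
    using adm by (auto simp: admissible_def)
  have "th (?c * (q * v) / z i) * th (q * v * z i) = 1 / (?c * v\<^sup>2) * (th (?c * v / z i) * th (v * z i))"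
    if "i \<in> {1..n}" for i
    using th_q[of "?c * v / z i"] th_q[of "v * z i"] nz(1-3) nz(4)[OF that] v
    by (simp add: mult_ac power2_eq_square)
  then have "(\<Prod>i=1..n. qpoch_quot ((z i)\<^sup>2) q *
        (th (?c * (q * v) / z i) * th (q * v * z i) / (\<Prod>j=1..2. qp (a j * z i) * qp (a j / z i))) *
        (\<Prod>k=3..6. qp (q / a k * z i) / qp (a k * z i))) =
     (\<Prod>i=1..n. 1 / (?c * v\<^sup>2) * (qpoch_quot ((z i)\<^sup>2) q *
        (th (?c * v / z i) * th (v * z i) / (\<Prod>j=1..2. qp (a j * z i) * qp (a j / z i))) *
        (\<Prod>k=3..6. qp (q / a k * z i) / qp (a k * z i))))"
    by (intro prod.cong refl) (simp only: mult_ac times_divide_eq_left times_divide_eq_right)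
  then show ?thesis
    unfolding J_integrand_def prod.distrib[of "\<lambda>_. 1 / (?c * v\<^sup>2)"] by (simp only: prod_constant card_atLeastAtMost diff_Suc_1 mult.assoc)
qed

definition v_product :: "nat \<Rightarrow> complex \<Rightarrow> (nat \<Rightarrow> complex) \<Rightarrow> complex \<Rightarrow> complex" where
  "v_product n t a v = (\<Prod>i=1..n. \<Prod>l=1..2. th (t ^ (i - 1) * a l * v))"

text \<open>The multiplier agrees with that of the integrand because the sum of the
  \<open>2 * (i - 1)\<close> over \<open>i\<close> up to \<open>n\<close> is
  \<open>n * (n - 1)\<close>.\<close>

lemma v_product_q:
  assumes nz: "t \<noteq> 0" "a 1 \<noteq> 0" "a 2 \<noteq> 0" "v \<noteq> 0"
  shows "v_product n t a (q * v) = (1 / (t ^ (n - 1) * a 1 * a 2 * v\<^sup>2)) ^ n * v_product n t a v"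
proof -
  have "v_product n t a (q * v) = (\<Prod>i=1..n. 1 / ((t ^ (i - 1))\<^sup>2 * (a 1 * a 2 * v\<^sup>2)) * (\<Prod>l=1..2. th (t ^ (i - 1) * a l * v)))"
    unfolding v_product_def prod_1_2
  proof (intro prod.cong refl)
    fix i
    have "th (t ^ (i - 1) * b * (q * v)) = - th (t ^ (i - 1) * b * v) / (t ^ (i - 1) * b * v)" if "b \<noteq> 0" for b
      using th_q[of "t ^ (i - 1) * b * v"] that nz by (simp add: mult_ac)
    from this[OF nz(2)] this[OF nz(3)]
    show "th (t ^ (i - 1) * a 1 * (q * v)) * th (t ^ (i - 1) * a 2 * (q * v)) =
       1 / ((t ^ (i - 1))\<^sup>2 * (a 1 * a 2 * v\<^sup>2)) * (th (t ^ (i - 1) * a 1 * v) * th (t ^ (i - 1) * a 2 * v))"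
      using nz by (simp add: power2_eq_square mult_ac)
  qed
  also have "\<dots> = (\<Prod>i=1..n. 1 / ((t ^ (i - 1))\<^sup>2 * (a 1 * a 2 * v\<^sup>2))) * v_product n t a v"
    by (simp only: prod.distrib v_product_def)
  also have "(\<Prod>i=1..n. 1 / ((t ^ (i - 1))\<^sup>2 * (a 1 * a 2 * v\<^sup>2))) = (1 / (t ^ (n - 1) * a 1 * a 2 * v\<^sup>2)) ^ n"
  proof -
    have "(\<Prod>i=1..n. (t ^ (i - 1))\<^sup>2) = (t ^ (n - 1)) ^ n"
    proof (induction n)
      case (Suc n)
      have "(\<Prod>i=1..Suc n. (t ^ (i - 1))\<^sup>2) = (t ^ (n - 1)) ^ n * (t ^ n)\<^sup>2"
        using Suc.IH by simp
      also have "\<dots> = t ^ ((n - 1) * n + n * 2)"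
        by (simp add: power_add power_mult)
      also have "(n - 1) * n + n * 2 = n * Suc n"
        by (cases n) auto
      finally show ?case by (simp only: power_mult diff_Suc_1)
    qed simp
    then show ?thesis
      by (simp add: prod_dividef prod.distrib power_divide power_mult_distrib mult.assoc)
  qed
  finally show ?thesis .
qed

text \<open>The assumption \<open>gen\<close> excludes common zeros of two of the
  \<open>2 * n\<close> theta factors of \<open>v_product\<close>, so all its zeros are simple and
  \<open>quasi_periodic_proportional\<close> applies.\<close>

lemma J_proportional:
  assumes t: "t \<noteq> 0" "norm t < 1"
    and a: "\<And>i. i \<in> {1..6} \<Longrightarrow> a i \<noteq> 0 \<and> norm (a i) < 1"
    and gen: "\<And>i j k l. i \<in> {1..n} \<Longrightarrow> j \<in> {1..n} \<Longrightarrow> k \<in> {1..2} \<Longrightarrow> l \<in> {1..2} \<Longrightarrow> (i, k) \<noteq> (j, l) \<Longrightarrow>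
       th (t ^ (i - 1) * a k / (t ^ (j - 1) * a l)) \<noteq> 0"
  obtains C where "\<And>v. v \<noteq> 0 \<Longrightarrow> torus_integral n (J_integrand n q t v a) = C * v_product n t a v"
proof -
  define A where "A v = torus_integral n (J_integrand n q t v a)" for v
  have a12: "a l \<noteq> 0" if "l \<in> {1..2}" for l using a[of l] that by auto
  have adm: "admissible n t a z" if "z \<in> torus n" for z
    by (rule admissible_torus[OF t a that])
  have Aq: "A (q * v) = (1 / (t ^ (n - 1) * a 1 * a 2 * v\<^sup>2)) ^ n * A v" if "v \<noteq> 0" for v
    unfolding A_def torus_integral_cmult[symmetric] using J_integrand_q[OF adm that]
    by (intro torus_integral_cong) auto
  have "\<exists>C. \<forall>v. v \<noteq> 0 \<longrightarrow> A v = C * v_product n t a v"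
  proof (rule quasi_periodic_proportional)
    show "A holomorphic_on - {0}"
      unfolding A_def
    proof (rule torus_integral_holomorphic)
      show "continuous_on ((- {0}) \<times> torus n) (\<lambda>(v, z). J_integrand n q t v a z)"
        unfolding case_prod_unfold
        by (intro J_integrand_continuous continuous_intros
            continuous_on_product_then_coordinatewise[OF continuous_on_snd[OF continuous_on_id]]) (use adm in auto)
    qed (use adm J_integrand_holomorphic in auto)
    show "v_product n t a holomorphic_on - {0}"
      unfolding v_product_def using t a12 by (intro holomorphic_intros) auto
    have "simple_zeros (\<lambda>v. \<Prod>x\<in>{1..n} \<times> {1..2}. th (t ^ (fst x - 1) * a (snd x) * v))"
    proof (rule simple_zeros_prod)
      fix x y v assume *: "x \<in> {1..n} \<times> {1..2}" "y \<in> {1..n} \<times> {1..2 :: nat}" "x \<noteq> y" "v \<noteq> (0 :: complex)"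
        "th (t ^ (fst x - 1) * a (snd x) * v) = 0"
      show "th (t ^ (fst y - 1) * a (snd y) * v) \<noteq> 0"
      proof
        assume "th (t ^ (fst y - 1) * a (snd y) * v) = 0"
        then have "th (t ^ (fst x - 1) * a (snd x) * v / (t ^ (fst y - 1) * a (snd y) * v)) = 0"
          using * t a12 by (intro th_zero_div) auto
        then show False
          using gen[of "fst x" "fst y" "snd x" "snd y"] * by (auto simp: prod_eq_iff)
      qed
    qed (use t a12 in \<open>auto intro!: holomorphic_intros simple_zeros_th_scale\<close>)
    then show "simple_zeros (v_product n t a)"
      by (simp add: v_product_def[abs_def] prod.cartesian_product case_prod_unfold)
    show "A v = 0" if v: "v \<noteq> 0" "v_product n t a v = 0" for v
    proof -
      obtain i l where il: "i \<in> {1..n}" "l \<in> {1..2}" "th (t ^ (i - 1) * a l * v) = 0"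
        using v(2) by (auto simp: v_product_def prod_zero_iff)
      have nz: "t ^ (i - 1) * a l \<noteq> 0" using t a12[OF il(2)] by simp
      obtain j where "t ^ (i - 1) * a l * v = q powi j"
        using il(3) nz v(1) by (auto simp: th_eq_0_iff)
      then have vj: "v = q powi j * (1 / (a l * t ^ (i - 1)))"
        using nz by (simp add: field_simps)
      \<comment> \<open>A zero of \<open>v_product\<close> differs by a power of \<open>q\<close>
        from a point treated in \<open>J_vanishes\<close>.\<close>
      have "A (q powi j * (1 / (a l * t ^ (i - 1)))) = 0 \<longleftrightarrow> A (1 / (a l * t ^ (i - 1))) = 0"
      proof (rule quasi_periodic_zero)
        fix w :: complex assume "w \<noteq> 0"
        then show "\<exists>m. m \<noteq> 0 \<and> A (q * w) = m * A w"
          using Aq t a12[of 1] a12[of 2]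
          by (intro exI[of _ "(1 / (t ^ (n - 1) * a 1 * a 2 * w\<^sup>2)) ^ n"]) auto
      qed (use nz in auto)
      moreover have "i - 1 < n" using il(1) by auto
      then have "A (1 / (a l * t ^ (i - 1))) = 0"
        unfolding A_def by (intro J_vanishes t a il(2))
      ultimately show ?thesis by (simp add: vj)
    qed
    show "(1 / (t ^ (n - 1) * a 1 * a 2 * v\<^sup>2)) ^ n \<noteq> 0" if "v \<noteq> 0" for v
      using that t a12[of 1] a12[of 2] by simp
    show "A (q * v) = (1 / (t ^ (n - 1) * a 1 * a 2 * v\<^sup>2)) ^ n * A v" if "v \<noteq> 0" for v
      by (rule Aq[OF that])
    show "v_product n t a (q * v) = (1 / (t ^ (n - 1) * a 1 * a 2 * v\<^sup>2)) ^ n * v_product n t a v" if "v \<noteq> 0" for v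
      using that t a12 by (intro v_product_q) auto
  qed blast
  then show ?thesis unfolding A_def using that by blast
qed

subsection \<open>The value at v = a6\<close>

lemma I_integrand_flip: "I_integrand n q t a (flip E z) = I_integrand n q t a z"
proof -
  have "pairprod {1..n} (\<lambda>j k. (qp (flip E z j / flip E z k) * qp (flip E z k / flip E z j) *
         qp (flip E z j * flip E z k) * qp (1 / (flip E z j * flip E z k))) /
        (qp (t * flip E z j / flip E z k) * qp (t * flip E z k / flip E z j) *
         qp (t * flip E z j * flip E z k) * qp (t / (flip E z j * flip E z k)))) =
     pairprod {1..n} (\<lambda>j k. (qp (z j / z k) * qp (z k / z j) *
         qp (z j * z k) * qp (1 / (z j * z k))) /
        (qp (t * z j / z k) * qp (t * z k / z j) *
         qp (t * z j * z k) * qp (t / (z j * z k))))"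
    by (intro pairprod_cong) (auto simp: flip_def mult_ac)
  moreover have "(\<Prod>i=1..n. qp ((flip E z i)\<^sup>2) * qp (1 / (flip E z i)\<^sup>2) *
        qp (q / a 6 * flip E z i) * qp (q / a 6 / flip E z i) /
        (\<Prod>m=1..5. qp (a m * flip E z i) * qp (a m / flip E z i))) =
     (\<Prod>i=1..n. qp ((z i)\<^sup>2) * qp (1 / (z i)\<^sup>2) * qp (q / a 6 * z i) * qp (q / a 6 / z i) /
        (\<Prod>m=1..5. qp (a m * z i) * qp (a m / z i)))"
    by (intro prod.cong refl) (auto simp: flip_def mult_ac power_divide)
  ultimately show ?thesis
    unfolding I_integrand_def prod_pairs_eq by simp
qed

text \<open>At \<open>v = a 6\<close> the factor \<open>th (a 6 * w i)\<close> cancels the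
  denominator \<open>qp (a 6 * w i)\<close> and leaves a numerator of the integrand of
  \<open>I\<close>. For \<open>k\<close> = 3, 4, 5 the numerators \<open>qp (q / a k * w i)\<close>
  complete \<open>qp (a k / w i)\<close> to theta functions, which together with the remaining theta
  factor form \<open>th4\<close> at \<open>1 / w i\<close>.\<close>

lemma J_integrand_eq_I_integrand:
  assumes adm: "admissible n t a w" and gen: "generic {1..n} w"
  shows "J_integrand n q t (a 6) a w =
     I_integrand n q t a w * bc_term (t ^ (n - 1) * a 1 * a 2 * a 6) (a 3) (a 4) (a 5) t {1..n} (\<lambda>i. 1 / w i)"
proof -
  have inv0: "th (1 / u) \<noteq> 0" if "u \<noteq> 0" "th u \<noteq> 0" for u
    using that by (simp add: th_inverse)
  have single: "qpoch_quot ((w i)\<^sup>2) q *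
        (th (t ^ (n - 1) * a 1 * a 2 * a 6 / w i) * th (a 6 * w i) /
           (\<Prod>j=1..2. qp (a j * w i) * qp (a j / w i))) *
        (\<Prod>k=3..6. qp (q / a k * w i) / qp (a k * w i)) =
      qp ((w i)\<^sup>2) * qp (1 / (w i)\<^sup>2) * qp (q / a 6 * w i) * qp (q / a 6 / w i) /
        (\<Prod>m=1..5. qp (a m * w i) * qp (a m / w i)) *
      (th4 (t ^ (n - 1) * a 1 * a 2 * a 6) (a 3) (a 4) (a 5) (1 / w i) / th ((1 / w i)\<^sup>2))"
    if i: "i \<in> {1..n}" for i
  proof -
    define x where "x = w i"
    have x: "x \<noteq> 0" "th (x\<^sup>2) \<noteq> 0" using gen i by (auto simp: generic_def x_def)
    have d: "qp (a k * x) \<noteq> 0" "qp (a k / x) \<noteq> 0" "a k \<noteq> 0" if "k \<in> {1..6}" for k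
      using admissible_denominators[OF adm i that] by (auto simp: x_def)
    have d': "qp (a 1 * x) \<noteq> 0" "qp (a 2 * x) \<noteq> 0" "qp (a 3 * x) \<noteq> 0" "qp (a 4 * x) \<noteq> 0"
      "qp (a 5 * x) \<noteq> 0" "qp (a 6 * x) \<noteq> 0" "qp (a 1 / x) \<noteq> 0" "qp (a 2 / x) \<noteq> 0" "qp (a 3 / x) \<noteq> 0"
      "qp (a 4 / x) \<noteq> 0" "qp (a 5 / x) \<noteq> 0"
      using d by auto
    have th2: "th ((1 / x)\<^sup>2) = qp (1 / x\<^sup>2) * qp (q * x\<^sup>2)"
      by (simp add: theta_def power_divide)
    have "th ((1 / x)\<^sup>2) \<noteq> 0"
      using inv0[of "x\<^sup>2"] x by (simp add: power_divide)
    then have n2: "qp (1 / x\<^sup>2) \<noteq> 0" "qp (q * x\<^sup>2) \<noteq> 0" by (auto simp: th2)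
    have rec: "qp (x\<^sup>2) = (1 - x\<^sup>2) * qp (q * x\<^sup>2)" by (rule qp_rec)
    have th_b: "th (b * (1 / x)) = qp (b / x) * qp (q / b * x)" for b
      by (simp add: theta_def)
    have th_6: "th (a 6 * x) = qp (a 6 * x) * qp (q / a 6 / x)"
      by (simp add: theta_def mult.commute)
    have "th (t ^ (n - 1) * a 1 * a 2 * a 6 * (1 / x)) = th (t ^ (n - 1) * a 1 * a 2 * a 6 / x)"
      by simp
    then show ?thesis
      unfolding x_def[symmetric] prod_1_2 prod_3_6 prod_1_5 th4_def th2 qpoch_quot_def
        th_b[of "a 3"] th_b[of "a 4"] th_b[of "a 5"] th_6 rec
      using d' n2 by (simp add: divide_simps)
  qed
  have pair: "qpoch_quot (w j * w k) q *
        (qp (w j / w k) * qp (w k / w j) / (qp (t * w j / w k) * qp (t * w k / w j))) *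
        (qp (q / t * w j * w k) / qp (t * w j * w k)) =
      (qp (w j / w k) * qp (w k / w j) * qp (w j * w k) * qp (1 / (w j * w k))) /
        (qp (t * w j / w k) * qp (t * w k / w j) * qp (t * w j * w k) * qp (t / (w j * w k))) *
      (th (t * (1 / w j) * (1 / w k)) / th (1 / w j * (1 / w k)))"
    if jk: "j \<in> {1..n}" "k \<in> {1..n}" "j < k" for j k
  proof -
    define x where "x = w j * w k"
    have x: "x \<noteq> 0" "th x \<noteq> 0" using gen jk by (auto simp: generic_def x_def)
    have d: "qp (t / x) \<noteq> 0" "t \<noteq> 0"
      using admissible_pair_denominators[OF adm jk(1,2)] by (auto simp: x_def)
    have "th (1 / x) = qp (1 / x) * qp (q * x)" by (simp add: theta_def)
    moreover have "th (1 / x) \<noteq> 0" using inv0 x by blast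
    ultimately have n2: "qp (1 / x) \<noteq> 0" "qp (q * x) \<noteq> 0" "th (1 / w j * (1 / w k)) = qp (1 / x) * qp (q * x)"
      by (auto simp: x_def)
    have tx: "th (t * (1 / w j) * (1 / w k)) = qp (t / x) * qp (q / t * x)"
      by (simp add: theta_def x_def)
    have rec: "qp x = (1 - x) * qp (q * x)" by (rule qp_rec)
    have assoc: "q / t * w j * w k = q / t * x" "t * w j * w k = t * x" by (simp_all add: x_def mult.assoc)
    show ?thesis
      unfolding n2(3) tx assoc x_def[symmetric] rec qpoch_quot_def using d n2(1,2) by (simp add: mult_ac)
  qed
  have "J_integrand n q t (a 6) a w =
     (\<Prod>i=1..n. qp ((w i)\<^sup>2) * qp (1 / (w i)\<^sup>2) * qp (q / a 6 * w i) * qp (q / a 6 / w i) /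
        (\<Prod>m=1..5. qp (a m * w i) * qp (a m / w i)) *
      (th4 (t ^ (n - 1) * a 1 * a 2 * a 6) (a 3) (a 4) (a 5) (1 / w i) / th ((1 / w i)\<^sup>2))) *
     pairprod {1..n} (\<lambda>j k. (qp (w j / w k) * qp (w k / w j) * qp (w j * w k) * qp (1 / (w j * w k))) /
        (qp (t * w j / w k) * qp (t * w k / w j) * qp (t * w j * w k) * qp (t / (w j * w k))) *
      (th (t * (1 / w j) * (1 / w k)) / th (1 / w j * (1 / w k))))"
    unfolding J_integrand_def prod_pairs_eq
    by (intro arg_cong2[of _ _ _ _ "(*)"] prod.cong[OF refl] pairprod_cong single pair)
  then show ?thesis
    unfolding I_integrand_def prod_pairs_eq bc_term_def pairprod_mult prod.distrib[of _ "\<lambda>i. th4 _ _ _ _ (1 / w i) / th ((1 / w i)\<^sup>2)"]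
    by (simp only: mult_ac)
qed

definition a_product :: "nat \<Rightarrow> complex \<Rightarrow> (nat \<Rightarrow> complex) \<Rightarrow> complex" where
  "a_product n t a = (\<Prod>i=1..n. \<Prod>j=3..5. \<Prod>k\<in>{j<..5}. th (t ^ (i - 1) * a j * a k))"

lemma a_product_eq:
  "a_product n t a = (\<Prod>i<n. th (t ^ i * a 3 * a 4) * th (t ^ i * a 3 * a 5) * th (t ^ i * a 4 * a 5))"
proof -
  have sets: "{3..5} = {3, 4, 5 :: nat}" "{3<..5} = {4, 5 :: nat}" "{4<..5} = {5 :: nat}" "{5<..5} = ({} :: nat set)"
    by auto
  have "a_product n t a = (\<Prod>i=1..n. th (t ^ (i - 1) * a 3 * a 4) * th (t ^ (i - 1) * a 3 * a 5) * th (t ^ (i - 1) * a 4 * a 5))"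
    unfolding a_product_def by (simp add: sets mult.assoc)
  also have "\<dots> = (\<Prod>i<n. th (t ^ i * a 3 * a 4) * th (t ^ i * a 3 * a 5) * th (t ^ i * a 4 * a 5))"
    by (intro prod.reindex_bij_witness[of _ Suc "\<lambda>i. i - 1"]) auto
  finally show ?thesis .
qed

text \<open>On the logarithmic scale to the base |q| the left side is a continuous function
  \<open>L\<close>. Near 0 it avoids all integers other than \<open>L 0\<close>, and since
  \<open>p\<close> is nonzero it differs from \<open>L 0\<close> for \<open>s > 0\<close>.\<close>

lemma eventually_not_q_power:
  assumes c: "0 < c" and p: "p \<noteq> 0"
  shows "\<forall>\<^sub>F s in at_right (0 :: real). c * (1 + s) powi p \<notin> range (\<lambda>j. norm q powi j)"
proof -
  have q: "0 < norm q" "norm q < 1" using q_less by auto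
  define L where "L s = (ln c + of_int p * ln (1 + s)) / ln (norm q)" for s :: real
  have lq: "ln (norm q) \<noteq> 0" using q by simp
  have "(L \<longlongrightarrow> L 0) (at_right 0)"
    unfolding L_def using lq by (intro tendsto_intros) auto
  moreover have "closed (\<int> - {L 0})" by (rule closed_subset_Ints) auto
  ultimately have "\<forall>\<^sub>F s in at_right 0. L s \<in> - (\<int> - {L 0})"
    by (intro topological_tendstoD) (simp_all only: open_Compl, auto)
  moreover have "\<forall>\<^sub>F s in at_right (0 :: real). 0 < s"
    by (simp add: eventually_at_right_less)
  ultimately show ?thesis
  proof eventually_elim
    case (elim s)
    have "L s \<noteq> L 0"
      using p lq elim(2) by (auto simp: L_def)
    then have "L s \<notin> \<int>" using elim(1) by auto
    moreover have "L s = of_int j" if "c * (1 + s) powi p = norm q powi j" for j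
    proof -
      have "ln c + of_int p * ln (1 + s) = ln (c * (1 + s) powi p)"
        using c elim(2) by (simp add: ln_mult ln_powr flip: powr_real_of_int')
      also have "\<dots> = of_int j * ln (norm q)"
        unfolding that using q by (simp add: ln_powr flip: powr_real_of_int')
      finally show ?thesis using lq by (simp add: L_def)
    qed
    ultimately show ?case by auto
  qed
qed

lemma right_limits_eq:
  fixes L M :: "real \<Rightarrow> complex"
  assumes "(L \<longlongrightarrow> l) (at_right x)" "(M \<longlongrightarrow> m) (at_right x)" "\<forall>\<^sub>F s in at_right x. L s = M s"
  shows "l = m"
  using tendsto_unique[OF trivial_limit_at_right_real Lim_transform_eventually[OF assms(1,3)] assms(2)] .

text \<open>The numbers |q| and 1 are consecutive integer powers of |q|, so the open interval
  between them contains none.\<close>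

lemma norm_q_power_gap:
  assumes "norm q < norm u" "norm u < 1"
  shows "th u \<noteq> 0"
proof (rule th_nonzero_norm)
  show "u \<noteq> 0" using assms(1) by auto
  show "norm u \<notin> range (\<lambda>j. norm q powi j)"
  proof
    assume "norm u \<in> range (\<lambda>j. norm q powi j)"
    then obtain j where j: "norm u = norm q powi j" by auto
    show False
    proof (cases "j \<le> 0")
      case True
      then have "1 \<le> norm q powi j"
        using q_less by (auto simp: power_int_def intro!: one_le_power one_le_inverse)
      then show False using j assms by simp
    next
      case False
      then obtain m where m: "j = int (Suc m)"
        by (metis not_le zero_less_imp_eq_int gr0_implies_Suc of_nat_0_less_iff)
      have "norm q powi j \<le> norm q"
        unfolding m power_int_of_nat using q_less mult_left_mono[OF power_le_one[of "norm q" m], of "norm q"]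
        by simp
      then show False using j assms by simp
    qed
  qed
qed

text \<open>
  The theta function identity needs generic arguments. They are reached by moving \<open>z\<close> off the torus,
  with a different radius \<open>(1 + s)\<^sup>i\<close> for each variable.
\<close>

lemma J_sum_flip:
  assumes t: "t \<noteq> 0" "norm t < 1"
    and a: "\<And>i. i \<in> {1..6} \<Longrightarrow> a i \<noteq> 0 \<and> norm (a i) < 1"
    and bal: "n \<noteq> 0 \<Longrightarrow> q = a 1 * a 2 * a 3 * a 4 * a 5 * a 6 * t ^ (2 * n - 2)"
    and gen: "\<And>i. i < n \<Longrightarrow> th ((t ^ i * a 3)\<^sup>2) \<noteq> 0"
    and z: "z \<in> torus n"
  shows "(\<Sum>E\<in>Pow {1..n}. J_integrand n q t (a 6) a (flip E z)) = a_product n t a * I_integrand n q t a z"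
proof -
  define r where "r = Max (insert (norm t) ((\<lambda>i. norm (a i)) ` {1..6}))"
  have r: "r < 1" "norm t \<le> r" using t a by (auto simp: r_def)
  have ar: "norm (a k) \<le> r" if "k \<in> {1..6}" for k
    unfolding r_def using that by (intro Max_ge) auto
  define Z where "Z s i = complex_of_real ((1 + s) ^ i) * z i" for s :: real and i
  have zn: "norm (z i) = 1" "z i \<noteq> 0" if "i \<in> {1..n}" for i
    using torus_norm[OF z that] torus_nonzero[OF z that] by auto
  have Zn: "norm (Z s i) = (1 + s) ^ i" if "0 \<le> s" "i \<in> {1..n}" for s i
    using that zn[OF that(2)] by (simp only: Z_def norm_mult norm_of_real) simp
  have "((\<lambda>s :: real. r * ((1 + s) ^ n)\<^sup>2) \<longlongrightarrow> r * ((1 + 0) ^ n)\<^sup>2) (at_right 0)"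
    by (intro tendsto_intros)
  then have "\<forall>\<^sub>F s in at_right (0 :: real). r * ((1 + s) ^ n)\<^sup>2 < 1"
    using r(1) by (intro order_tendstoD(2)) auto
  then obtain e where e: "e > 0" "\<And>s. 0 < s \<Longrightarrow> s < e \<Longrightarrow> r * ((1 + s) ^ n)\<^sup>2 < 1"
    by (auto simp: eventually_at_right_field)
  \<comment> \<open>Halved so that the bound also holds at the right end of the closed interval on
    which continuity is used.\<close>
  define d where "d = e / 2"
  have d: "d > 0" "r * ((1 + d) ^ n)\<^sup>2 < 1" using e by (auto simp: d_def)
  have adm: "admissible n t a (flip E (Z s))" if s: "s \<in> {0..d}" for E s
  proof (rule admissible_near_torus[where r = r and c = "(1 + d) ^ n"])
    fix i assume i: "i \<in> {1..n}"
    have "1 \<le> (1 + s) ^ i" using s by (intro one_le_power) auto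
    moreover have "(1 + s) ^ i \<le> (1 + d) ^ i" using s by (intro power_mono) auto
    moreover have "(1 + d) ^ i \<le> (1 + d) ^ n" using d i by (intro power_increasing) auto
    moreover have "norm (Z s i) = (1 + s) ^ i" using s i by (intro Zn) auto
    ultimately have bd: "1 \<le> norm (Z s i)" "norm (Z s i) \<le> (1 + d) ^ n"
      by linarith+
    have "1 / norm (Z s i) \<le> 1" using bd(1) by (subst divide_le_eq_1_pos) linarith+
    also have "1 \<le> (1 + d) ^ n" using d by (intro one_le_power) auto
    finally have bd': "1 / norm (Z s i) \<le> (1 + d) ^ n" .
    show "flip E (Z s) i \<noteq> 0 \<and> norm (flip E (Z s) i) \<le> (1 + d) ^ n \<and> norm (1 / flip E (Z s) i) \<le> (1 + d) ^ n"
      using bd bd' by (auto simp: flip_def norm_divide)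
  qed (use t a r ar d in \<open>auto intro: one_le_power\<close>)
  have Zcont: "continuous_on {0..d} (\<lambda>s. flip E (Z s) i)" if "i \<in> {1..n}" for E i
  proof -
    have "Z s i \<noteq> 0" if "s \<in> {0..d}" for s
      using Zn[of s i] that \<open>i \<in> {1..n}\<close> by (metis atLeastAtMost_iff norm_eq_zero power_eq_0_iff add_nonneg_eq_0_iff zero_le_one zero_neq_one)
    moreover have "continuous_on {0..d} (\<lambda>s. Z s i)"
      unfolding Z_def by (intro continuous_intros)
    ultimately show ?thesis
      unfolding flip_def by (cases "i \<in> E") (auto intro!: continuous_intros)
  qed
  define L where "L s = (\<Sum>E\<in>Pow {1..n}. J_integrand n q t (a 6) a (flip E (Z s)))" for s
  define M where "M s = a_product n t a * I_integrand n q t a (flip {} (Z s))" for s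
  have "continuous_on {0..d} L"
    unfolding L_def using a[of 6]
    by (intro continuous_on_sum J_integrand_continuous continuous_on_const Zcont adm) auto
  then have "(L \<longlongrightarrow> L 0) (at_right 0)"
    using d by (intro continuous_on_Icc_at_rightD)
  moreover have "continuous_on {0..d} M"
    unfolding M_def by (intro continuous_on_mult continuous_on_const I_integrand_continuous Zcont adm) auto
  then have "(M \<longlongrightarrow> M 0) (at_right 0)"
    using d by (intro continuous_on_Icc_at_rightD)
  moreover have "\<forall>\<^sub>F s in at_right 0. L s = M s"
  proof -
    \<comment> \<open>The exponents of \<open>1 + s\<close> in the relevant norms are
      \<open>2 * i\<close>, the sums and differences of two distinct indices, and plus or minus
      \<open>k\<close>. None is zero, because the indices start at 1 and the radii are
      distinct.\<close>
    have ev1: "\<forall>\<^sub>F s in at_right (0 :: real). \<forall>i\<in>{1..n}. 1 * (1 + s) powi (2 * int i) \<notin> range (\<lambda>j. norm q powi j)"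
      by (intro eventually_ball_finite ballI eventually_not_q_power) auto
    have ev2: "\<forall>\<^sub>F s in at_right (0 :: real). \<forall>x\<in>{x \<in> {1..n} \<times> {1..n}. fst x \<noteq> snd x}.
        1 * (1 + s) powi (int (fst x) + int (snd x)) \<notin> range (\<lambda>j. norm q powi j) \<and>
        1 * (1 + s) powi (int (fst x) - int (snd x)) \<notin> range (\<lambda>j. norm q powi j)"
      by (intro eventually_ball_finite ballI eventually_conj eventually_not_q_power) auto
    have ev3: "\<forall>\<^sub>F s in at_right (0 :: real). \<forall>k\<in>{1..n}. \<forall>i\<in>{..<n}.
        norm (t ^ i * a 3) * (1 + s) powi (int k) \<notin> range (\<lambda>j. norm q powi j) \<and>
        norm (t ^ i * a 3) * (1 + s) powi (- int k) \<notin> range (\<lambda>j. norm q powi j)"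
      using t a[of 3]
      by (intro eventually_ball_finite ballI eventually_conj eventually_not_q_power) auto
    have "\<forall>\<^sub>F s in at_right (0 :: real). s < d" using d(1) by (intro order_tendstoD(2)[OF tendsto_ident_at])
    moreover have "\<forall>\<^sub>F s in at_right (0 :: real). 0 < s" by (simp add: eventually_at_right_less)
    ultimately show ?thesis using ev1 ev2 ev3
    proof eventually_elim
      case (elim s)
      have s: "0 \<le> s" "s \<in> {0..d}" "1 + s \<noteq> 0" using elim by auto
      have Znz: "Z s i \<noteq> 0" if "i \<in> {1..n}" for i
        using Zn[OF s(1) that] s by auto
      have Zpow: "norm (Z s i) = (1 + s) powi (int i)" if "i \<in> {1..n}" for i
        using Zn[OF s(1) that] by simp
      have sq: "th ((Z s i)\<^sup>2) \<noteq> 0" if i: "i \<in> {1..n}" for i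
      proof (rule th_nonzero_norm)
        have "norm ((Z s i)\<^sup>2) = 1 * (1 + s) powi (2 * int i)"
          unfolding norm_power Zpow[OF i] by (simp add: power_int_mult mult.commute)
        then show "norm ((Z s i)\<^sup>2) \<notin> range (\<lambda>j. norm q powi j)" using elim(3) i by metis
      qed (use Znz i in auto)
      have pr: "th (Z s j * Z s k) \<noteq> 0" "th (Z s j / Z s k) \<noteq> 0" if jk: "j \<in> {1..n}" "k \<in> {1..n}" "j \<noteq> k" for j k
      proof -
        have "norm (Z s j * Z s k) = 1 * (1 + s) powi (int j + int k)"
          unfolding norm_mult Zpow[OF jk(1)] Zpow[OF jk(2)] using s by (simp add: power_int_add)
        moreover have "norm (Z s j / Z s k) = 1 * (1 + s) powi (int j - int k)"
          unfolding norm_divide Zpow[OF jk(1)] Zpow[OF jk(2)] using s by (simp add: power_int_diff)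
        ultimately have "norm (Z s j * Z s k) \<notin> range (\<lambda>j. norm q powi j)"
          "norm (Z s j / Z s k) \<notin> range (\<lambda>j. norm q powi j)"
          using bspec[OF elim(4), of "(j, k)"] jk by auto
        then show "th (Z s j * Z s k) \<noteq> 0" "th (Z s j / Z s k) \<noteq> 0"
          using Znz[OF jk(1)] Znz[OF jk(2)] th_nonzero_norm[of "Z s j * Z s k"] th_nonzero_norm[of "Z s j / Z s k"]
          by auto
      qed
      have inv0: "th (1 / u) \<noteq> 0" if "u \<noteq> 0" "th u \<noteq> 0" for u
        using that by (simp add: th_inverse)
      have genZ: "generic {1..n} (flip E (Z s))" for E
        unfolding generic_def
      proof (intro conjI ballI impI)
        fix i assume i: "i \<in> {1..n}"
        show "flip E (Z s) i \<noteq> 0" using Znz[OF i] by (simp add: flip_def)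
        show "th ((flip E (Z s) i)\<^sup>2) \<noteq> 0"
          using sq[OF i] inv0[of "(Z s i)\<^sup>2"] Znz[OF i] by (simp add: flip_def power_divide)
      next
        fix j k assume jk: "j \<in> {1..n}" "k \<in> {1..n}" "j \<noteq> k"
        note nz = Znz[OF jk(1)] Znz[OF jk(2)]
        show "th (flip E (Z s) j * flip E (Z s) k) \<noteq> 0" "th (flip E (Z s) j / flip E (Z s) k) \<noteq> 0"
          using pr[OF jk] pr[OF jk(2,1)] jk(3) inv0[of "Z s j * Z s k"] nz by (auto simp: flip_def mult.commute)
      qed
      have gen_inv: "generic {1..n} (\<lambda>i. 1 / Z s i)"
        using genZ[of "{1..n}"] by (auto simp: generic_def flip_def)
      \<comment> \<open>The remaining parameter dictated by
        \<open>J_integrand_eq_I_integrand\<close>. The distinguished parameter of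
        \<open>bc_theta_identity\<close> is \<open>a 3\<close>, which explains the assumption
        \<open>gen\<close>.\<close>
      define b0 where "b0 = t ^ (n - 1) * a 1 * a 2 * a 6"
      have ann: "a k \<noteq> 0" if "k \<in> {1..6}" for k using a[OF that] by simp
      have "(\<Sum>E\<in>Pow {1..n}. bc_term b0 (a 3) (a 4) (a 5) t {1..n} (flip E (\<lambda>i. 1 / Z s i))) =
         (\<Prod>i<card {1..n}. th (t ^ i * a 3 * a 4) * th (t ^ i * a 3 * a 5) * th (t ^ i * a 4 * a 5))"
      proof (rule bc_theta_identity[OF _ gen_inv])
        show "b0 \<noteq> 0" "a 3 \<noteq> 0" "a 4 \<noteq> 0" "a 5 \<noteq> 0" "t \<noteq> 0"
          using t ann[of 1] ann[of 2] ann[of 6] ann[of 3] ann[of 4] ann[of 5] by (auto simp: b0_def)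
        show "b0 * a 3 * a 4 * a 5 * t ^ (card {1..n} - 1) = q" if "{1..n} \<noteq> {}"
        proof -
          have n: "n \<noteq> 0" using that by auto
          \<comment> \<open>Half of the power of \<open>t\<close> in the balancing condition is
            contained in \<open>b0\<close>; the other half is the power required by
            \<open>bc_theta_identity\<close>.\<close>
          have "t ^ (2 * n - 2) = t ^ (n - 1) * t ^ (n - 1)"
          proof -
            have "2 * n - 2 = (n - 1) + (n - 1)" by simp
            then show ?thesis by (simp only: power_add)
          qed
          then show ?thesis using bal[OF n] by (simp add: b0_def mult_ac)
        qed
        show "th ((t ^ i * a 3)\<^sup>2) \<noteq> 0" if "i < card {1..n}" for i using gen that by simp
        fix k i assume k: "k \<in> {1..n}" and i: "i < card {1..n}"
        have "norm (t ^ i * a 3 * (1 / Z s k)) = norm (t ^ i * a 3) * (1 + s) powi (- int k)"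
          "norm (t ^ i * a 3 / (1 / Z s k)) = norm (t ^ i * a 3) * (1 + s) powi (int k)"
          using Zpow[OF k] s by (simp_all add: norm_mult norm_divide norm_inverse power_int_minus divide_inverse)
        then have "norm (t ^ i * a 3 * (1 / Z s k)) \<notin> range (\<lambda>j. norm q powi j)"
          "norm (t ^ i * a 3 / (1 / Z s k)) \<notin> range (\<lambda>j. norm q powi j)"
          using elim(5) k i by auto
        then show "th (t ^ i * a 3 * (1 / Z s k)) \<noteq> 0 \<and> th (t ^ i * a 3 / (1 / Z s k)) \<noteq> 0"
          using Znz[OF k] t ann[of 3] by (intro conjI th_nonzero_norm) auto
      qed simp
      then have id: "(\<Sum>E\<in>Pow {1..n}. bc_term b0 (a 3) (a 4) (a 5) t {1..n} (flip E (\<lambda>i. 1 / Z s i))) = a_product n t a"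
        by (simp add: a_product_eq)
      have "L s = (\<Sum>E\<in>Pow {1..n}. I_integrand n q t a (Z s) * bc_term b0 (a 3) (a 4) (a 5) t {1..n} (flip E (\<lambda>i. 1 / Z s i)))"
        unfolding L_def
      proof (rule sum.cong[OF refl])
        fix E
        have "bc_term b0 (a 3) (a 4) (a 5) t {1..n} (\<lambda>i. 1 / flip E (Z s) i) =
            bc_term b0 (a 3) (a 4) (a 5) t {1..n} (flip E (\<lambda>i. 1 / Z s i))"
          by (intro bc_term_cong) (simp add: flip_def)
        then show "J_integrand n q t (a 6) a (flip E (Z s)) =
            I_integrand n q t a (Z s) * bc_term b0 (a 3) (a 4) (a 5) t {1..n} (flip E (\<lambda>i. 1 / Z s i))"
          using J_integrand_eq_I_integrand[OF adm[OF s(2)] genZ] by (simp only: I_integrand_flip b0_def)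
      qed
      also have "\<dots> = M s"
        unfolding sum_distrib_left[symmetric] id M_def I_integrand_flip by (simp only: mult.commute)
      finally show ?case .
    qed
  qed
  ultimately have "L 0 = M 0"
    by (rule right_limits_eq)
  moreover have "Z 0 = z" by (simp add: Z_def fun_eq_iff)
  ultimately show ?thesis by (simp add: L_def M_def I_integrand_flip)
qed

text \<open>Inverting coordinates preserves the torus integral, so summing over all subsets
  multiplies it by \<open>2 ^ n\<close>; this is the factor in the normalisation of
  \<open>I_int\<close>.\<close>

lemma J_at_a6:
  assumes t: "t \<noteq> 0" "norm t < 1"
    and a: "\<And>i. i \<in> {1..6} \<Longrightarrow> a i \<noteq> 0 \<and> norm (a i) < 1"
    and bal: "n \<noteq> 0 \<Longrightarrow> q = a 1 * a 2 * a 3 * a 4 * a 5 * a 6 * t ^ (2 * n - 2)"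
    and gen: "\<And>i. i < n \<Longrightarrow> th ((t ^ i * a 3)\<^sup>2) \<noteq> 0"
  shows "J_int n q t (a 6) a = a_product n t a * I_int n q t a"
proof -
  let ?J = "J_integrand n q t (a 6) a"
  have adm: "admissible n t a z" if "z \<in> torus n" for z
    by (rule admissible_torus[OF t a that])
  have coord: "continuous_on X (\<lambda>z :: nat \<Rightarrow> complex. z i)" for X i
    by (rule continuous_on_product_then_coordinatewise[OF continuous_on_id])
  have cont: "continuous_on (torus n) ?J"
    using a[of 6] by (intro J_integrand_continuous continuous_on_const coord adm) auto
  have flipped: "torus_integral n (\<lambda>z. ?J (flip E z)) = torus_integral n ?J" for E
  proof -
    have "torus_integral n (\<lambda>z. ?J (flip E z)) = torus_integral n (\<lambda>z. ?J (\<lambda>i\<in>{1..n}. flip E z i))"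
      by (intro torus_integral_cong J_integrand_cong) simp
    then show ?thesis using torus_integral_flip[OF cont] by simp
  qed
  have admf: "admissible n t a (flip E z)" if "z \<in> torus n" for E z
  proof -
    have "(\<lambda>i\<in>{1..n}. flip E z i) \<in> torus n"
      using torus_norm[OF that] by (auto simp: torus_def flip_def norm_divide)
    from adm[OF this] show ?thesis by (simp add: admissible_def)
  qed
  have contf: "continuous_on (torus n) (\<lambda>z. ?J (flip E z))" for E
  proof -
    have "continuous_on (torus n) (\<lambda>z. flip E z i)" if "i \<in> {1..n}" for i
      unfolding flip_def using torus_nonzero[OF _ that]
      by (cases "i \<in> E") (auto intro!: continuous_intros coord)
    then show ?thesis
      using a[of 6] by (intro J_integrand_continuous continuous_on_const admf) auto
  qed
  have "2 ^ n * torus_integral n ?J = (\<Sum>E\<in>Pow {1..n}. torus_integral n (\<lambda>z. ?J (flip E z)))"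
    by (simp add: flipped card_Pow)
  also have "\<dots> = torus_integral n (\<lambda>z. \<Sum>E\<in>Pow {1..n}. ?J (flip E z))"
    by (rule torus_integral_sum[symmetric, OF contf])
  also have "\<dots> = torus_integral n (\<lambda>z. a_product n t a * I_integrand n q t a z)"
    by (intro torus_integral_cong J_sum_flip t a bal gen)
  finally have "2 ^ n * torus_integral n ?J = a_product n t a * torus_integral n (I_integrand n q t a)"
    by (simp only: torus_integral_cmult)
  then show ?thesis
    by (simp add: J_int_def I_int_def field_simps)
qed

subsection \<open>Removal of the genericity assumptions\<close>

text \<open>The unknown factor of proportionality is eliminated by comparing the arguments
  \<open>v\<close> and \<open>a 6\<close>. The result is kept free of quotients so that it passes to
  the limit.\<close>

lemma J_generic:
  assumes t: "t \<noteq> 0" "norm t < 1" and v: "v \<noteq> 0"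
    and a: "\<And>i. i \<in> {1..6} \<Longrightarrow> a i \<noteq> 0 \<and> norm (a i) < 1"
    and bal: "n \<noteq> 0 \<Longrightarrow> q = a 1 * a 2 * a 3 * a 4 * a 5 * a 6 * t ^ (2 * n - 2)"
    and gen1: "\<And>i. i < n \<Longrightarrow> th ((t ^ i * a 3)\<^sup>2) \<noteq> 0"
    and gen2: "\<And>i j k l. i \<in> {1..n} \<Longrightarrow> j \<in> {1..n} \<Longrightarrow> k \<in> {1..2} \<Longrightarrow> l \<in> {1..2} \<Longrightarrow> (i, k) \<noteq> (j, l) \<Longrightarrow>
       th (t ^ (i - 1) * a k / (t ^ (j - 1) * a l)) \<noteq> 0"
  shows "J_int n q t v a * v_product n t a (a 6) = a_product n t a * I_int n q t a * v_product n t a v"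
proof -
  obtain C where C: "\<And>v. v \<noteq> 0 \<Longrightarrow> torus_integral n (J_integrand n q t v a) = C * v_product n t a v"
    using J_proportional[where t = t and a = a and n = n, OF t a gen2] by blast
  have "J_int n q t v a * v_product n t a (a 6) = J_int n q t (a 6) a * v_product n t a v"
    using C[OF v] C[of "a 6"] a[of 6] by (simp add: J_int_def mult_ac)
  also have "J_int n q t (a 6) a = a_product n t a * I_int n q t a"
    by (rule J_at_a6[OF t a bal gen1])
  finally show ?thesis .
qed

text \<open>The parameters are deformed by a real number \<open>s\<close> within the balanced ones.
  The generic conditions hold for small \<open>s > 0\<close>, and both sides are continuous up to
  \<open>s = 0\<close>.\<close>

lemma J_general:
  assumes t: "t \<noteq> 0" "norm t < 1" and v: "v \<noteq> 0" and n: "1 \<le> n"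
    and a: "\<And>i. i \<in> {1..6} \<Longrightarrow> a i \<noteq> 0 \<and> norm (a i) < 1"
    and bal: "q = a 1 * a 2 * a 3 * a 4 * a 5 * a 6 * t ^ (2 * n - 2)"
  shows "J_int n q t v a * v_product n t a (a 6) = a_product n t a * I_int n q t a * v_product n t a v"
proof -
  define T where "T s = of_real (1 + s) * t" for s :: real
  \<comment> \<open>The exponents n, 2 - 3 n and the 2 n - 2 coming from \<open>T s\<close> add up
    to zero, so the balancing condition persists. The exponent n exceeds every difference of two
    numbers i - 1 with i \<le> n, which separates the multiples of \<open>a 1\<close> from those of
    \<open>a 2\<close>; and i + 2 - 3 n is negative for i < n, which moves
    \<open>t ^ i * a 3\<close>.\<close>
  define e where "e k = (if k = 1 then int n else if k = 3 then 2 - 3 * int n else 0)" for k :: nat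
  define B where "B s k = of_real ((1 + s) powi e k) * a k" for s :: real and k
  have T0: "T 0 = t" and B0: "B 0 = a" by (auto simp: T_def B_def)
  have Tn: "norm (T s) = norm t * (1 + s) powi 1" if "0 \<le> s" for s
    using that unfolding T_def norm_mult norm_of_real by simp
  have Bn: "norm (B s k) = norm (a k) * (1 + s) powi e k" if "0 \<le> s" for s k
    using that unfolding B_def norm_mult norm_of_real by simp
  define r where "r = Max (insert (norm t) ((\<lambda>i. norm (a i)) ` {1..6}))"
  have r: "r < 1" "norm t \<le> r" using t a by (auto simp: r_def)
  have r0: "0 \<le> r" using r(2) norm_ge_zero order_trans by blast
  have ar: "norm (a k) \<le> r" if "k \<in> {1..6}" for k
    unfolding r_def using that by (intro Max_ge) auto
  have "((\<lambda>s :: real. r * (1 + s) ^ n) \<longlongrightarrow> r * (1 + 0) ^ n) (at_right 0)"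
    by (intro tendsto_intros)
  then have "\<forall>\<^sub>F s in at_right (0 :: real). r * (1 + s) ^ n < 1"
    using r(1) by (intro order_tendstoD(2)) auto
  then obtain c where c: "c > 0" "\<And>s. 0 < s \<Longrightarrow> s < c \<Longrightarrow> r * (1 + s) ^ n < 1"
    by (auto simp: eventually_at_right_field)
  define d where "d = c / 2"
  have d: "d > 0" "r * (1 + d) ^ n < 1" using c by (auto simp: d_def)
  have small: "x * (1 + s) powi p < 1" if "0 \<le> x" "x \<le> r" "s \<in> {0..d}" "p \<le> int n" for x s p
  proof -
    have "(1 + s) powi p \<le> (1 + s) powi int n"
      using that by (intro power_int_increasing) auto
    also have "\<dots> \<le> (1 + d) ^ n"
      using that by (auto intro!: power_mono)
    finally have "x * (1 + s) powi p \<le> r * (1 + d) ^ n"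
      using that r0 by (intro mult_mono) auto
    then show ?thesis using d by simp
  qed
  have par: "T s \<noteq> 0" "norm (T s) < 1" "k \<in> {1..6} \<Longrightarrow> B s k \<noteq> 0 \<and> norm (B s k) < 1"
    if s: "s \<in> {0..d}" for s k
  proof -
    have s0: "0 \<le> s" using s by simp
    show "T s \<noteq> 0"
    proof -
      have "1 + s \<noteq> 0" using s by auto
      then have "complex_of_real (1 + s) \<noteq> 0" by (simp only: of_real_eq_0_iff not_False_eq_True)
      then show ?thesis using t by (simp only: T_def mult_eq_0_iff simp_thms)
    qed
    show "norm (T s) < 1"
      unfolding Tn[OF s0] using r(2) s n by (intro small) auto
    assume k: "k \<in> {1..6}"
    have "(1 + s) powi e k \<noteq> 0" using s0 by simp
    then have "complex_of_real ((1 + s) powi e k) \<noteq> 0" by (simp only: of_real_eq_0_iff not_False_eq_True)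
    then have "B s k \<noteq> 0" using a[OF k] by (simp only: B_def mult_eq_0_iff simp_thms)
    moreover have "norm (B s k) < 1"
      unfolding Bn[OF s0] using ar[OF k] s n by (intro small) (auto simp: e_def)
    ultimately show "B s k \<noteq> 0 \<and> norm (B s k) < 1" by simp
  qed
  have balance: "q = B s 1 * B s 2 * B s 3 * B s 4 * B s 5 * B s 6 * T s ^ (2 * n - 2)" if s: "s \<in> {0..d}" for s
  proof -
    have s1: "1 + s \<noteq> 0" using s by auto
    have "(1 + s) powi int n * (1 + s) powi (2 - 3 * int n) * (1 + s) ^ (2 * n - 2) =
        (1 + s) powi (int n + (2 - 3 * int n) + int (2 * n - 2))"
      by (simp only: power_int_add[OF disjI1[OF s1]] power_int_of_nat)
    also have "int n + (2 - 3 * int n) + int (2 * n - 2) = 0" using n by simp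
    finally have one: "(1 + s) powi int n * (1 + s) powi (2 - 3 * int n) * (1 + s) ^ (2 * n - 2) = 1"
      by simp
    have "B s 1 * B s 2 * B s 3 * B s 4 * B s 5 * B s 6 * T s ^ (2 * n - 2) =
        of_real ((1 + s) powi int n * (1 + s) powi (2 - 3 * int n) * (1 + s) ^ (2 * n - 2)) *
        (a 1 * a 2 * a 3 * a 4 * a 5 * a 6 * t ^ (2 * n - 2))"
      by (simp add: B_def T_def e_def power_mult_distrib mult_ac)
    then show ?thesis unfolding one bal[symmetric] by simp
  qed
  have Tcont: "continuous_on {0..d} T" unfolding T_def by (intro continuous_intros)
  have Bcont: "continuous_on {0..d} (\<lambda>s. B s k)" for k
    unfolding B_def by (intro continuous_intros) auto
  have adm: "admissible n (T s) (B s) z" if "s \<in> {0..d}" "z \<in> torus n" for s z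
    using par[OF that(1)] that(2) by (intro admissible_torus) auto
  have comp: "continuous_on ({0..d} \<times> torus n) (\<lambda>x. g (fst x))" if "continuous_on {0..d} g" for g :: "real \<Rightarrow> complex"
    using that by (rule continuous_on_compose2) (auto intro!: continuous_intros)
  have coord: "continuous_on X (\<lambda>x :: real \<times> (nat \<Rightarrow> complex). snd x i)" for X i
    by (rule continuous_on_product_then_coordinatewise[OF continuous_on_snd[OF continuous_on_id]])
  have Jcont: "continuous_on {0..d} (\<lambda>s. J_int n q (T s) v (B s))"
    unfolding J_int_def
  proof (intro continuous_on_mult continuous_on_const torus_integral_continuous)
    show "continuous_on ({0..d} \<times> torus n) (\<lambda>(s, z). J_integrand n q (T s) v (B s) z)"
      unfolding case_prod_unfold
      by (intro J_integrand_continuous continuous_on_const comp Tcont Bcont coord) (use adm v in auto)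
  qed
  have Icont: "continuous_on {0..d} (\<lambda>s. I_int n q (T s) (B s))"
    unfolding I_int_def
  proof (intro continuous_on_mult continuous_on_const torus_integral_continuous)
    show "continuous_on ({0..d} \<times> torus n) (\<lambda>(s, z). I_integrand n q (T s) (B s) z)"
      unfolding case_prod_unfold
      by (intro I_integrand_continuous comp Tcont Bcont coord) (use adm in auto)
  qed
  have nz: "T s \<noteq> 0 \<and> (\<forall>k\<in>{1..6}. B s k \<noteq> 0)" if "s \<in> {0..d}" for s
    using par[OF that] by blast
  have vcont: "continuous_on {0..d} (\<lambda>s. v_product n (T s) (B s) (w s))"
    if w: "continuous_on {0..d} w" "\<And>s. s \<in> {0..d} \<Longrightarrow> w s \<noteq> 0" for w
  proof -
    have "w s \<noteq> 0 \<and> T s \<noteq> 0 \<and> B s 1 \<noteq> 0 \<and> B s 2 \<noteq> 0" if "s \<in> {0..d}" for s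
      using nz[OF that] w(2)[OF that] by auto
    then show ?thesis
      unfolding v_product_def prod_1_2
      by (intro continuous_on_prod continuous_on_mult th_continuous continuous_on_power Tcont Bcont w(1)) simp_all
  qed
  have acont: "continuous_on {0..d} (\<lambda>s. a_product n (T s) (B s))"
  proof -
    have "T s \<noteq> 0 \<and> B s 3 \<noteq> 0 \<and> B s 4 \<noteq> 0 \<and> B s 5 \<noteq> 0" if "s \<in> {0..d}" for s
      using nz[OF that] by auto
    then show ?thesis
      unfolding a_product_eq
      by (intro continuous_on_prod continuous_on_mult th_continuous continuous_on_power Tcont Bcont) simp_all
  qed
  define L where "L s = J_int n q (T s) v (B s) * v_product n (T s) (B s) (B s 6)" for s
  define M where "M s = a_product n (T s) (B s) * I_int n q (T s) (B s) * v_product n (T s) (B s) v" for s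
  have "continuous_on {0..d} L"
    unfolding L_def using nz by (intro continuous_on_mult Jcont vcont Bcont) auto
  then have "(L \<longlongrightarrow> L 0) (at_right 0)"
    using d by (intro continuous_on_Icc_at_rightD)
  moreover have "continuous_on {0..d} M"
    unfolding M_def using v by (intro continuous_on_mult Icont acont vcont continuous_on_const) auto
  then have "(M \<longlongrightarrow> M 0) (at_right 0)"
    using d by (intro continuous_on_Icc_at_rightD)
  moreover have "\<forall>\<^sub>F s in at_right 0. L s = M s"
  proof -
    have ann: "a k \<noteq> 0" if "k \<in> {1..6}" for k using a[OF that] by simp
    have ev1: "\<forall>\<^sub>F s in at_right (0 :: real). \<forall>i\<in>{..<n}.
        norm (t ^ i * a 3) ^ 2 * (1 + s) powi (2 * (int i + e 3)) \<notin> range (\<lambda>j. norm q powi j)"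
      using t ann[of 3] by (intro eventually_ball_finite ballI eventually_not_q_power) (auto simp: e_def)
    define X where "X = {(x, y). x \<in> {1..n} \<times> {1..2} \<and> y \<in> {1..n} \<times> {1..2 :: nat} \<and> x \<noteq> y}"
    have finX: "finite X"
      by (rule finite_subset[of _ "({1..n} \<times> {1..2}) \<times> ({1..n} \<times> {1..2})"]) (auto simp: X_def)
    have ev2: "\<forall>\<^sub>F s in at_right (0 :: real). \<forall>(x, y)\<in>X.
        norm (t ^ (fst x - 1) * a (snd x) / (t ^ (fst y - 1) * a (snd y))) *
          (1 + s) powi (int (fst x - 1) + e (snd x) - (int (fst y - 1) + e (snd y))) \<notin> range (\<lambda>j. norm q powi j)"
      unfolding case_prod_unfold
    proof (intro eventually_ball_finite finX ballI eventually_not_q_power)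
      fix xy assume xy: "xy \<in> X"
      obtain i k j l where ijkl: "xy = ((i, k), (j, l))" by (metis surj_pair)
      have *: "i \<in> {1..n}" "j \<in> {1..n}" "k \<in> {1..2}" "l \<in> {1..2}" "(i, k) \<noteq> (j, l)"
        using xy by (auto simp: X_def ijkl)
      show "0 < norm (t ^ (fst (fst xy) - 1) * a (snd (fst xy)) / (t ^ (fst (snd xy) - 1) * a (snd (snd xy))))"
        using t ann[of k] ann[of l] * by (simp add: ijkl)
      have "k = 1 \<or> k = 2" "l = 1 \<or> l = 2" using * by auto
      then show "int (fst (fst xy) - 1) + e (snd (fst xy)) - (int (fst (snd xy) - 1) + e (snd (snd xy))) \<noteq> 0"
        using * by (auto simp: ijkl e_def)
    qed
    have "\<forall>\<^sub>F s in at_right (0 :: real). s < d" using d(1) by (intro order_tendstoD(2)[OF tendsto_ident_at])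
    moreover have "\<forall>\<^sub>F s in at_right (0 :: real). 0 < s" by (simp add: eventually_at_right_less)
    ultimately show ?thesis using ev1 ev2
    proof eventually_elim
      case (elim s)
      have s: "s \<in> {0..d}" "0 \<le> s" "1 + s \<noteq> 0" using elim by auto
      note p = par[OF s(1)]
      have TBn: "norm (T s ^ i * B s k) = norm (t ^ i * a k) * (1 + s) powi (int i + e k)" for i k
        unfolding norm_mult norm_power Tn[OF s(2)] Bn[OF s(2)] using s(3)
        by (simp add: power_mult_distrib power_int_add)
      show ?case
        unfolding L_def M_def
      proof (rule J_generic[OF p(1,2) v p(3) balance[OF s(1)]])
        fix i assume i: "i < n"
        show "th ((T s ^ i * B s 3)\<^sup>2) \<noteq> 0"
        proof (rule th_nonzero_norm)
          have "norm ((T s ^ i * B s 3)\<^sup>2) = norm (t ^ i * a 3) ^ 2 * (1 + s) powi (2 * (int i + e 3))"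
          proof -
            have "(1 + s) powi (2 * m) = ((1 + s) powi m)\<^sup>2" for m
              by (simp add: power_int_mult mult.commute[of 2])
            then show ?thesis
              by (simp only: norm_power[of "T s ^ i * B s 3"] TBn power_mult_distrib[of _ "_ powi _"])
          qed
          then show "norm ((T s ^ i * B s 3)\<^sup>2) \<notin> range (\<lambda>j. norm q powi j)" using elim(3) i by auto
        qed (use p(1) p(3)[of 3] in auto)
      next
        fix i j k l :: nat
        assume *: "i \<in> {1..n}" "j \<in> {1..n}" "k \<in> {1..2}" "l \<in> {1..2}" "(i, k) \<noteq> (j, l)"
        show "th (T s ^ (i - 1) * B s k / (T s ^ (j - 1) * B s l)) \<noteq> 0"
        proof (rule th_nonzero_norm)
          have "norm (T s ^ (i - 1) * B s k / (T s ^ (j - 1) * B s l)) =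
              norm (t ^ (i - 1) * a k / (t ^ (j - 1) * a l)) *
              (1 + s) powi (int (i - 1) + e k - (int (j - 1) + e l))"
            unfolding norm_divide TBn power_int_diff[OF disjI1[OF s(3)]] by simp
          moreover have "((i, k), (j, l)) \<in> X" using * by (simp add: X_def)
          ultimately show "norm (T s ^ (i - 1) * B s k / (T s ^ (j - 1) * B s l)) \<notin> range (\<lambda>j. norm q powi j)"
            using elim(4) by fastforce
        qed (use p(1) p(3)[of k] p(3)[of l] * in auto)
      qed
    qed
  qed
  ultimately have "L 0 = M 0"
    by (rule right_limits_eq)
  then show ?thesis by (simp add: L_def M_def T0 B0)
qed

text \<open>By the balancing condition \<open>q\<close> is the argument of the theta function times
  the remaining parameters, whose product has absolute value below 1. So the argument lies strictly
  between |q| and 1 in absolute value.\<close>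

lemma v_product_a6_nonzero:
  assumes t: "t \<noteq> 0" "norm t < 1" and n: "1 \<le> n"
    and a: "\<And>i. i \<in> {1..6} \<Longrightarrow> a i \<noteq> 0 \<and> norm (a i) < 1"
    and bal: "q = a 1 * a 2 * a 3 * a 4 * a 5 * a 6 * t ^ (2 * n - 2)"
  shows "v_product n t a (a 6) \<noteq> 0"
proof -
  have "th (t ^ (i - 1) * a l * a 6) \<noteq> 0" if i: "i \<in> {1..n}" and l: "l \<in> {1..2}" for i l
  proof -
    let ?u = "t ^ (i - 1) * a l * a 6"
    \<comment> \<open>The other element of \<open>{1, 2}\<close>.\<close>
    define l' where "l' = 3 - l"
    have l': "l' \<in> {1..6}" using l by (auto simp: l'_def)
    have prod_lt: "norm (x * y) < norm x" if "x \<noteq> 0" "norm y < 1" for x y :: complex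
      using that by (simp add: norm_mult)
    have mult_lt: "norm (x * y) < 1" if "norm x < 1" "norm y \<le> 1" for x y :: complex
      using that mult_left_le[of "norm y" "norm x"] by (simp add: norm_mult)
    have tp: "norm (t ^ k) \<le> 1" for k using t by (simp add: norm_power power_le_one)
    have an: "norm (a k) < 1" "norm (a k) \<le> 1" "a k \<noteq> 0" if "k \<in> {1..6}" for k
      using a[OF that] by auto
    have "a 1 * a 2 = a l * a l'" using l by (auto simp: l'_def numeral_2_eq_2 atLeastAtMostSuc_conv)
    moreover have "2 * n - 2 = (i - 1) + (2 * n - 2 - (i - 1))" using i by auto
    then have "t ^ (2 * n - 2) = t ^ (i - 1) * t ^ (2 * n - 2 - (i - 1))" by (metis power_add)
    ultimately have "q = ?u * (a l' * a 3 * a 4 * a 5 * t ^ (2 * n - 2 - (i - 1)))"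
      using bal by (simp add: mult_ac)
    moreover have "norm (a l' * a 3 * a 4 * a 5 * t ^ (2 * n - 2 - (i - 1))) < 1"
      using an l' tp by (intro mult_lt) auto
    moreover have unz: "?u \<noteq> 0" using t an(3)[of l] an(3)[of 6] l by auto
    ultimately have "norm q < norm ?u" using prod_lt by metis
    moreover have "norm ?u < 1"
    proof -
      have "norm (a 6 * (t ^ (i - 1) * a l)) < 1"
      proof (rule mult_lt)
        show "norm (t ^ (i - 1) * a l) \<le> 1"
          unfolding norm_mult using tp an(2)[of l] l by (intro mult_le_one) auto
      qed (use an in auto)
      then show ?thesis by (simp add: mult_ac)
    qed
    ultimately show ?thesis by (rule norm_q_power_gap)
  qed
  then show ?thesis by (simp add: v_product_def prod_zero_iff)
qed

end

text \<open>For \<open>n = 1\<close> the number \<open>t\<close> occurs only with exponent 0 and in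
  empty products over pairs.\<close>

lemma J_int_I_int_1_independent_of_t:
  fixes t t' :: complex
  shows "J_int 1 q t v a = J_int 1 q t' v a" "I_int 1 q t a = I_int 1 q t' a"
proof -
  have "J_integrand 1 q t v a = J_integrand 1 q t' v a" "I_integrand 1 q t a = I_integrand 1 q t' a"
    by (simp_all add: J_integrand_def I_integrand_def fun_eq_iff)
  then show "J_int 1 q t v a = J_int 1 q t' v a" "I_int 1 q t a = I_int 1 q t' a"
    by (simp_all add: J_int_def I_int_def)
qed

theorem proposition1p6:
  fixes n :: nat and q t v :: complex and a :: "nat \<Rightarrow> complex"
  assumes "n \<ge> 1"
    and "q \<noteq> 0" and "norm q < 1"
    and "v \<noteq> 0"
    and "\<And>i. i \<in> {1..6} \<Longrightarrow> norm (a i) < 1"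
    and "norm t < 1"
    and "q = a 1 * a 2 * a 3 * a 4 * a 5 * a 6 * t ^ (2 * n - 2)"
    and "I_int n q t a \<noteq> 0"
  shows "J_int n q t v a / I_int n q t a =
    (\<Prod>i=1..n.
       ((\<Prod>l=1..2. theta (t ^ (i - 1) * a l * v) q) *
        (\<Prod>j=3..5. \<Prod>k\<in>{j<..5}. theta (t ^ (i - 1) * a j * a k) q)) /
       (\<Prod>l=1..2. theta (t ^ (i - 1) * a l * a 6) q))"
proof -
  interpret nome q using assms(2,3) by unfold_locales
  have a: "a i \<noteq> 0 \<and> norm (a i) < 1" if "i \<in> {1..6}" for i
  proof -
    \<comment> \<open>None of the \<open>a i\<close> vanishes, since each divides the nonzero number
      \<open>q\<close> in the balancing condition.\<close>
    have "i = 1 \<or> i = 2 \<or> i = 3 \<or> i = 4 \<or> i = 5 \<or> i = 6" using that by auto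
    then show ?thesis using assms(2,5,7) that by auto
  qed
  \<comment> \<open>For \<open>n = 1\<close> the parameter \<open>t\<close> may vanish, but then nothing depends on it.\<close>
  define t' where "t' = (if n = 1 then 1 / 2 else t)"
  have "t \<noteq> 0" if "n \<noteq> 1"
    using assms(1,2,7) that by (auto simp: power_0_left)
  then have t': "t' \<noteq> 0" "norm t' < 1"
    using assms(6) by (auto simp: t'_def norm_divide)
  have pow: "t' ^ (i - 1) = t ^ (i - 1)" if "i \<in> {1..n}" for i
    using that by (auto simp: t'_def)
  have pow2: "t' ^ (2 * n - 2) = t ^ (2 * n - 2)" by (auto simp: t'_def)
  have ints: "J_int n q t v a = J_int n q t' v a" "I_int n q t a = I_int n q t' a"
    using J_int_I_int_1_independent_of_t by (auto simp: t'_def)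
  have bal: "q = a 1 * a 2 * a 3 * a 4 * a 5 * a 6 * t' ^ (2 * n - 2)"
    using assms(7) by (simp only: pow2)
  have nz: "v_product n t' a (a 6) \<noteq> 0"
    by (rule v_product_a6_nonzero[OF t' assms(1) a bal])
  have "J_int n q t v a / I_int n q t a = v_product n t' a v * a_product n t' a / v_product n t' a (a 6)"
    using J_general[OF t' assms(4,1) a bal] nz assms(8) by (simp add: ints field_simps)
  also have "\<dots> = v_product n t a v * a_product n t a / v_product n t a (a 6)"
  proof -
    have "v_product n t' a w = v_product n t a w" for w
      unfolding v_product_def by (intro prod.cong refl) (simp only: pow)
    moreover have "a_product n t' a = a_product n t a"
      unfolding a_product_def by (intro prod.cong refl) (simp only: pow)
    ultimately show ?thesis by simp
  qed
  finally show ?thesis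
    by (simp only: v_product_def a_product_def prod.distrib prod_dividef)
qed

end
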